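(* Let $a,k\in\mathbb N_{\ge1}$ be constants and $\epsilon\in[0,1)$ a constant. Let $\mathcal A$ be an algorithm that, for any unweighted graph $G'$ with $n'$ nodes and $m'$ edges, computes an $(a+\epsilon,k)$-approximation for all-pairs shortest paths in time $\tau_{\mathcal A}(n',m')$. Then, given an unweighted graph $G=(V,E)$ with $n$ nodes and $m$ edges, one can compute an $(a+(k+2)\epsilon,0)$-approximation for all-pairs shortest paths in $G$ in time $\tau_{\mathcal A}(n+km,(k+1)m)$. Moreover, if $\mathcal A$ is a dynamic algorithm, then the resulting dynamic algorithm for $G$ processes each update in $(k+1)$ times the update time of $\mathcal A$, and its query time equals that of $\mathcal A$ up to a constant factor.
   Context: For $\alpha\ge1,\beta\ge0$, an $(\alpha,\beta)$-approximation for all-pairs shortest paths is a collection of estimates $\hat d(u,v)$ for all node pairs with $d_G(u,v)\le \hat d(u,v)\le \alpha\, d_G(u,v)+\beta$, where $d_G$ is the shortest-path (hop) distance. *)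

theory Defs
  imports Complex_Main "HOL-Library.Extended_Real"
begin

subsection \<open>Unweighted graphs and hop distance\<close>

text \<open>Nodes are \<open>0, \<dots>, n - 1\<close>; edges are two-element sets of nodes.\<close>

definition ugraph :: "nat \<Rightarrow> nat set set \<Rightarrow> bool" where
  "ugraph n E \<longleftrightarrow> E \<subseteq> {{u, v} |u v. u < n \<and> v < n \<and> u \<noteq> v}"

definition walk :: "nat set set \<Rightarrow> nat \<Rightarrow> nat list \<Rightarrow> nat \<Rightarrow> bool" where
  "walk E u p v \<longleftrightarrow> p \<noteq> [] \<and> hd p = u \<and> last p = v \<and> successively (\<lambda>x y. {x, y} \<in> E) p"

text \<open>The infimum over the empty set is \<open>\<infinity>\<close>, the distance of nodes in different components.\<close>

definition hop_dist :: "nat set set \<Rightarrow> nat \<Rightarrow> nat \<Rightarrow> enat" where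
  "hop_dist E u v = (INF p \<in> {p. walk E u p v}. enat (length p - 1))"

definition good_estimate ::
    "real \<Rightarrow> real \<Rightarrow> nat set set \<Rightarrow> nat \<Rightarrow> nat \<Rightarrow> ereal \<Rightarrow> bool" where
  "good_estimate \<alpha> \<beta> E u v x \<longleftrightarrow>
     ereal_of_enat (hop_dist E u v) \<le> x \<and>
     x \<le> ereal \<alpha> * ereal_of_enat (hop_dist E u v) + ereal \<beta>"

definition apsp_approx ::
    "real \<Rightarrow> real \<Rightarrow> nat \<Rightarrow> nat set set \<Rightarrow> (nat \<Rightarrow> nat \<Rightarrow> ereal) \<Rightarrow> bool" where
  "apsp_approx \<alpha> \<beta> n E d \<longleftrightarrow> (\<forall>u<n. \<forall>v<n. good_estimate \<alpha> \<beta> E u v (d u v))"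

subsection \<open>Word RAM programs\<close>

text \<open>
  A deterministic word RAM with structured control flow, finitely many registers and finitely many
  randomly accessible arrays per program. Every instruction and every evaluation of a branching
  condition costs one step.
\<close>

datatype operand = Const nat | Reg string

datatype binop = Add | Sub | Mul | Div

datatype cond = Less operand operand | Equal operand operand

datatype com =
    Skip
  | Move string operand
  | Arith string binop operand operand
  | Load string string operand
  | Store string operand operand
  | Seq com com
  | If cond com com
  | While cond com

record state =
  regs :: "string \<Rightarrow> nat"
  arrs :: "string \<Rightarrow> nat \<Rightarrow> nat"

primrec val :: "operand \<Rightarrow> state \<Rightarrow> nat" where
  "val (Const c) s = c"
| "val (Reg r) s = regs s r"

primrec arith :: "binop \<Rightarrow> nat \<Rightarrow> nat \<Rightarrow> nat" where
  "arith Add x y = x + y"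
| "arith Sub x y = x - y"
| "arith Mul x y = x * y"
| "arith Div x y = x div y"

primrec holds :: "cond \<Rightarrow> state \<Rightarrow> bool" where
  "holds (Less x y) s \<longleftrightarrow> val x s < val y s"
| "holds (Equal x y) s \<longleftrightarrow> val x s = val y s"

definition set_reg :: "string \<Rightarrow> nat \<Rightarrow> state \<Rightarrow> state" where
  "set_reg r x s = s\<lparr>regs := (regs s)(r := x)\<rparr>"

definition set_cell :: "string \<Rightarrow> nat \<Rightarrow> nat \<Rightarrow> state \<Rightarrow> state" where
  "set_cell a i x s = s\<lparr>arrs := (arrs s)(a := (arrs s a)(i := x))\<rparr>"

text \<open>
  \<open>exec W c s t s'\<close>: started in \<open>s\<close>, program \<open>c\<close> halts in \<open>s'\<close> after \<open>t\<close> steps. A machine word holds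
  the numbers below \<open>W\<close>; a program that produces a larger number is stuck.
\<close>

inductive exec :: "nat \<Rightarrow> com \<Rightarrow> state \<Rightarrow> nat \<Rightarrow> state \<Rightarrow> bool" for W :: nat where
  Skip: "exec W Skip s 1 s"
| Move: "val x s < W \<Longrightarrow> exec W (Move r x) s 1 (set_reg r (val x s) s)"
| Arith: "arith b (val x s) (val y s) < W \<Longrightarrow>
    exec W (Arith r b x y) s 1 (set_reg r (arith b (val x s) (val y s)) s)"
| Load: "arrs s a (val i s) < W \<Longrightarrow> exec W (Load r a i) s 1 (set_reg r (arrs s a (val i s)) s)"
| Store: "val x s < W \<Longrightarrow> exec W (Store a i x) s 1 (set_cell a (val i s) (val x s) s)"
| Seq: "exec W c1 s t1 s1 \<Longrightarrow> exec W c2 s1 t2 s2 \<Longrightarrow> exec W (Seq c1 c2) s (t1 + t2) s2"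
| IfTrue: "holds b s \<Longrightarrow> exec W c1 s t s' \<Longrightarrow> exec W (If b c1 c2) s (1 + t) s'"
| IfFalse: "\<not> holds b s \<Longrightarrow> exec W c2 s t s' \<Longrightarrow> exec W (If b c1 c2) s (1 + t) s'"
| WhileFalse: "\<not> holds b s \<Longrightarrow> exec W (While b c) s 1 s"
| WhileTrue: "holds b s \<Longrightarrow> exec W c s t1 s1 \<Longrightarrow> exec W (While b c) s1 t2 s2 \<Longrightarrow>
    exec W (While b c) s (1 + t1 + t2) s2"

text \<open>Word length \<open>c * log 2 (N + 2)\<close>, that is, logarithmic in the problem size \<open>N\<close>.\<close>

definition word_bound :: "nat \<Rightarrow> nat \<Rightarrow> nat" where
  "word_bound c N = (N + 2) ^ c"

subsection \<open>Input and output conventions\<close>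

text \<open>Each edge is listed exactly once, in arbitrary order and orientation.\<close>

definition lists_edges :: "(nat \<times> nat) list \<Rightarrow> nat set set \<Rightarrow> bool" where
  "lists_edges es E \<longleftrightarrow>
     distinct (map (\<lambda>(u, v). {u, v}) es) \<and> set (map (\<lambda>(u, v). {u, v}) es) = E"

definition graph_input :: "nat \<Rightarrow> (nat \<times> nat) list \<Rightarrow> state" where
  "graph_input n es =
     \<lparr>regs = (\<lambda>_. 0)(''n'' := n, ''m'' := length es),
      arrs = (\<lambda>_ _. 0)
        (''src'' := (\<lambda>i. if i < length es then fst (es ! i) else 0),
         ''dst'' := (\<lambda>i. if i < length es then snd (es ! i) else 0))\<rparr>"

text \<open>
  An estimate is a fraction \<open>p / q\<close>, with \<open>p / 0\<close> for \<open>p > 0\<close> denoting \<open>\<infinity>\<close>. The pair \<open>(0, 0)\<close>, the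
  content of untouched memory, is no estimate: an algorithm has to write down every estimate.
\<close>

definition is_estimate :: "nat \<Rightarrow> nat \<Rightarrow> bool" where
  "is_estimate p q \<longleftrightarrow> p \<noteq> 0 \<or> q \<noteq> 0"

definition estimate :: "nat \<Rightarrow> nat \<Rightarrow> ereal" where
  "estimate p q = (if q = 0 then \<infinity> else ereal (real p / real q))"

subsection \<open>Static algorithms\<close>

text \<open>The estimate for \<open>(u, v)\<close> is stored at index \<open>u * n + v\<close> of the arrays \<open>num\<close> and \<open>den\<close>.\<close>

definition static_apsp :: "real \<Rightarrow> real \<Rightarrow> com \<Rightarrow> (nat \<Rightarrow> nat \<Rightarrow> nat) \<Rightarrow> bool" where
  "static_apsp \<alpha> \<beta> A \<tau> \<longleftrightarrow>
     (\<exists>c. \<forall>n E es. ugraph n E \<and> lists_edges es E \<longrightarrow>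
       (\<exists>t s. exec (word_bound c (n + card E)) A (graph_input n es) t s \<and>
          t \<le> \<tau> n (card E) \<and>
          (\<forall>u<n. \<forall>v<n. is_estimate (arrs s ''num'' (u * n + v)) (arrs s ''den'' (u * n + v))) \<and>
          apsp_approx \<alpha> \<beta> n E
            (\<lambda>u v. estimate (arrs s ''num'' (u * n + v)) (arrs s ''den'' (u * n + v)))))"

subsection \<open>Dynamic algorithms\<close>

text \<open>
  The node set of a dynamic graph is fixed, the edge set changes by insertions and deletions of
  single edges, and \<open>m\<close> bounds the number of edges at all times. The set \<open>K\<close> of admissible kinds of
  updates distinguishes incremental, decremental and fully dynamic algorithms.
\<close>

datatype kind = Insert | Delete

datatype guarantee = Worst_Case | Amortized

record dyn_alg =
  prep_prog :: com
  upd_prog :: "kind \<Rightarrow> com"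
  qry_prog :: com

primrec valid_update ::
    "kind \<Rightarrow> nat \<Rightarrow> nat \<Rightarrow> nat set set \<Rightarrow> nat \<Rightarrow> nat \<Rightarrow> bool" where
  "valid_update Insert n m E u v \<longleftrightarrow> u < n \<and> v < n \<and> u \<noteq> v \<and> {u, v} \<notin> E \<and> card E < m"
| "valid_update Delete n m E u v \<longleftrightarrow> {u, v} \<in> E"

primrec apply_update :: "kind \<Rightarrow> nat set set \<Rightarrow> nat \<Rightarrow> nat \<Rightarrow> nat set set" where
  "apply_update Insert E u v = insert {u, v} E"
| "apply_update Delete E u v = E - {{u, v}}"

definition dyn_input :: "nat \<Rightarrow> nat \<Rightarrow> (nat \<times> nat) list \<Rightarrow> state" where
  "dyn_input n m es = set_reg ''cap'' m (graph_input n es)"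

definition set_args :: "nat \<Rightarrow> nat \<Rightarrow> state \<Rightarrow> state" where
  "set_args u v s = set_reg ''v'' v (set_reg ''u'' u s)"

text \<open>
  \<open>dyn_reach c K D n m E s i j T\<close>: some run of \<open>D\<close> has processed \<open>i\<close> operations, \<open>j\<close> of them updates,
  now stores the graph with edge set \<open>E\<close> in memory state \<open>s\<close>, and has spent \<open>T\<close> steps on preprocessing
  and updates. Words have length logarithmic in the graph size and the number of operations so far.
\<close>

inductive dyn_reach ::
    "nat \<Rightarrow> kind set \<Rightarrow> dyn_alg \<Rightarrow> nat \<Rightarrow> nat \<Rightarrow>
     nat set set \<Rightarrow> state \<Rightarrow> nat \<Rightarrow> nat \<Rightarrow> nat \<Rightarrow> bool"
  for c :: nat and K :: "kind set" and D :: dyn_alg and n m :: nat where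
  start:
    "ugraph n E \<Longrightarrow> lists_edges es E \<Longrightarrow> card E \<le> m \<Longrightarrow>
     exec (word_bound c (n + m)) (prep_prog D) (dyn_input n m es) t s \<Longrightarrow>
     dyn_reach c K D n m E s 0 0 t"
| update:
    "dyn_reach c K D n m E s i j T \<Longrightarrow> \<kappa> \<in> K \<Longrightarrow> valid_update \<kappa> n m E u v \<Longrightarrow>
     exec (word_bound c (n + m + i)) (upd_prog D \<kappa>) (set_args u v s) t s' \<Longrightarrow>
     dyn_reach c K D n m (apply_update \<kappa> E u v) s' (Suc i) (Suc j) (T + t)"
| query:
    "dyn_reach c K D n m E s i j T \<Longrightarrow> u < n \<Longrightarrow> v < n \<Longrightarrow>
     exec (word_bound c (n + m + i)) (qry_prog D) (set_args u v s) t s' \<Longrightarrow>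
     dyn_reach c K D n m E s' (Suc i) j T"

text \<open>
  Preprocessing time \<open>P\<close>, update time \<open>U\<close> and query time \<open>Q\<close>. With an amortized guarantee,
  preprocessing followed by any \<open>j\<close> updates takes at most \<open>P + j * U\<close> steps in total.
\<close>

definition dynamic_apsp ::
    "guarantee \<Rightarrow> kind set \<Rightarrow> real \<Rightarrow> real \<Rightarrow> dyn_alg \<Rightarrow>
     (nat \<Rightarrow> nat \<Rightarrow> nat) \<Rightarrow> (nat \<Rightarrow> nat \<Rightarrow> nat) \<Rightarrow> (nat \<Rightarrow> nat \<Rightarrow> nat) \<Rightarrow> bool" where
  "dynamic_apsp g K \<alpha> \<beta> D P U Q \<longleftrightarrow>
     (\<exists>c. \<forall>n m.
       (\<forall>E es. ugraph n E \<and> lists_edges es E \<and> card E \<le> m \<longrightarrow>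
          (\<exists>t s. exec (word_bound c (n + m)) (prep_prog D) (dyn_input n m es) t s \<and> t \<le> P n m)) \<and>
       (\<forall>E s i j T. dyn_reach c K D n m E s i j T \<longrightarrow>
          (g = Amortized \<longrightarrow> T \<le> P n m + j * U n m) \<and>
          (\<forall>\<kappa>\<in>K. \<forall>u v. valid_update \<kappa> n m E u v \<longrightarrow>
             (\<exists>t s'. exec (word_bound c (n + m + i)) (upd_prog D \<kappa>) (set_args u v s) t s' \<and>
                (g = Worst_Case \<longrightarrow> t \<le> U n m))) \<and>
          (\<forall>u<n. \<forall>v<n.
             \<exists>t s'. exec (word_bound c (n + m + i)) (qry_prog D) (set_args u v s) t s' \<and>
                t \<le> Q n m \<and>
                is_estimate (regs s' ''num'') (regs s' ''den'') \<and>
                good_estimate \<alpha> \<beta> E u v (estimate (regs s' ''num'') (regs s' ''den'')))))"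

end

theory Submission
  imports Defs
begin

text \<open>
  Subdividing every edge of \<open>G\<close> into \<open>k + 1\<close> edges multiplies all distances by \<open>k + 1\<close>, so an estimate \<open>x\<close> for
  the subdivided graph satisfies \<open>d \<le> x / (k + 1) \<le> (a + \<epsilon>) d + k / (k + 1)\<close>. Since \<open>d\<close> is an integer, rounding
  \<open>x / (k + 1)\<close> down keeps the lower bound. If \<open>\<epsilon> d < 1 / (k + 1)\<close>, rounding yields at most \<open>a d\<close>; otherwise the
  additive term is at most \<open>k \<epsilon> d\<close>.

  A static algorithm has to write the estimates of all pairs and so takes at least quadratic time, which
  pays for subdividing and rounding. A dynamic one is run on a graph with \<open>m\<close> slots of \<open>k\<close> spare nodes
  each; a stack of free slots and a table from node pairs to slots turn every update into \<open>k + 1\<close> updates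
  with constant overhead. The registers in which the simulated algorithm delivers its answer are saved
  and restored, because the reported answer is the rounded one.
\<close>

section \<open>Hop distance\<close>

text \<open>A program that produces a value too large for a word is stuck, so every time bound has
  to come with a bound on the word length. If the new instance has size parameter \<open>N\<close>,
  that of the simulated one is below \<open>(2 * k + 2) * (N + 2)\<close>; since words hold numbers
  below a power of \<open>N + 2 \<ge> 2\<close>, a larger constant exponent absorbs this factor and
  leaves room for products of two indices. The given algorithm is an unknown program. Its code runs
  verbatim in a larger memory whose additional registers and arrays have names that it does not
  mention, so its effect is known from a run in the memory it expects. In the dynamic case that run
  is a genuine one on the subdivided graph, in which a path may be present only in part; every such
  intermediate graph is legal and within capacity, so even an amortized guarantee, which speaks only
  of totals over a whole run, carries over. Distances are compared through potentials on nodes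
  instead of surgery on walks.\<close>

lemma hop_dist_le: "walk E u p v \<Longrightarrow> hop_dist E u v \<le> enat (length p - 1)"
  unfolding hop_dist_def by (rule INF_lower) simp

text \<open>A nonempty set of \<open>enat\<close> values contains its infimum, so a finite distance
  is attained by a shortest walk.\<close>

lemma hop_dist_cases:
  obtains "hop_dist E u v = \<infinity>"
  | p where "walk E u p v" "hop_dist E u v = enat (length p - 1)"
proof (cases "\<exists>p. walk E u p v")
  case True
  let ?S = "(\<lambda>p. enat (length p - 1)) ` {p. walk E u p v}"
  have "?S \<noteq> {}" using True by auto
  then have "Inf ?S \<in> ?S" unfolding Inf_enat_def by (auto intro: LeastI)
  then show ?thesis using that(2) unfolding hop_dist_def by auto
next
  case False
  then show ?thesis using that(1) by (auto simp: hop_dist_def top_enat_def)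
qed

lemma hop_dist_self [simp]: "hop_dist E u u = 0"
proof -
  have "walk E u [u] u" by (simp add: walk_def)
  from hop_dist_le[OF this] show ?thesis by (simp add: zero_enat_def[symmetric])
qed

lemma hop_dist_edge:
  assumes "{x, y} \<in> E"
  shows "hop_dist E u y \<le> hop_dist E u x + 1"
proof (cases rule: hop_dist_cases[of E u x])
  case (2 p)
  then have "walk E u (p @ [y]) y"
    using assms by (auto simp: walk_def successively_append_iff)
  from hop_dist_le[OF this] show ?thesis
    using 2 by (cases p) (auto simp: walk_def one_enat_def)
qed simp

text \<open>The growth is summed along a shortest walk. Graphs are compared by a choice of
  \<open>\<phi>\<close>, so no walk has to be translated from one graph to the other. Positivity of
  \<open>c\<close> covers unreachable nodes, since \<open>0 * \<infinity>\<close> is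
  \<open>0\<close> in \<open>enat\<close>.\<close>

lemma hop_dist_potential:
  fixes \<phi> :: "nat \<Rightarrow> enat"
  assumes step: "\<And>x y. {x, y} \<in> E \<Longrightarrow> \<phi> y \<le> \<phi> x + enat c" and "c > 0"
  shows "\<phi> v \<le> \<phi> u + enat c * hop_dist E u v"
proof (cases rule: hop_dist_cases[of E u v])
  case 1
  then show ?thesis using \<open>c > 0\<close> by (simp add: imult_is_infinity zero_enat_def)
next
  case (2 p)
  have "walk E u p v \<Longrightarrow> \<phi> v \<le> \<phi> u + enat (c * (length p - 1))" for u
  proof (induction p arbitrary: u)
    case Nil
    then show ?case by (simp add: walk_def)
  next
    case (Cons x q)
    show ?case
    proof (cases q)
      case Nil
      then show ?thesis using Cons.prems by (auto simp: walk_def zero_enat_def[symmetric])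
    next
      case (Cons y r)
      have w: "walk E y q v" and e: "{u, y} \<in> E"
        using Cons.prems Cons by (auto simp: walk_def)
      have "\<phi> v \<le> \<phi> y + enat (c * (length q - 1))" by (rule Cons.IH[OF w])
      also have "\<dots> \<le> \<phi> u + enat c + enat (c * (length q - 1))"
        by (intro add_right_mono step e)
      also have "\<dots> = \<phi> u + enat (c * (length (x # q) - 1))"
        using Cons by (simp add: add.assoc)
      finally show ?thesis .
    qed
  qed
  then show ?thesis using 2 by simp
qed

section \<open>Subdivision\<close>

text \<open>
  A slot \<open>b\<close> owns the nodes \<open>n + b * k, \<dots>, n + b * k + k - 1\<close> and subdivides the edge with end nodes \<open>f b\<close>
  into the path with nodes \<open>node n k f b j\<close> for \<open>j \<le> k + 1\<close>.
\<close>

definition ends :: "(nat \<Rightarrow> nat \<times> nat) \<Rightarrow> nat \<Rightarrow> nat set" where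
  "ends f b = {fst (f b), snd (f b)}"

definition node :: "nat \<Rightarrow> nat \<Rightarrow> (nat \<Rightarrow> nat \<times> nat) \<Rightarrow> nat \<Rightarrow> nat \<Rightarrow> nat" where
  "node n k f b j =
     (if j = 0 then fst (f b) else if j = Suc k then snd (f b) else n + b * k + (j - 1))"

text \<open>The argument is a single pair, so the edge set is the image of
  \<open>B \<times> {..k}\<close>, and a path that is present only in part is the image of a subset
  of that product.\<close>

definition seg :: "nat \<Rightarrow> nat \<Rightarrow> (nat \<Rightarrow> nat \<times> nat) \<Rightarrow> nat \<times> nat \<Rightarrow> nat set" where
  "seg n k f = (\<lambda>(b, j). {node n k f b j, node n k f b (Suc j)})"

text \<open>\<open>f\<close> is a total function because slots are freed and reused; only its values
  on \<open>B\<close> count. Injectivity of \<open>ends f\<close> keeps an edge from occupying two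
  slots, in whichever orientation it is stored.\<close>

definition slots :: "nat \<Rightarrow> nat \<Rightarrow> (nat \<Rightarrow> nat \<times> nat) \<Rightarrow> nat set \<Rightarrow> bool" where
  "slots n m f B \<longleftrightarrow> B \<subseteq> {..<m} \<and>
     (\<forall>b\<in>B. fst (f b) < n \<and> snd (f b) < n \<and> fst (f b) \<noteq> snd (f b)) \<and> inj_on (ends f) B"

lemma slots_finite: "slots n m f B \<Longrightarrow> finite B"
  using finite_subset by (auto simp: slots_def)

lemma slots_mono: "slots n m f B \<Longrightarrow> A \<subseteq> B \<Longrightarrow> slots n m f A"
  by (auto simp: slots_def intro: inj_on_subset)

lemma node_less:
  assumes "slots n m f B" "b \<in> B" "j \<le> Suc k"
  shows "node n k f b j < n + k * m"
proof -
  have b: "fst (f b) < n" "snd (f b) < n" "b < m" using assms by (auto simp: slots_def)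
  have "b * k + k \<le> k * m" using mult_le_mono1[of "Suc b" m k] b by (simp add: mult.commute)
  then show ?thesis using b assms(3) by (auto simp: node_def)
qed

text \<open>The offset \<open>b * k + (j - 1)\<close> is a two-digit number in base
  \<open>k\<close>, so quotient and remainder recover slot and position.\<close>

lemma node_inner:
  assumes "0 < j" "j \<le> k"
  shows "n \<le> node n k f b j" "(node n k f b j - n) div k = b"
    "(node n k f b j - n) mod k = j - 1"
proof -
  have "node n k f b j = n + (b * k + (j - 1))" "j - 1 < k"
    using assms by (auto simp: node_def)
  then show "n \<le> node n k f b j" "(node n k f b j - n) div k = b"
    "(node n k f b j - n) mod k = j - 1"
    by (simp_all add: div_add1_eq)
qed

lemma node_inner_eq_iff:
  assumes "0 < j" "j \<le> k" "0 < j'" "j' \<le> k"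
  shows "node n k f b j = node n k f b' j' \<longleftrightarrow> b = b' \<and> j = j'"
proof
  assume e: "node n k f b j = node n k f b' j'"
  have "b = b'" using node_inner(2)[of j k n f b] node_inner(2)[of j' k n f b'] assms e by simp
  moreover have "j - 1 = j' - 1"
    using node_inner(3)[of j k n f b] node_inner(3)[of j' k n f b'] assms e by simp
  ultimately show "b = b' \<and> j = j'" using assms by simp
qed simp

lemma node_outer:
  assumes "slots n m f B" "b \<in> B"
  shows "node n k f b 0 < n" "node n k f b (Suc k) < n" "node n k f b 0 \<noteq> node n k f b (Suc k)"
  using assms by (auto simp: node_def slots_def)

lemma node_neq_Suc:
  assumes "slots n m f B" "b \<in> B" "1 \<le> k" "j \<le> k"
  shows "node n k f b j \<noteq> node n k f b (Suc j)"
proof -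
  consider "j = 0" | "0 < j" "j = k" | "0 < j" "j < k" using assms(4) by linarith
  then show ?thesis
  proof cases
    case 1
    then show ?thesis
      using node_outer(1)[OF assms(1,2), of k] node_inner(1)[of "Suc j" k n f b] assms by force
  next
    case 2
    then show ?thesis
      using node_outer(2)[OF assms(1,2), of k] node_inner(1)[of j k n f b] by force
  next
    case 3
    then show ?thesis using node_inner_eq_iff[of j k "Suc j" n f b b] by simp
  qed
qed

text \<open>Since \<open>k \<ge> 1\<close>, each piece contains an inner node, which determines slot
  and position. The delicate case is a match with the two nodes exchanged: the inner node then
  leaves only adjacent pieces of one path, and these could coincide only for \<open>k = 1\<close>
  with equal end nodes, which is excluded.\<close>

lemma inj_on_seg:
  assumes S: "slots n m f B" and "1 \<le> k"
  shows "inj_on (seg n k f) (B \<times> {..k})"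
proof (rule inj_onI, clarsimp)
  fix b j b' j'
  assume b: "b \<in> B" "b' \<in> B" and j: "j \<le> k" "j' \<le> k"
    and eq: "seg n k f (b, j) = seg n k f (b', j')"
  have inner: "n \<le> node n k f c i \<longleftrightarrow> 0 < i \<and> i \<le> k" if "c \<in> B" "i \<le> Suc k" for c i
    using node_outer[OF S that(1), of k] node_inner(1)[of i k n f c] that
    by (cases "i = 0"; cases "i = Suc k") auto
  have in_eq: "c = c' \<and> i = i'"
    if "node n k f c i = node n k f c' i'" "c \<in> B" "c' \<in> B" "0 < i" "i \<le> k" "i' \<le> Suc k"
    for c c' i i'
    using inner[of c i] inner[of c' i'] node_inner_eq_iff[of i k i' n f c c'] that by auto
  from eq consider
      (a) "node n k f b j = node n k f b' j'" "node n k f b (Suc j) = node n k f b' (Suc j')"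
    | (b) "node n k f b j = node n k f b' (Suc j')" "node n k f b (Suc j) = node n k f b' j'"
    unfolding seg_def by (auto simp: doubleton_eq_iff)
  then show "b = b' \<and> j = j'"
  proof cases
    case a
    show ?thesis
    proof (cases "0 < j")
      case True
      then show ?thesis using in_eq[OF a(1) b] j by simp
    next
      case False
      then show ?thesis using in_eq[OF a(2) b] j \<open>1 \<le> k\<close> by simp
    qed
  next
    case b': b
    show ?thesis
    proof (cases "0 < j")
      case True
      then have 1: "b = b'" "j = Suc j'" using in_eq[OF b'(1) b] j by simp_all
      show ?thesis
      proof (cases "j < k")
        case True
        then show ?thesis using in_eq[OF b'(2) b] j 1 by simp
      next
        case False
        show ?thesis
        proof (cases "j' = 0")
          case True
          then have "node n k f b (Suc k) = node n k f b 0" using b'(2) 1 False j by simp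
          then show ?thesis using node_outer(3)[OF S b(1), of k] by simp
        next
          case f: False
          then show ?thesis using in_eq[OF b'(2)[symmetric] b(2,1)] 1 j by simp
        qed
      qed
    next
      case False
      then have "b = b'" "Suc j = j'" using in_eq[OF b'(2) b] j \<open>1 \<le> k\<close> by simp_all
      moreover have "node n k f b 0 = node n k f b' (Suc j')" using False b'(1) by simp
      moreover have "n \<le> node n k f b' (Suc j')" if "Suc j' \<le> k"
        using inner[of b' "Suc j'"] b that by simp
      ultimately show ?thesis
        using node_outer[OF S b(1), of k] j by (metis le_antisym not_le not_less_eq_eq)
    qed
  qed
qed

lemma seg_ugraph:
  assumes S: "slots n m f B" and "1 \<le> k"
  shows "ugraph (n + k * m) (seg n k f ` (B \<times> {..k}))"
  unfolding ugraph_def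
proof (intro subsetI, elim imageE SigmaE, clarsimp)
  fix b j assume b: "b \<in> B" "j \<le> k"
  show "\<exists>u v. seg n k f (b, j) = {u, v} \<and> u < n + k * m \<and> v < n + k * m \<and> u \<noteq> v"
    using node_less[OF S b(1)] node_neq_Suc[OF S b(1) \<open>1 \<le> k\<close>] b(2)
    by (intro exI[of _ "node n k f b j"] exI[of _ "node n k f b (Suc j)"]) (auto simp: seg_def)
qed

text \<open>Each inequality exhibits a potential. The distance from \<open>u\<close> in the
  subdivided graph grows by at most \<open>k + 1\<close> along an original edge; conversely,
  \<open>k + 1\<close> times the original distance extends to the inner nodes in such a way that it
  changes by at most 1 along a piece.\<close>

lemma hop_dist_subdivision:
  assumes S: "slots n m f B" and "1 \<le> k" and uv: "u < n" "v < n"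
  shows "hop_dist (seg n k f ` (B \<times> {..k})) u v = enat (Suc k) * hop_dist (ends f ` B) u v"
    (is "hop_dist ?E' u v = _ * hop_dist ?E u v")
proof (rule antisym)
  have seg_edge: "{node n k f b j, node n k f b (Suc j)} \<in> ?E'" if "b \<in> B" "j \<le> k" for b j
    using that by (force simp: seg_def)
  have fwd: "hop_dist ?E' u (node n k f b j) \<le> hop_dist ?E' u (node n k f b 0) + enat j"
    if "b \<in> B" "j \<le> Suc k" for b j
    using that(2)
  proof (induction j)
    case (Suc j)
    have "hop_dist ?E' u (node n k f b (Suc j)) \<le> hop_dist ?E' u (node n k f b j) + 1"
      using seg_edge Suc that by (intro hop_dist_edge) auto
    also have "\<dots> \<le> hop_dist ?E' u (node n k f b 0) + enat j + 1"
      using Suc by (intro add_right_mono) auto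
    finally show ?case by (simp add: add.assoc one_enat_def)
  qed (simp add: zero_enat_def[symmetric])
  \<comment> \<open>A slot fixes one orientation of its edge, but the potential must be bounded in
    both directions, so the path is also followed backwards.\<close>
  have bwd: "hop_dist ?E' u (node n k f b (Suc k - j)) \<le> hop_dist ?E' u (node n k f b (Suc k)) + enat j"
    if "b \<in> B" "j \<le> Suc k" for b j
    using that(2)
  proof (induction j)
    case (Suc j)
    have "{node n k f b (Suc k - j), node n k f b (Suc k - Suc j)} \<in> ?E'"
      using seg_edge[of b "Suc k - Suc j"] Suc that by (simp add: insert_commute Suc_diff_le)
    then have "hop_dist ?E' u (node n k f b (Suc k - Suc j)) \<le> hop_dist ?E' u (node n k f b (Suc k - j)) + 1"
      by (rule hop_dist_edge)
    also have "\<dots> \<le> hop_dist ?E' u (node n k f b (Suc k)) + enat j + 1"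
      using Suc by (intro add_right_mono) auto
    finally show ?case by (simp add: add.assoc one_enat_def)
  qed (simp add: zero_enat_def[symmetric])
  have "hop_dist ?E' u v \<le> hop_dist ?E' u u + enat (Suc k) * hop_dist ?E u v"
  proof (rule hop_dist_potential)
    fix x y assume "{x, y} \<in> ?E"
    then obtain b where b: "b \<in> B" "{x, y} = {node n k f b 0, node n k f b (Suc k)}"
      by (auto simp: ends_def node_def)
    then consider "x = node n k f b 0" "y = node n k f b (Suc k)"
      | "y = node n k f b 0" "x = node n k f b (Suc k)"
      by (auto simp: doubleton_eq_iff)
    then show "hop_dist ?E' u y \<le> hop_dist ?E' u x + enat (Suc k)"
      using fwd[OF b(1), of "Suc k"] bwd[OF b(1), of "Suc k"] by cases auto
  qed simp
  then show "hop_dist ?E' u v \<le> enat (Suc k) * hop_dist ?E u v" by simp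
next
  let ?d = "\<lambda>w. enat (Suc k) * hop_dist ?E u w"
  \<comment> \<open>An inner node is reached from \<open>u\<close> through one end of its path or
    the other; \<open>\<psi>\<close> takes the cheaper way.\<close>
  define \<psi> where "\<psi> b j = min (?d (fst (f b)) + enat j) (?d (snd (f b)) + enat (Suc k - j))" for b j
  \<comment> \<open>Numbers from \<open>n\<close> on are decoded into slot and position. The
    remainder counts from 0 and the position from 1, hence the \<open>Suc\<close>.\<close>
  define \<phi> where "\<phi> w = (if w < n then ?d w else \<psi> ((w - n) div k) (Suc ((w - n) mod k)))" for w
  have d_edge: "?d y \<le> ?d x + enat (Suc k)" if "{x, y} \<in> ?E" for x y
  proof -
    have "?d y \<le> enat (Suc k) * (hop_dist ?E u x + 1)"
      by (intro mult_left_mono hop_dist_edge that) simp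
    then show ?thesis by (simp add: distrib_left)
  qed
  \<comment> \<open>At the ends of a path, \<open>\<psi>\<close> has to return the scaled distance
    itself: the way through the other end costs \<open>k + 1\<close> more pieces, and by
    \<open>d_edge\<close> it is not shorter.\<close>
  have \<phi>_node: "\<phi> (node n k f b j) = \<psi> b j" if bB: "b \<in> B" and jk: "j \<le> Suc k" for b j
  proof -
    have e: "{fst (f b), snd (f b)} \<in> ?E" using bB by (auto simp: ends_def)
    note d = d_edge[OF e] d_edge[OF e[unfolded insert_commute[of "fst (f b)"]]]
    have o: "node n k f b 0 = fst (f b)" "node n k f b (Suc k) = snd (f b)"
      by (simp_all add: node_def)
    consider "j = 0" | "j = Suc k" | "0 < j" "j \<le> k" using jk by force
    then show ?thesis
    proof cases
      case 1
      then show ?thesis using d node_outer[OF S bB, of k] o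
        by (simp add: \<phi>_def \<psi>_def zero_enat_def[symmetric] min_def)
    next
      case 2
      then show ?thesis using d node_outer[OF S bB, of k] o
        by (auto simp: \<phi>_def \<psi>_def zero_enat_def[symmetric] min_def)
    next
      case 3
      then show ?thesis using node_inner[OF 3, of n f b] by (simp add: \<phi>_def)
    qed
  qed
  have up: "\<psi> b (Suc j) \<le> \<psi> b j + enat 1" "\<psi> b j \<le> \<psi> b (Suc j) + enat 1" if "j \<le> k" for b j
    using that unfolding \<psi>_def
    by (cases "?d (fst (f b))"; cases "?d (snd (f b))"; auto simp: min_def)+
  have "\<phi> v \<le> \<phi> u + enat 1 * hop_dist ?E' u v"
  proof (rule hop_dist_potential)
    fix x y assume "{x, y} \<in> ?E'"
    then obtain b j where b: "b \<in> B" "j \<le> k" "{x, y} = {node n k f b j, node n k f b (Suc j)}"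
      by (auto simp: seg_def)
    then consider "x = node n k f b j" "y = node n k f b (Suc j)"
      | "y = node n k f b j" "x = node n k f b (Suc j)"
      by (auto simp: doubleton_eq_iff)
    then show "\<phi> y \<le> \<phi> x + enat 1"
      using up[OF b(2)] \<phi>_node[OF b(1)] b(2) by cases auto
  qed simp
  then show "enat (Suc k) * hop_dist ?E u v \<le> hop_dist ?E' u v"
    using uv by (simp add: \<phi>_def one_enat_def[symmetric, unfolded One_nat_def])
qed

section \<open>Rounding\<close>

lemma good_estimate_round:
  assumes S: "slots n m f B" and k: "1 \<le> k" and uv: "u < n" "v < n"
    and "1 \<le> a" "0 \<le> \<epsilon>"
    and good: "good_estimate (real a + \<epsilon>) (real k) (seg n k f ` (B \<times> {..k})) u v (estimate p q)"
  shows "good_estimate (real a + (real k + 2) * \<epsilon>) 0 (ends f ` B) u v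
     (if q = 0 then estimate p q else estimate (p div q div Suc k) 1)"
proof -
  let ?d = "hop_dist (ends f ` B) u v"
  note good = good[unfolded good_estimate_def hop_dist_subdivision[OF S k uv]]
  \<comment> \<open>A positive factor keeps the product with \<open>\<infinity>\<close> infinite,
    which the upper bound for unreachable pairs requires.\<close>
  have c: "ereal (real a + (real k + 2) * \<epsilon>) > 0" using \<open>1 \<le> a\<close> \<open>0 \<le> \<epsilon>\<close>
    by (simp add: add_pos_nonneg)
  show ?thesis
  proof (cases ?d)
    case infinity
    then have "q = 0" using good by (auto simp: estimate_def split: if_splits)
    then show ?thesis using infinity c by (simp add: good_estimate_def estimate_def)
  next
    case (enat d)
    \<comment> \<open>The upper bound is finite here, whereas denominator \<open>0\<close> would
      denote \<open>\<infinity>\<close>.\<close>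
    have "q \<noteq> 0" using good enat by (auto simp: estimate_def split: if_splits)
    define r where "r = real p / real q"
    have lo: "real (Suc k * d) \<le> r" and hi: "r \<le> (real a + \<epsilon>) * real (Suc k * d) + real k"
      using good enat \<open>q \<noteq> 0\<close> by (auto simp: estimate_def r_def)
    define e where "e = p div q div Suc k"
    \<comment> \<open>Nested integer divisions compose. The program can therefore divide twice and
      never forms \<open>q * Suc k\<close>, which might not fit into a word.\<close>
    have e: "e = nat \<lfloor>r / Suc k\<rfloor>"
    proof -
      have "e = p div (q * Suc k)" by (simp only: e_def div_mult2_eq)
      also have "\<dots> = nat \<lfloor>real p / real (q * Suc k)\<rfloor>" by (simp only: floor_divide_of_nat_eq nat_int)
      also have "real p / real (q * Suc k) = r / Suc k" by (simp only: r_def of_nat_mult divide_divide_eq_left)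
      finally show ?thesis .
    qed
    have "real d \<le> r / Suc k" using lo by (simp add: field_simps)
    then have "int d \<le> \<lfloor>r / Suc k\<rfloor>" by (simp add: le_floor_iff)
    then have de: "d \<le> e" and e_le: "real e \<le> r / Suc k" and e_int: "int e = \<lfloor>r / Suc k\<rfloor>"
      unfolding e by linarith+
    have r: "r / Suc k \<le> real a * d + \<epsilon> * d + real k / Suc k"
    proof -
      have "r / Suc k \<le> ((real a + \<epsilon>) * real (Suc k * d) + real k) / Suc k"
        by (intro divide_right_mono hi) simp
      also have "\<dots> = (real a + \<epsilon>) * d + real k / Suc k"
        by (simp only: add_divide_distrib of_nat_mult) simp
      finally show ?thesis by (simp add: distrib_right)
    qed
    have "real e \<le> (real a + (real k + 2) * \<epsilon>) * real d"
    proof (cases "\<epsilon> * d < 1 / Suc k")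
      case True
      \<comment> \<open>The threshold is the complement of \<open>k / (k + 1)\<close>, so the excess
        over \<open>a * d\<close> stays below 1. As \<open>a * d\<close> is an integer, rounding
        removes this excess entirely.\<close>
      have "\<epsilon> * d + real k / Suc k < 1" using True by (simp add: field_simps)
      then have "real e < real (a * d) + 1" using e_le r by simp
      then have "e < a * d + 1" by (metis of_nat_1 of_nat_add of_nat_less_iff)
      then have "real e \<le> real (a * d)" by (simp only: of_nat_le_iff)
      also have "\<dots> \<le> (real a + (real k + 2) * \<epsilon>) * real d"
        using \<open>0 \<le> \<epsilon>\<close> by (simp add: algebra_simps)
      finally show ?thesis .
    next
      case False
      then have "real k * (1 / Suc k) \<le> real k * (\<epsilon> * d)" by (intro mult_left_mono) auto
      then have "real e \<le> real a * d + \<epsilon> * d + real k * (\<epsilon> * d)" using e_le r by simp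
      also have "\<dots> \<le> (real a + (real k + 2) * \<epsilon>) * real d"
        using \<open>0 \<le> \<epsilon>\<close> by (simp add: algebra_simps)
      finally show ?thesis .
    qed
    then show ?thesis
      using de enat \<open>q \<noteq> 0\<close> by (simp add: good_estimate_def estimate_def e_def)
  qed
qed

section \<open>Word RAM programs\<close>

lemma regs_set_reg [simp]: "regs (set_reg r x s) = (regs s)(r := x)"
  and arrs_set_reg [simp]: "arrs (set_reg r x s) = arrs s"
  and regs_set_cell [simp]: "regs (set_cell a i x s) = regs s"
  and arrs_set_cell [simp]: "arrs (set_cell a i x s) = (arrs s)(a := (arrs s a)(i := x))"
  by (simp_all add: set_reg_def set_cell_def)

lemma regs_set_args [simp]: "regs (set_args u v s) = (regs s)(''u'' := u, ''v'' := v)"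
  and arrs_set_args [simp]: "arrs (set_args u v s) = arrs s"
  by (simp_all add: set_args_def)

lemmas exec_intros = exec.intros[simplified]

inductive_cases exec_SkipE: "exec W Skip s t s'"
inductive_cases exec_MoveE: "exec W (Move r x) s t s'"
inductive_cases exec_ArithE: "exec W (Arith r b x y) s t s'"
inductive_cases exec_LoadE: "exec W (Load r a i) s t s'"
inductive_cases exec_StoreE: "exec W (Store a i x) s t s'"
inductive_cases exec_SeqE: "exec W (Seq c1 c2) s t s'"
inductive_cases exec_IfE: "exec W (If b c1 c2) s t s'"
inductive_cases exec_WhileE: "exec W (While b c) s t s'"

text \<open>Reachable states of a dynamic algorithm come from arbitrary executions. Determinism
  identifies each of them, including its running time, with the execution constructed here.\<close>

lemma exec_deterministic:
  "exec W c s t s' \<Longrightarrow> exec W c s t2 s2 \<Longrightarrow> t2 = t \<and> s2 = s'"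
proof (induction arbitrary: t2 s2 rule: exec.induct)
  case (Seq c1 s t1 s1 c2 t2' s2')
  from Seq.prems obtain t3 s3 t4 where "exec W c1 s t3 s3" "exec W c2 s3 t4 s2" "t2 = t3 + t4"
    by (rule exec_SeqE) blast
  then show ?case using Seq.IH by blast
next
  case (WhileTrue b s c t1 s1 t2' s2')
  from WhileTrue.prems obtain t3 s3 t4
    where "exec W c s t3 s3" "exec W (While b c) s3 t4 s2" "t2 = Suc (t3 + t4)"
    by (rule exec_WhileE) (use WhileTrue.hyps in auto)
  then show ?case using WhileTrue.IH by fastforce
next
  case (WhileFalse b s c)
  from WhileFalse.prems show ?case
    by (rule exec_WhileE) (use WhileFalse.hyps in auto)
next
  case (IfTrue b s c1 t s' c2)
  from IfTrue.prems obtain t3 where "exec W c1 s t3 s2" "t2 = Suc t3"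
    by (rule exec_IfE) (use IfTrue.hyps in auto)
  then show ?case using IfTrue.IH by fastforce
next
  case (IfFalse b s c2 t s' c1)
  from IfFalse.prems obtain t3 where "exec W c2 s t3 s2" "t2 = Suc t3"
    by (rule exec_IfE) (use IfFalse.hyps in auto)
  then show ?case using IfFalse.IH by fastforce
qed (auto elim!: exec_SkipE exec_MoveE exec_ArithE exec_LoadE exec_StoreE)

text \<open>The word bound occurs only as an upper bound in premises, so longer words never
  hurt.\<close>

lemma exec_mono: "exec W c s t s' \<Longrightarrow> W \<le> W' \<Longrightarrow> exec W' c s t s'"
  by (induction rule: exec.induct) (auto intro: exec_intros)

lemma exec_pos: "exec W c s t s' \<Longrightarrow> 0 < t"
  by (induction rule: exec.induct) auto

text \<open>Copying or loading a value that does not fit into a word is stuck, so code that reads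
  memory left behind by an unknown program needs a bound on all of it.\<close>

definition bounded :: "nat \<Rightarrow> state \<Rightarrow> bool" where
  "bounded W s \<longleftrightarrow> (\<forall>r. regs s r < W) \<and> (\<forall>a i. arrs s a i < W)"

lemma bounded_mono: "bounded W s \<Longrightarrow> W \<le> W' \<Longrightarrow> bounded W' s"
  by (auto simp: bounded_def intro: less_le_trans)

lemma exec_bounded: "exec W c s t s' \<Longrightarrow> bounded W s \<Longrightarrow> bounded W s'"
  by (induction rule: exec.induct) (auto simp: bounded_def)

definition changed :: "state \<Rightarrow> state \<Rightarrow> (string \<times> nat) set" where
  "changed s s' = {(a, i). arrs s' a i \<noteq> arrs s a i}"

lemma changed_trans: "changed s s'' \<subseteq> changed s s' \<union> changed s' s''"
  by (auto simp: changed_def)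

text \<open>One step writes at most one array cell. This turns the amount of output into a lower
  bound on time.\<close>

lemma card_changed_le_time: "exec W c s t s' \<Longrightarrow> finite (changed s s') \<and> card (changed s s') \<le> t"
proof (induction rule: exec.induct)
  case (Store x s a i)
  have "changed s (set_cell a (val i s) (val x s) s) \<subseteq> {(a, val i s)}"
    by (auto simp: changed_def split: if_splits)
  then show ?case using card_mono[of "{(a, val i s)}"] finite_subset by fastforce
next
  case (Seq c1 s t1 s1 c2 t2 s2)
  then show ?case
    using changed_trans[of s s2 s1] card_mono[OF _ changed_trans[of s s2 s1]]
      card_Un_le[of "changed s s1" "changed s1 s2"]
    by (meson add_mono finite_Un finite_subset le_trans)
next
  case (WhileTrue b s c t1 s1 t2 s2)
  then have "card (changed s s2) \<le> t1 + t2"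
    using card_mono[OF _ changed_trans[of s s2 s1]] card_Un_le[of "changed s s1" "changed s1 s2"]
    by (meson add_mono finite_Un le_trans)
  then show ?case using WhileTrue changed_trans[of s s2 s1] by (auto intro: finite_subset)
qed (auto simp: changed_def)

section \<open>Names occurring in a program, and the frame rule\<close>

primrec opvars :: "operand \<Rightarrow> string set" where
  "opvars (Const c) = {}"
| "opvars (Reg r) = {r}"

primrec condvars :: "cond \<Rightarrow> string set" where
  "condvars (Less x y) = opvars x \<union> opvars y"
| "condvars (Equal x y) = opvars x \<union> opvars y"

text \<open>Register and array names are pooled, so one freshness condition protects both.\<close>

primrec vars :: "com \<Rightarrow> string set" where
  "vars Skip = {}"
| "vars (Move r x) = {r} \<union> opvars x"
| "vars (Arith r b x y) = {r} \<union> opvars x \<union> opvars y"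
| "vars (Load r a i) = {r, a} \<union> opvars i"
| "vars (Store a i x) = {a} \<union> opvars i \<union> opvars x"
| "vars (Seq c1 c2) = vars c1 \<union> vars c2"
| "vars (If b c1 c2) = condvars b \<union> vars c1 \<union> vars c2"
| "vars (While b c) = condvars b \<union> vars c"

lemma finite_vars: "finite (vars c)"
proof -
  have o: "finite (opvars x)" for x by (cases x) auto
  have "finite (condvars b)" for b by (cases b) (auto simp: o)
  then show ?thesis by (induction c) (auto simp: o)
qed

definition agree :: "string set \<Rightarrow> state \<Rightarrow> state \<Rightarrow> bool" where
  "agree V s s' \<longleftrightarrow> (\<forall>x\<in>V. regs s x = regs s' x \<and> arrs s x = arrs s' x)"

lemma agree_val: "agree V s s' \<Longrightarrow> opvars x \<subseteq> V \<Longrightarrow> val x s' = val x s"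
  by (cases x) (auto simp: agree_def)

lemma agree_holds: "agree V s s' \<Longrightarrow> condvars b \<subseteq> V \<Longrightarrow> holds b s' = holds b s"
  by (cases b) (auto simp: agree_val)

lemma agree_trans: "agree V s s' \<Longrightarrow> agree V s' s'' \<Longrightarrow> agree V s s''"
  by (simp add: agree_def)

lemma agree_refl: "agree V s s"
  by (simp add: agree_def)

text \<open>A program reads and writes only what it mentions. Here \<open>s\<close> is the memory
  that a simulated program expects and \<open>r\<close> the larger memory in which it really runs;
  agreement on \<open>V\<close> persists, and everything outside \<open>V\<close> survives.\<close>

lemma exec_frame:
  "exec W c s t s' \<Longrightarrow> vars c \<subseteq> V \<Longrightarrow> agree V s r \<Longrightarrow>
   \<exists>r'. exec W c r t r' \<and> agree V s' r' \<and> agree (- V) r r'"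
proof (induction arbitrary: r rule: exec.induct)
  case (Skip s)
  then show ?case by (auto intro: exec_intros(1) agree_refl)
next
  case (Move x s q)
  then have "val x r = val x s" by (auto intro: agree_val)
  with Move have "exec W (Move q x) r 1 (set_reg q (val x s) r)"
    "agree V (set_reg q (val x s) s) (set_reg q (val x s) r)" "agree (- V) r (set_reg q (val x s) r)"
    using exec.Move[of x r W q] by (simp_all add: agree_def)
  then show ?case by blast
next
  case (Arith b x s y q)
  then have "val x r = val x s" "val y r = val y s" by (auto intro: agree_val)
  with Arith have "exec W (Arith q b x y) r 1 (set_reg q (arith b (val x s) (val y s)) r)"
    "agree V (set_reg q (arith b (val x s) (val y s)) s) (set_reg q (arith b (val x s) (val y s)) r)" "agree (- V) r (set_reg q (arith b (val x s) (val y s)) r)"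
    using exec.Arith[of b x r y W q] by (simp_all add: agree_def)
  then show ?case by blast
next
  case (Load s a i q)
  then have "val i r = val i s" "arrs r a = arrs s a" by (auto intro: agree_val simp: agree_def)
  with Load have "exec W (Load q a i) r 1 (set_reg q (arrs s a (val i s)) r)"
    "agree V (set_reg q (arrs s a (val i s)) s) (set_reg q (arrs s a (val i s)) r)" "agree (- V) r (set_reg q (arrs s a (val i s)) r)"
    using exec.Load[of r a i W q] by (simp_all add: agree_def)
  then show ?case by blast
next
  case (Store x s a i)
  then have "val x r = val x s" "val i r = val i s" by (auto intro: agree_val)
  with Store have "exec W (Store a i x) r 1 (set_cell a (val i s) (val x s) r)"
    "agree V (set_cell a (val i s) (val x s) s) (set_cell a (val i s) (val x s) r)" "agree (- V) r (set_cell a (val i s) (val x s) r)"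
    using exec.Store[of x r W a i] by (simp_all add: agree_def)
  then show ?case by blast
next
  case (Seq c1 s t1 s1 c2 t2 s2)
  then have V: "vars c1 \<subseteq> V" "vars c2 \<subseteq> V" by simp_all
  obtain r1 where r1: "exec W c1 r t1 r1" "agree V s1 r1" "agree (- V) r r1"
    using Seq.IH(1)[OF V(1) Seq.prems(2)] by blast
  obtain r2 where "exec W c2 r1 t2 r2" "agree V s2 r2" "agree (- V) r1 r2"
    using Seq.IH(2)[OF V(2) r1(2)] by blast
  then show ?case using r1 exec.Seq agree_trans by meson
next
  case (IfTrue b s c1 t s' c2)
  then have "holds b r" "vars c1 \<subseteq> V" using agree_holds by auto
  then show ?case using IfTrue.IH[OF _ IfTrue.prems(2)] exec.IfTrue by meson
next
  case (IfFalse b s c2 t s' c1)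
  then have "\<not> holds b r" "vars c2 \<subseteq> V" using agree_holds by auto
  then show ?case using IfFalse.IH[OF _ IfFalse.prems(2)] exec.IfFalse by meson
next
  case (WhileFalse b s c)
  then have "\<not> holds b r" using agree_holds by auto
  then show ?case using WhileFalse.prems exec.WhileFalse agree_refl by meson
next
  case (WhileTrue b s c t1 s1 t2 s2)
  then have h: "holds b r" and V: "vars c \<subseteq> V" using agree_holds by auto
  obtain r1 where r1: "exec W c r t1 r1" "agree V s1 r1" "agree (- V) r r1"
    using WhileTrue.IH(1)[OF V WhileTrue.prems(2)] by blast
  obtain r2 where "exec W (While b c) r1 t2 r2" "agree V s2 r2" "agree (- V) r1 r2"
    using WhileTrue.IH(2)[OF WhileTrue.prems(1) r1(2)] by blast
  then show ?case using r1 h exec.WhileTrue agree_trans by meson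
qed

section \<open>Total correctness with time bounds\<close>

definition runs :: "nat \<Rightarrow> com \<Rightarrow> state \<Rightarrow> nat \<Rightarrow> (state \<Rightarrow> bool) \<Rightarrow> bool" where
  "runs W c s T Q \<longleftrightarrow> (\<exists>t s'. exec W c s t s' \<and> t \<le> T \<and> Q s')"

text \<open>By determinism the existential statement \<open>runs\<close> says something about every
  execution.\<close>

lemma runs_exec:
  assumes "runs W c s T Q" "exec W c s t s'"
  shows "t \<le> T" "Q s'"
  using assms exec_deterministic unfolding runs_def by blast+

lemma runs_weaken:
  assumes "runs W c s T Q" "T \<le> T'" "\<And>s'. Q s' \<Longrightarrow> R s'"
  shows "runs W c s T' R"
  using assms unfolding runs_def by (meson le_trans)

lemma runs_Seq:
  assumes "runs W c1 s T1 (\<lambda>s1. runs W c2 s1 T2 Q)" "T1 + T2 \<le> T"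
  shows "runs W (Seq c1 c2) s T Q"
proof -
  from assms(1) obtain t1 s1 where 1: "exec W c1 s t1 s1" "t1 \<le> T1" "runs W c2 s1 T2 Q"
    unfolding runs_def by blast
  from 1(3) obtain t2 s2 where 2: "exec W c2 s1 t2 s2" "t2 \<le> T2" "Q s2"
    unfolding runs_def by blast
  from 1 2 assms(2) have "exec W (Seq c1 c2) s (t1 + t2) s2" "t1 + t2 \<le> T"
    by (auto intro: exec_intros(6))
  then show ?thesis using 2 unfolding runs_def by blast
qed

lemma runs_If:
  assumes "holds b s \<Longrightarrow> runs W c1 s T Q" "\<not> holds b s \<Longrightarrow> runs W c2 s T Q"
  shows "runs W (If b c1 c2) s (Suc T) Q"
  using assms exec_intros(7)[of b s W c1 _ _ c2] exec_intros(8)[of b s W c2 _ _ c1]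
  unfolding runs_def by (cases "holds b s"; fastforce)

text \<open>The invariant carries the iteration count, which also yields termination. Each iteration
  pays one step for its test, and the final failing test accounts for the outer
  \<open>Suc\<close>.\<close>

lemma runs_While_count:
  assumes step: "\<And>i s. i < N \<Longrightarrow> I i s \<Longrightarrow> holds b s \<and> runs W c s T (I (Suc i))"
    and stop: "\<And>s. I N s \<Longrightarrow> \<not> holds b s" and init: "I 0 s"
  shows "runs W (While b c) s (Suc (N * Suc T)) (I N)"
proof -
  have "runs W (While b c) s (Suc ((N - i) * Suc T)) (I N)" if "i \<le> N" "I i s" for i s
    using that
  proof (induction "N - i" arbitrary: i s)
    case 0
    then show ?case using exec_intros(9)[OF stop, of s W c] unfolding runs_def by auto
  next
    case (Suc d)
    then have "i < N" by simp
    from step[OF this Suc.prems(2)] obtain t1 s1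
      where 1: "holds b s" "exec W c s t1 s1" "t1 \<le> T" "I (Suc i) s1"
      unfolding runs_def by blast
    have "d = N - Suc i" "Suc i \<le> N" using Suc by simp_all
    from Suc.hyps(1)[OF this 1(4)] obtain t2 s2
      where 2: "exec W (While b c) s1 t2 s2" "t2 \<le> Suc ((N - Suc i) * Suc T)" "I N s2"
      unfolding runs_def by blast
    have "N - i = Suc (N - Suc i)" using \<open>i < N\<close> by simp
    then have "Suc (t1 + t2) \<le> Suc ((N - i) * Suc T)" using 1 2 by simp
    then show ?case using exec_intros(10)[OF 1(1,2) 2(1)] 2(3) unfolding runs_def by blast
  qed
  from this[of 0 s] init show ?thesis by simp
qed

text \<open>This is how code of the given algorithm is used: its execution is known in
  \<open>s0\<close> with shorter words and is replayed in \<open>s\<close>.\<close>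

lemma runs_frame:
  assumes "exec W0 c s0 t s0'" "W0 \<le> W" "vars c \<subseteq> V" "agree V s0 s"
  shows "runs W c s t (\<lambda>s'. agree V s0' s' \<and> agree (- V) s s')"
  using exec_frame[OF exec_mono[OF assms(1,2)] assms(3,4)] unfolding runs_def by blast

text \<open>The closing \<open>Skip\<close> costs a step, hence the strict inequality in
  \<open>runs_block\<close>.\<close>

definition block :: "com list \<Rightarrow> com" where
  "block cs = foldr Seq cs Skip"

text \<open>Weakest precondition of straight-line code, overflow conditions included.\<close>

fun wp :: "nat \<Rightarrow> com list \<Rightarrow> (state \<Rightarrow> bool) \<Rightarrow> state \<Rightarrow> bool" where
  "wp W [] Q s = Q s"
| "wp W (Move r x # cs) Q s = (val x s < W \<and> wp W cs Q (set_reg r (val x s) s))"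
| "wp W (Arith r b x y # cs) Q s =
     (arith b (val x s) (val y s) < W \<and> wp W cs Q (set_reg r (arith b (val x s) (val y s)) s))"
| "wp W (Load r a i # cs) Q s =
     (arrs s a (val i s) < W \<and> wp W cs Q (set_reg r (arrs s a (val i s)) s))"
| "wp W (Store a i x # cs) Q s = (val x s < W \<and> wp W cs Q (set_cell a (val i s) (val x s) s))"
| "wp W (_ # cs) Q s = False"

lemma wp_append: "wp W (cs @ ds) Q s = wp W cs (wp W ds Q) s"
  by (induction W cs Q s rule: wp.induct) auto

lemma wp_mono: "wp W cs Q s \<Longrightarrow> (\<And>s'. Q s' \<Longrightarrow> R s') \<Longrightarrow> wp W cs R s"
  by (induction W cs Q s rule: wp.induct) auto

lemma runs_Cons:
  assumes "exec W c s 1 s1" "runs W (block cs) s1 T Q"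
  shows "runs W (block (c # cs)) s (Suc T) Q"
proof -
  have "runs W c s 1 (\<lambda>s1. runs W (block cs) s1 T Q)"
    using assms unfolding runs_def by blast
  then show ?thesis unfolding block_def foldr.simps o_apply by (rule runs_Seq) simp
qed

lemma runs_block:
  assumes "wp W cs Q s" "length cs < T"
  shows "runs W (block cs) s T Q"
proof -
  from assms(1) have "runs W (block cs) s (Suc (length cs)) Q"
  proof (induction W cs Q s rule: wp.induct)
    case (1 W Q s)
    then show ?case using exec.Skip[of W s] by (auto simp: runs_def block_def)
  qed (auto intro!: runs_Cons intro: exec.intros)
  then show ?thesis by (rule runs_weaken) (use assms(2) in auto)
qed

section \<open>Word length and inputs\<close>

lemma word_bound_mono: "N \<le> N' \<Longrightarrow> word_bound c N \<le> word_bound c N'"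
  unfolding word_bound_def by (rule power_mono) auto

text \<open>As \<open>N + 2 \<ge> 2\<close>, the constant \<open>2 * k + 2\<close> is at most
  \<open>(N + 2) ^ (2 * k + 2)\<close>, so \<open>B\<close> is at most the power with exponent
  \<open>2 * k + 3\<close>. In the factor \<open>c + 2\<close>, the \<open>c\<close> serves the
  words of the given algorithm on an instance of size up to \<open>B\<close>, and the 2 serves
  products of two numbers up to \<open>B\<close>.\<close>

lemma word_bound_sub:
  fixes k c N :: nat
  defines "B \<equiv> (2 * k + 2) * (N + 2)" and "W \<equiv> word_bound ((2 * k + 3) * (c + 2)) N"
  shows "N' + 2 \<le> B \<Longrightarrow> word_bound c N' \<le> W" and "B * B \<le> W"
proof -
  have "2 * k + 2 \<le> (2::nat) ^ (2 * k + 2)" using less_exp[of "2 * k + 2"] by linarith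
  also have "\<dots> \<le> (N + 2) ^ (2 * k + 2)" by (rule power_mono) auto
  finally have "B \<le> (N + 2) ^ (2 * k + 2) * (N + 2)" unfolding B_def by (rule mult_le_mono1)
  then have "B \<le> (N + 2) ^ (2 * k + 3)" by (simp add: mult.commute numeral_3_eq_3)
  then have B: "B ^ (c + 2) \<le> W"
    unfolding W_def word_bound_def power_mult by (rule power_mono) auto
  have "1 \<le> B" by (simp add: B_def)
  then have "B ^ c \<le> B ^ (c + 2)" by (intro power_increasing) auto
  moreover have "B ^ 2 \<le> B ^ (c + 2)" using \<open>1 \<le> B\<close> by (intro power_increasing) auto
  ultimately show "B * B \<le> W" unfolding power2_eq_square[symmetric] using B by linarith
  assume "N' + 2 \<le> B"
  then have "word_bound c N' \<le> B ^ c" unfolding word_bound_def by (intro power_mono) auto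
  moreover have "B ^ c \<le> B ^ (c + 2)" using \<open>1 \<le> B\<close> by (intro power_increasing) auto
  ultimately show "word_bound c N' \<le> W" using B by linarith
qed

lemma lists_edges_length: "lists_edges es E \<Longrightarrow> length es = card E"
  using distinct_card[of "map (\<lambda>(u, v). {u, v}) es"] by (auto simp: lists_edges_def)

lemma ends_nth: "ends ((!) es) ` {..<length es} = set (map (\<lambda>(u, v). {u, v}) es)"
  by (force simp: ends_def set_conv_nth case_prod_beta)

text \<open>The input list is itself an initial slot table: the edge at index \<open>i\<close>
  occupies slot \<open>i\<close>.\<close>

lemma lists_edges_slots:
  assumes "ugraph n E" "lists_edges es E" "length es \<le> m"
  shows "slots n m ((!) es) {..<length es}" "ends ((!) es) ` {..<length es} = E"
proof -
  show E: "ends ((!) es) ` {..<length es} = E" using assms by (simp add: ends_nth lists_edges_def)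
  have "fst (es ! i) < n \<and> snd (es ! i) < n \<and> fst (es ! i) \<noteq> snd (es ! i)" if "i < length es" for i
  proof -
    have "{fst (es ! i), snd (es ! i)} \<in> E" using E that by (auto simp: ends_def)
    then show ?thesis using assms(1) by (auto simp: ugraph_def doubleton_eq_iff)
  qed
  moreover have "inj_on (ends ((!) es)) {..<length es}"
  proof (rule inj_onI)
    fix i j assume ij: "i \<in> {..<length es}" "j \<in> {..<length es}" "ends ((!) es) i = ends ((!) es) j"
    then have "map (\<lambda>(u, v). {u, v}) es ! i = map (\<lambda>(u, v). {u, v}) es ! j"
      by (simp add: ends_def case_prod_beta)
    then show "i = j" using ij assms(2) nth_eq_iff_index_eq[of "map (\<lambda>(u, v). {u, v}) es" i j]
      by (simp add: lists_edges_def)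
  qed
  ultimately show "slots n m ((!) es) {..<length es}" using assms(3) by (auto simp: slots_def)
qed

lemma graph_input_bounded:
  assumes "slots n m ((!) es) {..<length es}" "n < W" "length es < W"
  shows "bounded W (graph_input n es)"
  using assms by (auto simp: bounded_def graph_input_def slots_def intro: less_trans)

lemma dyn_reach_ugraph: "dyn_reach c K D n m E s i j T \<Longrightarrow> ugraph n E"
proof (induction rule: dyn_reach.induct)
  case (update E s i j T \<kappa> u v t s')
  then show ?case by (cases \<kappa>) (auto simp: ugraph_def)
qed auto

lemma valid_update_less: "ugraph n E \<Longrightarrow> valid_update \<kappa> n m E u v \<Longrightarrow> u < n \<and> v < n"
  by (cases \<kappa>) (auto simp: ugraph_def doubleton_eq_iff)

lemma bounded_set_args: "bounded W s \<Longrightarrow> u < W \<Longrightarrow> v < W \<Longrightarrow> bounded W (set_args u v s)"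
  by (simp add: bounded_def)

lemma size_less_word_bound: "1 \<le> c \<Longrightarrow> N + 2 \<le> word_bound c N"
  using power_increasing[of 1 c "N + 2"] by (simp add: word_bound_def)

text \<open>Execution preserves the bound, and the bound only grows with the number of operations.
  The exponent is positive so that the input and the arguments fit.\<close>

lemma dyn_reach_bounded:
  assumes "dyn_reach c K D n m E s i j T" "1 \<le> c"
  shows "bounded (word_bound c (n + m + i)) s"
  using assms
proof (induction rule: dyn_reach.induct)
  case (start E es t s)
  have "n + m + 2 \<le> word_bound c (n + m)" by (rule size_less_word_bound[OF start.prems])
  moreover have "length es \<le> m" using lists_edges_length start by auto
  ultimately have "bounded (word_bound c (n + m)) (dyn_input n m es)"
    using graph_input_bounded[OF lists_edges_slots(1)[OF start(1,2)], of m]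
    by (auto simp: dyn_input_def bounded_def)
  then show ?case using exec_bounded start by auto
next
  case (update E s i j T \<kappa> u v t s')
  have "n + m + i + 2 \<le> word_bound c (n + m + i)" by (rule size_less_word_bound[OF update.prems])
  then have "bounded (word_bound c (n + m + i)) (set_args u v s)"
    using update valid_update_less[OF dyn_reach_ugraph[OF update(1)] update(3)]
    by (intro bounded_set_args) auto
  then show ?case using exec_bounded update(4) bounded_mono word_bound_mono
    by (metis add_Suc_right le_SucI le_refl)
next
  case (query E s i j T u v t s')
  have "n + m + i + 2 \<le> word_bound c (n + m + i)" by (rule size_less_word_bound[OF query.prems])
  then have "bounded (word_bound c (n + m + i)) (set_args u v s)"
    using query by (intro bounded_set_args) auto
  then show ?case using exec_bounded query(4) bounded_mono word_bound_mono
    by (metis add_Suc_right le_SucI le_refl)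
qed

lemma dyn_reach_bounded_args:
  assumes "dyn_reach c K D n m E s i j T" "1 \<le> c" "u < n" "v < n"
  shows "bounded (word_bound c (n + m + i)) (set_args u v s)"
  using dyn_reach_bounded[OF assms(1,2)] size_less_word_bound[OF assms(2), of "n + m + i"] assms(3,4)
  by (intro bounded_set_args) auto

section \<open>Building the subdivided graph\<close>

text \<open>Piece \<open>j\<close> of edge \<open>i\<close> is entry \<open>j * length es + i\<close>, so that the edge list can be expanded in place.\<close>

definition subdivided_list :: "nat \<Rightarrow> nat \<Rightarrow> (nat \<times> nat) list \<Rightarrow> (nat \<times> nat) list" where
  "subdivided_list n k es =
     map (\<lambda>p. (node n k ((!) es) (p mod length es) (p div length es),
               node n k ((!) es) (p mod length es) (Suc (p div length es)))) [0..<Suc k * length es]"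

text \<open>A position of the expanded list is read as an edge (remainder) and a piece of it
  (quotient). Together with \<open>inj_on_seg\<close> this excludes duplicates in the expanded
  list.\<close>

lemma bij_betw_mod_div:
  "bij_betw (\<lambda>p. (p mod m, p div m)) {..<Suc k * m} ({..<m} \<times> {..k :: nat})"
proof (rule bij_betw_byWitness[where f' = "\<lambda>(i, j). j * m + i"])
  show "(\<lambda>p. (p mod m, p div m)) ` {..<Suc k * m} \<subseteq> {..<m} \<times> {..k}"
  proof
    fix q assume "q \<in> (\<lambda>p. (p mod m, p div m)) ` {..<Suc k * m}"
    then obtain p where q: "q = (p mod m, p div m)" and p: "p < Suc k * m" by auto
    then have "0 < m" by (cases m) auto
    moreover have "p div m < Suc k" using p by (rule less_mult_imp_div_less)
    ultimately show "q \<in> {..<m} \<times> {..k}" using q by simp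
  qed
  show "(\<lambda>(i, j). j * m + i) ` ({..<m} \<times> {..k}) \<subseteq> {..<Suc k * m}"
  proof clarsimp
    fix i j assume "i < m" "j \<le> k"
    then have "j * m + i < j * m + m" "j * m \<le> k * m" by simp_all
    then show "j * m + i < m + k * m" by linarith
  qed
qed auto

lemma lists_edges_subdivided:
  assumes S: "slots n m ((!) es) {..<length es}" and "1 \<le> k"
  shows "lists_edges (subdivided_list n k es) (seg n k ((!) es) ` ({..<length es} \<times> {..k}))"
proof -
  let ?m = "length es"
  let ?g = "\<lambda>p. (p mod ?m, p div ?m)"
  have map: "map (\<lambda>(u, v). {u, v}) (subdivided_list n k es) = map (seg n k ((!) es) \<circ> ?g) [0..<Suc k * ?m]"
    by (simp add: subdivided_list_def seg_def)
  have b: "inj_on ?g {..<Suc k * ?m}" "?g ` {..<Suc k * ?m} = {..<?m} \<times> {..k}"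
    using bij_betw_mod_div[of ?m k] by (auto simp: bij_betw_def)
  have "inj_on (seg n k ((!) es) \<circ> ?g) {..<Suc k * ?m}"
    using b inj_on_seg[OF S \<open>1 \<le> k\<close>] by (intro comp_inj_on) auto
  moreover have "(seg n k ((!) es) \<circ> ?g) ` {..<Suc k * ?m} = seg n k ((!) es) ` ({..<?m} \<times> {..k})"
    unfolding image_comp[symmetric] b(2) ..
  ultimately show ?thesis
    unfolding lists_edges_def map set_map distinct_map set_upt atLeast0LessThan
    using distinct_upt by blast
qed

text \<open>The square makes room for two-dimensional indices: keys of node pairs lie below
  \<open>n * n\<close>, positions in the output of the simulated static algorithm below the square
  of \<open>n + k * m\<close>.\<close>

definition roomy :: "nat \<Rightarrow> nat \<Rightarrow> nat \<Rightarrow> nat \<Rightarrow> bool" where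
  "roomy k n m W \<longleftrightarrow> (n + Suc k * m + Suc k + 2) * (n + Suc k * m + Suc k + 2) \<le> W"

lemma roomyD:
  assumes "roomy k n m W"
  shows "n * n < W" "n + Suc k * m + Suc k + 2 \<le> W" "Suc k * m + m < W"
proof -
  let ?D = "n + Suc k * m + Suc k + 2"
  have "n * n < ?D * ?D" by (rule mult_strict_mono) auto
  then show "n * n < W" using assms unfolding roomy_def by linarith
  have "?D * 2 \<le> ?D * ?D" by (rule mult_le_mono2) simp
  then have "?D * 2 \<le> W" using assms unfolding roomy_def by (rule le_trans)
  moreover have "m \<le> Suc k * m" by simp
  moreover have "n + q + Suc k + 2 \<le> W \<and> q + m < W" if "(n + q + Suc k + 2) * 2 \<le> W" "m \<le> q" for q
    using that by simp
  ultimately show "?D \<le> W" "Suc k * m + m < W" by blast+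
qed

definition changes_only :: "string set \<Rightarrow> string set \<Rightarrow> state \<Rightarrow> state \<Rightarrow> bool" where
  "changes_only R A s s' \<longleftrightarrow> (\<forall>r. r \<notin> R \<longrightarrow> regs s' r = regs s r) \<and> (\<forall>a. a \<notin> A \<longrightarrow> arrs s' a = arrs s a)"

lemma changes_only_trans:
  "changes_only R A s s' \<Longrightarrow> changes_only R' A' s' s'' \<Longrightarrow> R \<subseteq> R'' \<Longrightarrow> R' \<subseteq> R'' \<Longrightarrow> A \<subseteq> A'' \<Longrightarrow> A' \<subseteq> A'' \<Longrightarrow>
   changes_only R'' A'' s s''"
  unfolding changes_only_def by (metis subsetD)

text \<open>\<open>z\<close> supplies registers and arrays that the given algorithm does not use.\<close>

locale subdivider =
  fixes k :: nat and z :: "nat \<Rightarrow> string"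
  assumes k: "1 \<le> k" and inj_z: "inj z"
    and fresh: "z i \<notin> {''n'', ''m'', ''cap'', ''u'', ''v'', ''num'', ''den'', ''src'', ''dst''}"
begin

lemma z_eq [simp]: "z i = z j \<longleftrightarrow> i = j"
  using inj_z by (auto dest: injD)

lemma z_neq [simp]:
  "z i \<noteq> ''n''" "z i \<noteq> ''m''" "z i \<noteq> ''cap''" "z i \<noteq> ''u''" "z i \<noteq> ''v''" "z i \<noteq> ''num''"
  "z i \<noteq> ''den''" "z i \<noteq> ''src''" "z i \<noteq> ''dst''"
  using fresh[of i] unfolding insert_iff de_Morgan_disj by - (elim conjE; assumption)+

lemmas z_neq' [simp] = z_neq[symmetric]

abbreviation "zNum \<equiv> z 2"
abbreviation "zDen \<equiv> z 3"
abbreviation "zN \<equiv> z 4"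
abbreviation "zTop \<equiv> z 5"
abbreviation "zB \<equiv> z 6"
abbreviation "zX \<equiv> z 7"
abbreviation "zY \<equiv> z 8"
abbreviation "zBase \<equiv> z 9"
abbreviation "zT \<equiv> z 10"
abbreviation "zM \<equiv> z 11"
abbreviation "zPos \<equiv> z 12"

text \<open>Registers and arrays form separate name spaces, so the same fresh names serve
  both.\<close>

abbreviation "aX \<equiv> z 2"
abbreviation "aY \<equiv> z 3"
abbreviation "aSlot \<equiv> z 4"
abbreviation "aStack \<equiv> z 5"

text \<open>Each slot is entered under both orderings of its end nodes, because an update may name
  an edge either way round. Only slots in \<open>B\<close> are constrained, so entries of deleted
  edges may go stale.\<close>

definition stored :: "nat \<Rightarrow> (nat \<Rightarrow> nat \<times> nat) \<Rightarrow> nat set \<Rightarrow> state \<Rightarrow> bool" where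
  "stored n f B s \<longleftrightarrow> (\<forall>b\<in>B. arrs s aX b = fst (f b) \<and> arrs s aY b = snd (f b) \<and>
     arrs s aSlot (fst (f b) * n + snd (f b)) = b \<and> arrs s aSlot (snd (f b) * n + fst (f b)) = b)"

lemma stored_changes_only:
  "changes_only R A s s' \<Longrightarrow> aX \<notin> A \<Longrightarrow> aY \<notin> A \<Longrightarrow> aSlot \<notin> A \<Longrightarrow> stored n f B s' = stored n f B s"
  by (simp add: changes_only_def stored_def)

definition record_edge :: "com list" where
  "record_edge =
    [Store aX (Reg zB) (Reg zX), Store aY (Reg zB) (Reg zY),
     Arith zT Mul (Reg zX) (Reg zN), Arith zT Add (Reg zT) (Reg zY), Store aSlot (Reg zT) (Reg zB),
     Arith zT Mul (Reg zY) (Reg zN), Arith zT Add (Reg zT) (Reg zX), Store aSlot (Reg zT) (Reg zB)]"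

lemma key_less: "x < n \<Longrightarrow> y < n \<Longrightarrow> x * n + y < n * (n::nat)"
  using mult_le_mono1[of "Suc x" n n] by simp

lemma key_eq_iff:
  assumes "y < n" "y' < n"
  shows "x * n + y = x' * n + (y'::nat) \<longleftrightarrow> x = x' \<and> y = y'"
proof
  assume e: "x * n + y = x' * n + y'"
  have "(x * n + y) div n = x" "(x * n + y) mod n = y" "(x' * n + y') div n = x'" "(x' * n + y') mod n = y'"
    using assms by simp_all
  then show "x = x' \<and> y = y'" using e by simp
qed simp

lemma wp_record_edge:
  assumes s: "regs s zB = b" "regs s zX = fst (f b)" "regs s zY = snd (f b)" "regs s zN = n"
    and S: "slots n m f (insert b B)" and "b \<notin> B" and st: "stored n f B s" and W: "roomy k n m W"
  shows "wp W record_edge (\<lambda>s'. changes_only {zT} {aX, aY, aSlot} s s' \<and> stored n f (insert b B) s') s"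
proof -
  obtain x y where f: "f b = (x, y)" by (cases "f b")
  have xy: "x < n" "y < n" "b < m" using S f by (auto simp: slots_def)
  have lt: "x * n + y < W" "y * n + x < W" "x < W" "y < W" "b < W"
    using key_less[of x n y] key_less[of y n x] roomyD[OF W] xy by simp_all
  then have lt': "x * n < W" "y * n < W" by simp_all
  \<comment> \<open>Neither key written for \<open>b\<close> belongs to another slot: a key
    determines its ordered pair, and distinct slots have distinct end sets.\<close>
  have other: "fst (f c) * n + snd (f c) \<noteq> x * n + y" "fst (f c) * n + snd (f c) \<noteq> y * n + x"
      "snd (f c) * n + fst (f c) \<noteq> x * n + y" "snd (f c) * n + fst (f c) \<noteq> y * n + x" "c \<noteq> b"
    if "c \<in> B" for c
  proof -
    have "ends f c \<noteq> ends f b" using S that \<open>b \<notin> B\<close> by (auto simp: slots_def inj_on_def)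
    moreover have "fst (f c) < n" "snd (f c) < n" using S that by (auto simp: slots_def)
    ultimately show "fst (f c) * n + snd (f c) \<noteq> x * n + y" "fst (f c) * n + snd (f c) \<noteq> y * n + x"
      "snd (f c) * n + fst (f c) \<noteq> x * n + y" "snd (f c) * n + fst (f c) \<noteq> y * n + x" "c \<noteq> b"
      using xy f that \<open>b \<notin> B\<close> by (auto simp: key_eq_iff ends_def)
  qed
  show ?thesis
    using lt lt' s f st other by (auto simp: record_edge_def changes_only_def stored_def)
qed

definition base :: "com list" where
  "base = [Arith zBase Mul (Reg zB) (Const k), Arith zBase Add (Reg zBase) (Reg zN)]"

lemma wp_base:
  assumes "regs s zB = b" "regs s zN = n" "b < m" "roomy k n m W"
  shows "wp W base (\<lambda>s'. changes_only {zBase} {} s s' \<and> regs s' zBase = n + b * k) s"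
proof -
  have "b * k \<le> m * k" using assms(3) by (intro mult_le_mono1) simp
  moreover have "Suc k * m = m + m * k" by simp
  ultimately have "b * k + n < W" using roomyD(2)[OF assms(4)] by linarith
  then show ?thesis using assms by (simp add: base_def changes_only_def)
qed

text \<open>The distinction on \<open>j\<close> is made while the program is built. Since
  \<open>k\<close> is a constant, a path is processed by unrolled code without branches.\<close>

definition load_node :: "string \<Rightarrow> nat \<Rightarrow> com" where
  "load_node r j = (if j = 0 then Move r (Reg zX) else if j = Suc k then Move r (Reg zY)
     else Arith r Add (Reg zBase) (Const (j - 1)))"

definition at_slot :: "nat \<Rightarrow> (nat \<Rightarrow> nat \<times> nat) \<Rightarrow> nat \<Rightarrow> state \<Rightarrow> bool" where
  "at_slot n f b s \<longleftrightarrow>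
     regs s zX = fst (f b) \<and> regs s zY = snd (f b) \<and> regs s zBase = n + b * k"

lemma at_slot_changes_only:
  "changes_only R A s s' \<Longrightarrow> zX \<notin> R \<Longrightarrow> zY \<notin> R \<Longrightarrow> zBase \<notin> R \<Longrightarrow> at_slot n f b s' = at_slot n f b s"
  by (simp add: changes_only_def at_slot_def)

lemma wp_load_node:
  assumes "at_slot n f b s"
  shows "wp W (load_node r j # cs) Q s \<longleftrightarrow>
    node n k f b j < W \<and> wp W cs Q (set_reg r (node n k f b j) s)"
  using assms by (simp add: load_node_def at_slot_def node_def)

primrec write_segs :: "nat \<Rightarrow> com list" where
  "write_segs 0 = []"
| "write_segs (Suc j) = write_segs j @
    [load_node zT j, Store ''src'' (Reg zPos) (Reg zT),
     load_node zT (Suc j), Store ''dst'' (Reg zPos) (Reg zT), Arith zPos Add (Reg zPos) (Reg zM)]"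

lemma wp_write_segs:
  assumes "at_slot n f b s" "regs s zPos = b" "regs s zM = m0" "b < m0" "m0 \<le> m"
    and S: "slots n m f B" and "b \<in> B" and W: "roomy k n m W" and "j \<le> Suc k"
  shows "wp W (write_segs j) (\<lambda>s'. changes_only {zT, zPos} {''src'', ''dst''} s s' \<and> regs s' zPos = j * m0 + b \<and>
    arrs s' ''src'' = (\<lambda>p. if p mod m0 = b \<and> p div m0 < j then node n k f b (p div m0) else arrs s ''src'' p) \<and>
    arrs s' ''dst'' = (\<lambda>p. if p mod m0 = b \<and> p div m0 < j then node n k f b (Suc (p div m0)) else arrs s ''dst'' p)) s"
  using \<open>j \<le> Suc k\<close>
proof (induction j)
  case 0
  then show ?case using assms by (simp add: changes_only_def)
next
  case (Suc j)
  have lt: "node n k f b i < W" if "i \<le> Suc k" for i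
    using node_less[OF S \<open>b \<in> B\<close> that] roomyD(2)[OF W] by simp
  \<comment> \<open>After the last piece the write position lies past the end of the list, and this
    value, too, has to fit into a word.\<close>
  have "j * m0 \<le> k * m0" using Suc.prems by (intro mult_le_mono1) simp
  then have "j * m0 + b + m0 \<le> Suc k * m0 + m0"
    using \<open>b < m0\<close> unfolding mult_Suc by linarith
  also have "\<dots> \<le> Suc k * m + m" by (rule add_mono[OF mult_le_mono2]) (rule \<open>m0 \<le> m\<close>)+
  finally have pos: "j * m0 + b + m0 < W" using roomyD(3)[OF W] by linarith
  have "(j * m0 + b) mod m0 = b" "(j * m0 + b) div m0 = j" using \<open>b < m0\<close> by simp_all
  then have p: "p = j * m0 + b \<longleftrightarrow> p mod m0 = b \<and> p div m0 = j" for p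
    by (metis div_mult_mod_eq)
  have upd: "(\<lambda>p. if p mod m0 = b \<and> p div m0 < j then g (p div m0) else h p)(j * m0 + b := g j) =
    (\<lambda>p. if p mod m0 = b \<and> p div m0 < Suc j then g (p div m0) else h p)" for g h :: "nat \<Rightarrow> nat"
    unfolding fun_upd_def p by (auto simp: fun_eq_iff less_Suc_eq)
  show ?case
    unfolding write_segs.simps wp_append
  proof (rule wp_mono[OF Suc.IH])
    show "j \<le> Suc k" using Suc.prems by simp
    fix s'
    assume s': "changes_only {zT, zPos} {''src'', ''dst''} s s' \<and> regs s' zPos = j * m0 + b \<and>
      arrs s' ''src'' = (\<lambda>p. if p mod m0 = b \<and> p div m0 < j then node n k f b (p div m0) else arrs s ''src'' p) \<and>
      arrs s' ''dst'' = (\<lambda>p. if p mod m0 = b \<and> p div m0 < j then node n k f b (Suc (p div m0)) else arrs s ''dst'' p)"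
    then have at: "at_slot n f b s'" using at_slot_changes_only[of "{zT, zPos}" _ s s'] assms(1) by auto
    have at2: "at_slot n f b (set_cell a i x (set_reg zT y s'))" for a i x y
      using at by (simp add: at_slot_def)
    have "regs s' zM = m0" using s' assms(3) by (simp add: changes_only_def)
    then show "wp W [load_node zT j, Store ''src'' (Reg zPos) (Reg zT),
       load_node zT (Suc j), Store ''dst'' (Reg zPos) (Reg zT), Arith zPos Add (Reg zPos) (Reg zM)]
      (\<lambda>s'. changes_only {zT, zPos} {''src'', ''dst''} s s' \<and> regs s' zPos = Suc j * m0 + b \<and>
        arrs s' ''src'' = (\<lambda>p. if p mod m0 = b \<and> p div m0 < Suc j then node n k f b (p div m0) else arrs s ''src'' p) \<and>
        arrs s' ''dst'' = (\<lambda>p. if p mod m0 = b \<and> p div m0 < Suc j then node n k f b (Suc (p div m0)) else arrs s ''dst'' p)) s'"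
      using s' pos lt Suc.prems
      by (simp add: wp_load_node[OF at] wp_load_node[OF at2] upd[of "node n k f b"]
          upd[of "\<lambda>i. node n k f b (Suc i)"])
        (simp add: changes_only_def)
  qed
qed

definition expand_body :: "com list" where
  "expand_body = [Load zX ''src'' (Reg zB), Load zY ''dst'' (Reg zB)] @ record_edge @ base @
     [Move zPos (Reg zB)] @ write_segs (Suc k) @ [Arith zB Add (Reg zB) (Const 1)]"

definition expand :: com where
  "expand = Seq (block [Move zB (Const 0)]) (While (Less (Reg zB) (Reg zM)) (block expand_body))"

text \<open>All pieces of edge \<open>i\<close> go to positions with remainder \<open>i\<close>, so
  among the original positions only \<open>i\<close> itself is overwritten while edge
  \<open>i\<close> is processed. No edge is destroyed before it has been read.\<close>

definition expand_inv :: "nat \<Rightarrow> (nat \<times> nat) list \<Rightarrow> state \<Rightarrow> nat \<Rightarrow> state \<Rightarrow> bool" where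
  "expand_inv n es s0 i s \<longleftrightarrow> regs s zB = i \<and>
     changes_only {zB, zX, zY, zBase, zT, zPos} {aX, aY, aSlot, ''src'', ''dst''} s0 s \<and>
     stored n ((!) es) {..<i} s \<and>
     arrs s ''src'' = (\<lambda>p. if p mod length es < i \<and> p div length es \<le> k
       then node n k ((!) es) (p mod length es) (p div length es) else arrs s0 ''src'' p) \<and>
     arrs s ''dst'' = (\<lambda>p. if p mod length es < i \<and> p div length es \<le> k
       then node n k ((!) es) (p mod length es) (Suc (p div length es)) else arrs s0 ''dst'' p)"

lemma wp_expand_body:
  assumes inv: "expand_inv n es s0 i s" and "i < length es" "length es \<le> m"
    and S: "slots n m ((!) es) {..<length es}" and W: "roomy k n m W"
    and s0: "regs s0 zN = n" "regs s0 zM = length es"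
      "arrs s0 ''src'' = arrs (graph_input n es) ''src''" "arrs s0 ''dst'' = arrs (graph_input n es) ''dst''"
  shows "wp W expand_body (expand_inv n es s0 (Suc i)) s"
proof -
  let ?f = "(!) es"
  let ?R = "{zB, zX, zY, zBase, zT, zPos}" and ?A = "{aX, aY, aSlot, ''src'', ''dst''}"
  note inv = inv[unfolded expand_inv_def]
  have x: "fst (?f i) < n" "snd (?f i) < n" using S \<open>i < length es\<close> by (auto simp: slots_def)
  have lt: "fst (?f i) < W" "snd (?f i) < W" "Suc i < W" "n < W"
    using x roomyD(2)[OF W] \<open>i < length es\<close> \<open>length es \<le> m\<close> by simp_all
  have sd: "arrs s ''src'' i = fst (?f i)" "arrs s ''dst'' i = snd (?f i)"
    using inv \<open>i < length es\<close> s0 by (auto simp: graph_input_def)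
  have zs: "regs s zN = n" "regs s zM = length es" "regs s zB = i" using inv s0 by (auto simp: changes_only_def)
  define s1 where "s1 = set_reg zY (snd (?f i)) (set_reg zX (fst (?f i)) s)"
  have S': "slots n m ?f (insert i {..<i})" using S \<open>i < length es\<close> by (auto intro: slots_mono)
  have st1: "stored n ?f {..<i} s1" using inv by (simp add: s1_def stored_def)
  have u1: "changes_only {zX, zY} {} s s1" by (simp add: changes_only_def s1_def)
  have "wp W (record_edge @ base @ [Move zPos (Reg zB)] @ write_segs (Suc k) @ [Arith zB Add (Reg zB) (Const 1)])
    (expand_inv n es s0 (Suc i)) s1"
    unfolding wp_append[of W record_edge]
  proof (rule wp_mono[OF wp_record_edge[where b = i and B = "{..<i}", OF _ _ _ _ S' _ st1 W]])
    fix s2 assume 2: "changes_only {zT} {aX, aY, aSlot} s1 s2 \<and> stored n ?f (insert i {..<i}) s2"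
    have z2: "regs s2 zB = i" "regs s2 zN = n" "regs s2 zM = length es"
      "regs s2 zX = fst (?f i)" "regs s2 zY = snd (?f i)"
      using 2 zs by (auto simp: changes_only_def s1_def)
    show "wp W (base @ [Move zPos (Reg zB)] @ write_segs (Suc k) @ [Arith zB Add (Reg zB) (Const 1)])
      (expand_inv n es s0 (Suc i)) s2"
      unfolding wp_append[of W base]
    proof (rule wp_mono[OF wp_base[OF z2(1,2) _ W]])
      show "i < m" using \<open>i < length es\<close> \<open>length es \<le> m\<close> by simp
      fix s3 assume 3: "changes_only {zBase} {} s2 s3 \<and> regs s3 zBase = n + i * k"
      define s4 where "s4 = set_reg zPos i s3"
      have z4: "at_slot n ?f i s4" "regs s4 zPos = i" "regs s4 zM = length es" "regs s3 zB = i"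
        using 3 z2 by (auto simp: at_slot_def changes_only_def s4_def)
      have u4: "changes_only ?R ?A s s4" "arrs s4 ''src'' = arrs s ''src''" "arrs s4 ''dst'' = arrs s ''dst''"
        "regs s4 zB = i" "stored n ?f {..<Suc i} s4"
        using u1 2 3 zs by (auto simp: changes_only_def s4_def stored_def lessThan_Suc)
      have "wp W (write_segs (Suc k) @ [Arith zB Add (Reg zB) (Const 1)]) (expand_inv n es s0 (Suc i)) s4"
        unfolding wp_append
      proof (rule wp_mono[OF wp_write_segs[OF z4(1-3) \<open>i < length es\<close> \<open>length es \<le> m\<close> S _ W le_refl]])
        show "i \<in> {..<length es}" using \<open>i < length es\<close> by simp
        fix s5
        assume 5: "changes_only {zT, zPos} {''src'', ''dst''} s4 s5 \<and> regs s5 zPos = Suc k * length es + i \<and>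
          arrs s5 ''src'' = (\<lambda>p. if p mod length es = i \<and> p div length es < Suc k
             then node n k ?f i (p div length es) else arrs s4 ''src'' p) \<and>
          arrs s5 ''dst'' = (\<lambda>p. if p mod length es = i \<and> p div length es < Suc k
             then node n k ?f i (Suc (p div length es)) else arrs s4 ''dst'' p)"
        have z5: "regs s5 zB = i" using 5 u4 by (simp add: changes_only_def)
        have "stored n ?f {..<Suc i} s5" using 5 u4(5) stored_changes_only[of _ _ s4 s5] by auto
        moreover have "changes_only ?R ?A s s5" using u4(1) 5 by (auto intro: changes_only_trans)
        then have "changes_only ?R ?A s0 s5" using inv by (auto intro: changes_only_trans)
        moreover have "arrs s5 ''src'' = (\<lambda>p. if p mod length es < Suc i \<and> p div length es \<le> k
          then node n k ?f (p mod length es) (p div length es) else arrs s0 ''src'' p)"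
        proof
          fix p
          have "arrs s ''src'' p = (if p mod length es < i \<and> p div length es \<le> k
            then node n k ?f (p mod length es) (p div length es) else arrs s0 ''src'' p)"
            using inv by simp
          moreover have "arrs s5 ''src'' p = (if p mod length es = i \<and> p div length es \<le> k
             then node n k ?f i (p div length es) else arrs s ''src'' p)"
            using 5 u4(2,3) by (simp add: less_Suc_eq_le)
          ultimately show "arrs s5 ''src'' p = (if p mod length es < Suc i \<and> p div length es \<le> k
            then node n k ?f (p mod length es) (p div length es) else arrs s0 ''src'' p)"
            by (auto simp: less_Suc_eq)
        qed
        moreover have "arrs s5 ''dst'' = (\<lambda>p. if p mod length es < Suc i \<and> p div length es \<le> k
          then node n k ?f (p mod length es) (Suc (p div length es)) else arrs s0 ''dst'' p)"
        proof
          fix p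
          have "arrs s ''dst'' p = (if p mod length es < i \<and> p div length es \<le> k
            then node n k ?f (p mod length es) (Suc (p div length es)) else arrs s0 ''dst'' p)"
            using inv by simp
          moreover have "arrs s5 ''dst'' p = (if p mod length es = i \<and> p div length es \<le> k
             then node n k ?f i (Suc (p div length es)) else arrs s ''dst'' p)"
            using 5 u4(2,3) by (simp add: less_Suc_eq_le)
          ultimately show "arrs s5 ''dst'' p = (if p mod length es < Suc i \<and> p div length es \<le> k
            then node n k ?f (p mod length es) (Suc (p div length es)) else arrs s0 ''dst'' p)"
            by (auto simp: less_Suc_eq)
        qed
        ultimately show "wp W [Arith zB Add (Reg zB) (Const 1)] (expand_inv n es s0 (Suc i)) s5"
          using z5 lt(3) by (simp add: expand_inv_def changes_only_def stored_def)
      qed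
      then show "wp W ([Move zPos (Reg zB)] @ write_segs (Suc k) @ [Arith zB Add (Reg zB) (Const 1)])
        (expand_inv n es s0 (Suc i)) s3"
        using z4 lt by (simp add: s4_def)
    qed
  qed (use zs in \<open>auto simp: s1_def\<close>)
  then show ?thesis unfolding expand_body_def using sd lt zs by (simp add: s1_def)
qed

text \<open>The node count \<open>n'\<close> is arbitrary, since the arrays of
  \<open>graph_input\<close> do not depend on it.\<close>

lemma runs_expand:
  assumes S: "slots n m ((!) es) {..<length es}" and "length es \<le> m" and W: "roomy k n m W"
    and s0: "regs s0 zN = n" "regs s0 zM = length es"
      "arrs s0 ''src'' = arrs (graph_input n es) ''src''" "arrs s0 ''dst'' = arrs (graph_input n es) ''dst''"
  shows "runs W expand s0 (3 + length es * (length expand_body + 2))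
    (\<lambda>s. changes_only {zB, zX, zY, zBase, zT, zPos} {aX, aY, aSlot, ''src'', ''dst''} s0 s \<and>
       stored n ((!) es) {..<length es} s \<and>
       arrs s ''src'' = arrs (graph_input n' (subdivided_list n k es)) ''src'' \<and>
       arrs s ''dst'' = arrs (graph_input n' (subdivided_list n k es)) ''dst'')"
proof -
  let ?f = "(!) es" and ?m = "length es"
  have "runs W (While (Less (Reg zB) (Reg zM)) (block expand_body)) (set_reg zB 0 s0)
    (Suc (?m * Suc (Suc (length expand_body)))) (expand_inv n es s0 ?m)"
  proof (rule runs_While_count)
    fix i s assume i: "i < ?m" "expand_inv n es s0 i s"
    have "runs W (block expand_body) s (Suc (length expand_body)) (expand_inv n es s0 (Suc i))"
      by (rule runs_block[OF wp_expand_body[OF i(2,1) \<open>?m \<le> m\<close> S W s0]]) simp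
    moreover have "regs s zM = ?m" "regs s zB = i" using i s0 by (auto simp: expand_inv_def changes_only_def)
    ultimately show "holds (Less (Reg zB) (Reg zM)) s \<and>
      runs W (block expand_body) s (Suc (length expand_body)) (expand_inv n es s0 (Suc i))"
      using i by simp
  next
    fix s assume "expand_inv n es s0 ?m s"
    then have "regs s zM = ?m" "regs s zB = ?m" using s0 by (auto simp: expand_inv_def changes_only_def)
    then show "\<not> holds (Less (Reg zB) (Reg zM)) s" by simp
  next
    show "expand_inv n es s0 0 (set_reg zB 0 s0)" by (simp add: expand_inv_def changes_only_def stored_def)
  qed
  moreover have "runs W (block [Move zB (Const 0)]) s0 2 (\<lambda>s. s = set_reg zB 0 s0)"
    using roomyD(2)[OF W] by (intro runs_block) simp_all
  ultimately have "runs W expand s0 (3 + ?m * (length expand_body + 2)) (expand_inv n es s0 ?m)"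
    unfolding expand_def
    by (intro runs_Seq[where ?T1.0 = 2 and ?T2.0 = "Suc (?m * Suc (Suc (length expand_body)))"])
      (auto elim!: runs_weaken)
  then show ?thesis
  proof (rule runs_weaken)
    fix s assume inv: "expand_inv n es s0 ?m s"
    have split: "p mod ?m < ?m \<and> p div ?m \<le> k \<longleftrightarrow> p < Suc k * ?m" for p
    proof (cases "?m = 0")
      case False
      then have "p div ?m < Suc k \<longleftrightarrow> p < Suc k * ?m" by (intro div_less_iff_less_mult) simp
      then show ?thesis using False by (simp add: less_Suc_eq_le)
    qed simp
    have len: "length (subdivided_list n k es) = Suc k * ?m" by (simp add: subdivided_list_def)
    \<comment> \<open>Beyond the expanded list both sides are zero, because the original list is not
      longer than the expanded one.\<close>
    have big: "\<not> p < Suc k * ?m \<Longrightarrow> \<not> p < ?m" for p by simp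
    have "arrs s ''src'' = arrs (graph_input n' (subdivided_list n k es)) ''src''"
      "arrs s ''dst'' = arrs (graph_input n' (subdivided_list n k es)) ''dst''"
      using inv s0(3,4) big unfolding expand_inv_def split graph_input_def len
      by (auto simp: fun_eq_iff subdivided_list_def simp del: mult_Suc upt_Suc)
    then show "changes_only {zB, zX, zY, zBase, zT, zPos} {aX, aY, aSlot, ''src'', ''dst''} s0 s \<and>
       stored n ?f {..<?m} s \<and>
       arrs s ''src'' = arrs (graph_input n' (subdivided_list n k es)) ''src'' \<and>
       arrs s ''dst'' = arrs (graph_input n' (subdivided_list n k es)) ''dst''"
      using inv by (simp add: expand_inv_def)
  qed simp
qed

end

section \<open>Static algorithms\<close>

definition rnd :: "nat \<Rightarrow> nat \<Rightarrow> nat \<Rightarrow> nat \<times> nat" where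
  "rnd k p q = (if q = 0 then (p, q) else (p div q div Suc k, 1))"

text \<open>Rounding can produce numerator \<open>0\<close>; denominator \<open>1\<close> keeps the
  result distinct from the pair \<open>(0, 0)\<close>.\<close>

lemma is_estimate_rnd: "is_estimate p q \<Longrightarrow> is_estimate (fst (rnd k p q)) (snd (rnd k p q))"
  by (auto simp: is_estimate_def rnd_def)

lemma good_estimate_rnd:
  assumes "slots n m f B" "1 \<le> k" "u < n" "v < n" "1 \<le> a" "0 \<le> \<epsilon>"
    "good_estimate (real a + \<epsilon>) (real k) (seg n k f ` (B \<times> {..k})) u v (estimate p q)"
  shows "good_estimate (real a + (real k + 2) * \<epsilon>) 0 (ends f ` B) u v
     (estimate (fst (rnd k p q)) (snd (rnd k p q)))"
  using good_estimate_round[OF assms] by (simp add: rnd_def split: if_splits)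

lemma card_seg:
  assumes "slots n m f B" "1 \<le> k"
  shows "card (seg n k f ` (B \<times> {..k})) = Suc k * card B"
  using card_image[OF inj_on_seg[OF assms]] by (simp add: card_cartesian_product)

lemma card_ends: "slots n m f B \<Longrightarrow> card (ends f ` B) = card B"
  by (auto simp: slots_def card_image)

text \<open>Every estimate has to be written, and memory is initially zero.\<close>

lemma static_time_lower_bound:
  assumes ex: "exec W A (graph_input n es) t s"
    and est: "\<And>u v. u < n \<Longrightarrow> v < n \<Longrightarrow>
      is_estimate (arrs s ''num'' (u * n + v)) (arrs s ''den'' (u * n + v))"
  shows "n * n \<le> t"
proof -
  let ?C = "changed (graph_input n es) s"
  have "{..<n * n} \<subseteq> snd ` ?C"
  proof
    fix p assume "p \<in> {..<n * n}"
    then have p: "p < n * n" by simp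
    then have "0 < n" by (cases n) auto
    have "p div n < n" using p by (rule less_mult_imp_div_less)
    moreover have "p mod n < n" using \<open>0 < n\<close> by simp
    ultimately have "is_estimate (arrs s ''num'' (p div n * n + p mod n)) (arrs s ''den'' (p div n * n + p mod n))"
      by (rule est)
    then have "is_estimate (arrs s ''num'' p) (arrs s ''den'' p)" by simp
    then have "(''num'', p) \<in> ?C \<or> (''den'', p) \<in> ?C"
      by (auto simp: is_estimate_def changed_def graph_input_def)
    then show "p \<in> snd ` ?C" by force
  qed
  moreover have "finite ?C" "card ?C \<le> t" using card_changed_le_time[OF ex] by auto
  ultimately have "card {..<n * n} \<le> card (snd ` ?C)" by (intro card_mono) auto
  also have "\<dots> \<le> t" using card_image_le[OF \<open>finite ?C\<close>, of snd] \<open>card ?C \<le> t\<close> by linarith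
  finally show ?thesis by simp
qed

lemma roomy_word_bound:
  "roomy k n m (word_bound ((2 * k + 3) * (c + 2)) (n + m + i))"
proof -
  have "n + Suc k * m + Suc k + 2 \<le> (2 * k + 2) * (n + m + i + 2)" by (simp add: algebra_simps)
  then show ?thesis
    using word_bound_sub(2)[of k "n + m + i" c] mult_le_mono unfolding roomy_def by (meson le_trans)
qed

context subdivider
begin

section \<open>Rounding the estimates and compacting the output table\<close>

definition round_code :: "string \<Rightarrow> string \<Rightarrow> com" where
  "round_code p q = If (Equal (Reg q) (Const 0)) Skip
     (block [Arith p Div (Reg p) (Reg q), Arith p Div (Reg p) (Const (Suc k)), Move q (Const 1)])"

lemma runs_round_code:
  assumes "p \<noteq> q" "regs s p < W" "1 < W"
  shows "runs W (round_code p q) s 5 (\<lambda>s'. changes_only {p, q} {} s s' \<and>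
    regs s' p = fst (rnd k (regs s p) (regs s q)) \<and> regs s' q = snd (rnd k (regs s p) (regs s q)))"
    (is "runs _ _ _ _ ?Q")
proof -
  have le: "regs s p div x < W" "regs s p div x div y < W" for x y
    using assms(2) div_le_dividend[of "regs s p" x] div_le_dividend[of "regs s p div x" y] by linarith+
  have "runs W (round_code p q) s (Suc 4) ?Q"
    unfolding round_code_def
  proof (rule runs_If)
    assume "holds (Equal (Reg q) (Const 0)) s"
    then have "?Q s" by (simp add: changes_only_def rnd_def)
    then show "runs W Skip s 4 ?Q" using exec.Skip[of W s] unfolding runs_def by force
  next
    let ?cs = "[Arith p Div (Reg p) (Reg q), Arith p Div (Reg p) (Const (Suc k)), Move q (Const 1)]"
    assume "\<not> holds (Equal (Reg q) (Const 0)) s"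
    then have "wp W ?cs ?Q s" using assms le by (simp add: changes_only_def rnd_def)
    then show "runs W (block ?cs) s 4 ?Q" by (rule runs_block) simp
  qed
  then show ?thesis by simp
qed

definition out_index :: "com list" where
  "out_index = [Arith zX Div (Reg zB) (Reg zN), Arith zT Mul (Reg zX) (Reg zN),
     Arith zT Sub (Reg zB) (Reg zT), Arith zX Mul (Reg zX) (Reg zPos), Arith zX Add (Reg zX) (Reg zT),
     Load zNum ''num'' (Reg zX), Load zDen ''den'' (Reg zX)]"

definition out_store :: "com list" where
  "out_store = [Store ''num'' (Reg zB) (Reg zNum), Store ''den'' (Reg zB) (Reg zDen),
     Arith zB Add (Reg zB) (Const 1)]"

definition out_loop :: com where
  "out_loop = Seq (block [Arith zY Mul (Reg zN) (Reg zN), Move zB (Const 0)])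
     (While (Less (Reg zB) (Reg zY))
       (Seq (block out_index) (Seq (round_code zNum zDen) (block out_store))))"

text \<open>\<open>N\<close> and \<open>D\<close> are the tables left by the simulated algorithm,
  with row length \<open>n'\<close>; the required row length is \<open>n\<close>. Positions from
  \<open>i\<close> on still hold their original entries.\<close>

definition out_inv :: "nat \<Rightarrow> nat \<Rightarrow> (nat \<Rightarrow> nat) \<Rightarrow> (nat \<Rightarrow> nat) \<Rightarrow> nat \<Rightarrow> state \<Rightarrow> bool" where
  "out_inv n n' N D i s \<longleftrightarrow>
     regs s zB = i \<and> regs s zN = n \<and> regs s zPos = n' \<and> regs s zY = n * n \<and>
     (\<forall>p. arrs s ''num'' p =
        (if p < i then fst (rnd k (N (p div n * n' + p mod n)) (D (p div n * n' + p mod n))) else N p)) \<and>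
     (\<forall>p. arrs s ''den'' p =
        (if p < i then snd (rnd k (N (p div n * n' + p mod n)) (D (p div n * n' + p mod n))) else D p))"

text \<open>The copying is in place: entry \<open>p\<close> is computed from an entry with index at least \<open>p\<close>.\<close>

lemma runs_out_loop:
  assumes "regs s zN = n" "regs s zPos = n'" "n \<le> n'" "n' * n' < W"
    and NW: "\<And>p. arrs s ''num'' p < W" and DW: "\<And>p. arrs s ''den'' p < W" and "1 < W"
  shows "runs W out_loop s (4 + n * n * 18)
    (out_inv n n' (arrs s ''num'') (arrs s ''den'') (n * n))"
proof -
  let ?I = "out_inv n n' (arrs s ''num'') (arrs s ''den'')"
  let ?body = "Seq (block out_index) (Seq (round_code zNum zDen) (block out_store))"
  let ?cs = "[Arith zY Mul (Reg zN) (Reg zN), Move zB (Const 0)]"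
  have nn: "n * n \<le> n' * n'" using \<open>n \<le> n'\<close> by (rule mult_le_mono) (rule \<open>n \<le> n'\<close>)
  let ?s1 = "set_reg zB 0 (set_reg zY (n * n) s)"
  have loop: "runs W (While (Less (Reg zB) (Reg zY)) ?body) ?s1 (Suc (n * n * Suc 17)) (?I (n * n))"
  proof (rule runs_While_count)
    show "?I 0 ?s1" using assms by (simp add: out_inv_def)
  next
    fix t assume "?I (n * n) t"
    then show "\<not> holds (Less (Reg zB) (Reg zY)) t" by (simp add: out_inv_def)
  next
    fix i t assume i: "i < n * n" and inv: "?I i t"
    have "0 < n" using i by (cases n) auto
    have "i div n < n" using i by (rule less_mult_imp_div_less)
    then have ind: "i div n < n'" "i mod n < n'" using \<open>n \<le> n'\<close> \<open>0 < n\<close> mod_less_divisor[OF \<open>0 < n\<close>, of i]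
      by linarith+
    let ?q = "i div n * n' + i mod n"
    have qW: "?q < W" using key_less[OF ind] assms(4) by linarith
    have "i div n * n \<le> i div n * n'" using \<open>n \<le> n'\<close> by (rule mult_le_mono2)
    then have iq: "i \<le> ?q" using div_mult_mod_eq[of i n] by linarith
    have iW: "i < W" "Suc i < W" using i nn assms(4) by linarith+
    have small: "i div n < W" "i div n * n < W" "i div n * n' < W" "i - i div n * n < W"
      using iW qW div_le_dividend[of i n] \<open>i div n * n \<le> i div n * n'\<close> by linarith+
    have md: "i - i div n * n = i mod n" by (simp add: minus_div_mult_eq_mod)
    note inv' = inv[unfolded out_inv_def]
    have rd: "arrs t ''num'' ?q = arrs s ''num'' ?q" "arrs t ''den'' ?q = arrs s ''den'' ?q"
      using inv' iq by simp_all
    have "wp W out_index (\<lambda>t1. changes_only {zX, zT, zNum, zDen} {} t t1 \<and>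
      regs t1 zNum = arrs s ''num'' ?q \<and> regs t1 zDen = arrs s ''den'' ?q) t"
      using inv' small qW NW DW rd by (simp add: out_index_def changes_only_def md)
    then have 1: "runs W (block out_index) t 8 (\<lambda>t1. changes_only {zX, zT, zNum, zDen} {} t t1 \<and>
      regs t1 zNum = arrs s ''num'' ?q \<and> regs t1 zDen = arrs s ''den'' ?q)"
      by (rule runs_block) (simp add: out_index_def)
    let ?r = "rnd k (arrs s ''num'' ?q) (arrs s ''den'' ?q)"
    have rW: "fst ?r < W" "snd ?r < W"
      using NW[of ?q] DW[of ?q] \<open>1 < W\<close> unfolding rnd_def
      by (auto intro: le_less_trans[OF div_le_dividend])
    have "runs W ?body t 17 (?I (Suc i))"
    proof (rule runs_Seq[OF runs_weaken[OF 1 le_refl]])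
      fix t1 assume t1: "changes_only {zX, zT, zNum, zDen} {} t t1 \<and>
        regs t1 zNum = arrs s ''num'' ?q \<and> regs t1 zDen = arrs s ''den'' ?q"
      have "runs W (round_code zNum zDen) t1 5 (\<lambda>t2. changes_only {zNum, zDen} {} t1 t2 \<and>
        regs t2 zNum = fst ?r \<and> regs t2 zDen = snd ?r)"
        using runs_round_code[of zNum zDen t1 W] t1 NW \<open>1 < W\<close> by simp
      then show "runs W (Seq (round_code zNum zDen) (block out_store)) t1 9 (?I (Suc i))"
      proof (rule runs_Seq[OF runs_weaken[OF _ le_refl]])
        fix t2 assume t2: "changes_only {zNum, zDen} {} t1 t2 \<and> regs t2 zNum = fst ?r \<and> regs t2 zDen = snd ?r"
        then have r: "regs t2 zB = i" "regs t2 zN = n" "regs t2 zPos = n'" "regs t2 zY = n * n"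
          "regs t2 zNum = fst ?r" "regs t2 zDen = snd ?r" "arrs t2 = arrs t"
          using t1 inv' by (auto simp: changes_only_def fun_eq_iff)
        have "wp W out_store (?I (Suc i)) t2"
          using r rW iW inv' by (auto simp: out_store_def out_inv_def less_Suc_eq)
        then show "runs W (block out_store) t2 4 (?I (Suc i))"
          by (rule runs_block) (simp add: out_store_def)
      qed simp
    qed simp
    then show "holds (Less (Reg zB) (Reg zY)) t \<and> runs W ?body t 17 (?I (Suc i))"
      using i inv' by simp
  qed
  have "wp W ?cs (\<lambda>t. t = ?s1) s" using assms nn by simp
  then have "runs W (block ?cs) s 3 (\<lambda>t. t = ?s1)" by (rule runs_block) simp
  then have "runs W (block ?cs) s 3
      (\<lambda>t. runs W (While (Less (Reg zB) (Reg zY)) ?body) t (Suc (n * n * Suc 17)) (?I (n * n)))"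
    by (rule runs_weaken) (use loop in auto)
  then show ?thesis unfolding out_loop_def by (rule runs_Seq) simp
qed

section \<open>The static reduction\<close>

definition static_prog :: "com \<Rightarrow> com" where
  "static_prog A = Seq (block [Move zN (Reg ''n''), Move zM (Reg ''m'')]) (Seq expand
     (Seq (block [Arith zT Mul (Reg zM) (Const k), Arith ''n'' Add (Reg zN) (Reg zT),
          Arith ''m'' Mul (Reg zM) (Const (Suc k)), Move zPos (Reg ''n'')])
       (Seq A out_loop)))"

lemma runs_static_prog:
  assumes S: "slots n m ((!) es) {..<length es}" and m: "length es = m" and W: "roomy k n m W"
    and vA: "vars A \<subseteq> - range z"
    and ex: "exec W0 A (graph_input (n + k * m) (subdivided_list n k es)) t sA" and "W0 \<le> W"
  shows "runs W (static_prog A) (graph_input n es) (t + 15 + m * (length expand_body + 2) + n * n * 18)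
    (out_inv n (n + k * m) (arrs sA ''num'') (arrs sA ''den'') (n * n))"
proof -
  let ?n = "n + k * m" and ?s0 = "graph_input n es" and ?es = "subdivided_list n k es"
  let ?L = "length expand_body"
  note RW = roomyD[OF W]
  have kW: "m < W" "n < W" "k * m < W" "n + k * m < W" "m + k * m < W" "1 < W" using RW(2) by simp_all
  have len: "length ?es = Suc k * m" by (simp add: subdivided_list_def m)
  let ?s1 = "set_reg zM m (set_reg zN n ?s0)"
  have 1: "runs W (block [Move zN (Reg ''n''), Move zM (Reg ''m'')]) ?s0 3 (\<lambda>s. s = ?s1)"
  proof -
    have "wp W [Move zN (Reg ''n''), Move zM (Reg ''m'')] (\<lambda>s. s = ?s1) ?s0"
      using kW m by (simp add: graph_input_def)
    then show ?thesis by (rule runs_block) simp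
  qed
  let ?R = "{zB, zX, zY, zBase, zT, zPos}" and ?A = "{aX, aY, aSlot, ''src'', ''dst''}"
  have "runs W expand ?s1 (3 + length es * (length expand_body + 2))
    (\<lambda>s. changes_only ?R ?A ?s1 s \<and> stored n ((!) es) {..<length es} s \<and>
       arrs s ''src'' = arrs (graph_input ?n ?es) ''src'' \<and> arrs s ''dst'' = arrs (graph_input ?n ?es) ''dst'')"
    by (rule runs_expand[OF S _ W]) (use m in auto)
  then have 2: "runs W expand ?s1 (3 + m * (?L + 2)) (\<lambda>s. changes_only ?R ?A ?s1 s \<and>
       arrs s ''src'' = arrs (graph_input ?n ?es) ''src'' \<and> arrs s ''dst'' = arrs (graph_input ?n ?es) ''dst'')"
    unfolding m by (rule runs_weaken) auto
  let ?cs = "[Arith zT Mul (Reg zM) (Const k), Arith ''n'' Add (Reg zN) (Reg zT),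
          Arith ''m'' Mul (Reg zM) (Const (Suc k)), Move zPos (Reg ''n'')]"
  let ?T = "5 + (t + (4 + n * n * 18))"
  let ?Q = "out_inv n ?n (arrs sA ''num'') (arrs sA ''den'') (n * n)"
  have "runs W (Seq (block ?cs) (Seq A out_loop)) s2 ?T ?Q"
    if s2: "changes_only ?R ?A ?s1 s2 \<and> arrs s2 ''src'' = arrs (graph_input ?n ?es) ''src'' \<and>
      arrs s2 ''dst'' = arrs (graph_input ?n ?es) ''dst''" for s2
  proof -
    have z2: "regs s2 zM = m" "regs s2 zN = n" using s2 by (auto simp: changes_only_def)
    define s3 where "s3 = set_reg zPos ?n (set_reg ''m'' (m * Suc k) (set_reg ''n'' ?n (set_reg zT (k * m) s2)))"
    have "wp W ?cs (\<lambda>s. s = s3) s2" using kW z2 by (simp add: s3_def mult.commute)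
    then have 3: "runs W (block ?cs) s2 5 (\<lambda>s. s = s3)" by (rule runs_block) simp
    \<comment> \<open>The memory handed to \<open>A\<close> must look like a fresh input under every
      name that \<open>A\<close> may mention. This is why all scratch data has names in
      \<open>range z\<close> and why the size registers are overwritten before \<open>A\<close>
      starts.\<close>
    have ag: "agree (- range z) (graph_input ?n ?es) s3"
      unfolding agree_def
    proof (intro ballI conjI)
      fix x assume x: "x \<in> - range z"
      then have nz: "x \<noteq> z i" for i by auto
      have "regs s2 x = regs ?s0 x" using s2 nz by (auto simp: changes_only_def)
      then show "regs (graph_input ?n ?es) x = regs s3 x"
        using nz by (simp add: s3_def graph_input_def len mult.commute)
      show "arrs (graph_input ?n ?es) x = arrs s3 x"
      proof (cases "x = ''src'' \<or> x = ''dst''")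
        case True
        then show ?thesis using s2 by (auto simp: s3_def)
      next
        case False
        then have "arrs s2 x = arrs ?s0 x" using s2 nz by (auto simp: changes_only_def)
        then show ?thesis using False by (simp add: s3_def graph_input_def)
      qed
    qed
    \<comment> \<open>A bound on the input carries over to the memory left by \<open>A\<close>, so
      that \<open>out_loop\<close> can load the estimates.\<close>
    have "bounded W (graph_input ?n ?es)"
    proof -
      have "fst (?es ! p) < W \<and> snd (?es ! p) < W" if "p < Suc k * m" for p
      proof -
        have "(p mod m, p div m) \<in> {..<m} \<times> {..k}"
          using bij_betw_mod_div[of m k] that by (auto simp: bij_betw_def)
        then have "node n k ((!) es) (p mod m) j < n + k * m" if "j \<le> Suc k" for j
          using node_less[OF S _ that] m by auto
        moreover have "p div m \<le> k" using \<open>(p mod m, p div m) \<in> _\<close> by simp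
        ultimately have "node n k ((!) es) (p mod m) (p div m) < W" "node n k ((!) es) (p mod m) (Suc (p div m)) < W"
          using kW(4) by (meson le_SucI less_trans Suc_le_mono)+
        then show ?thesis using that m by (simp add: subdivided_list_def del: mult_Suc upt_Suc)
      qed
      then show ?thesis using kW by (auto simp: bounded_def graph_input_def len simp del: mult_Suc) simp
    qed
    then have bA: "bounded W sA" using exec_bounded[OF exec_mono[OF ex \<open>W0 \<le> W\<close>]] by simp
    have 4: "runs W A s3 t (\<lambda>s4. agree (- range z) sA s4 \<and> agree (- (- range z)) s3 s4)"
      by (rule runs_frame[OF ex \<open>W0 \<le> W\<close> vA ag])
    have "runs W out_loop s4 (4 + n * n * 18) ?Q"
      if s4: "agree (- range z) sA s4 \<and> agree (- (- range z)) s3 s4" for s4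
    proof -
      have nd: "''num'' \<in> - range z" "''den'' \<in> - range z" by auto
      have eq: "arrs s4 ''num'' = arrs sA ''num''" "arrs s4 ''den'' = arrs sA ''den''"
        using s4 nd unfolding agree_def by auto
      have "regs s4 zN = regs s3 zN" "regs s4 zPos = regs s3 zPos" using s4 by (auto simp: agree_def)
      then have zz: "regs s4 zN = n" "regs s4 zPos = ?n" using z2 by (simp_all add: s3_def)
      have "?n * ?n < (n + Suc k * m + Suc k + 2) * (n + Suc k * m + Suc k + 2)"
        by (rule mult_strict_mono) auto
      then have "?n * ?n < W" using W unfolding roomy_def by linarith
      then have "runs W out_loop s4 (4 + n * n * 18) (out_inv n ?n (arrs s4 ''num'') (arrs s4 ''den'') (n * n))"
        using zz bA eq kW(6) by (intro runs_out_loop) (auto simp: bounded_def)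
      then show ?thesis unfolding eq .
    qed
    then have "runs W (Seq A out_loop) s3 (t + (4 + n * n * 18)) ?Q"
      by (intro runs_Seq[OF runs_weaken[OF 4 le_refl]]) auto
    then show ?thesis by (intro runs_Seq[OF runs_weaken[OF 3 le_refl]]) auto
  qed
  then have "runs W (Seq expand (Seq (block ?cs) (Seq A out_loop))) ?s1 ((3 + m * (?L + 2)) + ?T) ?Q"
    by (intro runs_Seq[OF runs_weaken[OF 2 le_refl]]) auto
  then show ?thesis unfolding static_prog_def
    by (intro runs_Seq[OF runs_weaken[OF 1 le_refl]]) auto
qed

lemma static_reduction:
  assumes A: "static_apsp (real a + \<epsilon>) (real k) A \<tau>" and vA: "vars A \<subseteq> - range z"
    and "1 \<le> a" "0 \<le> \<epsilon>"
  shows "\<exists>C. static_apsp (real a + (real k + 2) * \<epsilon>) 0 (static_prog A)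
    (\<lambda>n m. C * \<tau> (n + k * m) ((k + 1) * m))"
proof -
  from A obtain c where c: "\<And>n E es. ugraph n E \<and> lists_edges es E \<longrightarrow>
       (\<exists>t s. exec (word_bound c (n + card E)) A (graph_input n es) t s \<and> t \<le> \<tau> n (card E) \<and>
          (\<forall>u<n. \<forall>v<n. is_estimate (arrs s ''num'' (u * n + v)) (arrs s ''den'' (u * n + v))) \<and>
          apsp_approx (real a + \<epsilon>) (real k) n E
            (\<lambda>u v. estimate (arrs s ''num'' (u * n + v)) (arrs s ''den'' (u * n + v))))"
    unfolding static_apsp_def by blast
  \<comment> \<open>With \<open>L\<close> the length of \<open>expand_body\<close> and with 1,
    \<open>m\<close> and \<open>n * n\<close> all at most \<open>t\<close>, the time
    \<open>t + 15 + m * (L + 2) + n * n * 18\<close> is at most \<open>(36 + L) * t\<close>.\<close>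
  define C where "C = 36 + length expand_body"
  show ?thesis unfolding static_apsp_def
  proof (rule exI[of _ C], rule exI[of _ "(2 * k + 3) * (c + 2)"], intro allI impI, elim conjE)
    fix n E es assume G: "ugraph n E" "lists_edges es E"
    define m where "m = card E"
    have m: "length es = m" using lists_edges_length[OF G(2)] by (simp add: m_def)
    let ?f = "(!) es" and ?n = "n + k * m" and ?W = "word_bound ((2 * k + 3) * (c + 2)) (n + card E)"
    let ?E = "seg n k ?f ` ({..<length es} \<times> {..k})"
    have S: "slots n m ?f {..<length es}" and E: "ends ?f ` {..<length es} = E"
      using lists_edges_slots[OF G, of m] m by auto
    have cE: "card ?E = Suc k * m" using card_seg[OF S k] m by simp
    have "ugraph ?n ?E" by (rule seg_ugraph[OF S k])
    moreover have "lists_edges (subdivided_list n k es) ?E" by (rule lists_edges_subdivided[OF S k])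
    ultimately obtain t sA where
      ex: "exec (word_bound c (?n + card ?E)) A (graph_input ?n (subdivided_list n k es)) t sA"
      and t: "t \<le> \<tau> ?n (card ?E)"
      and est: "\<And>u v. u < ?n \<Longrightarrow> v < ?n \<Longrightarrow> is_estimate (arrs sA ''num'' (u * ?n + v)) (arrs sA ''den'' (u * ?n + v))"
      and app: "apsp_approx (real a + \<epsilon>) (real k) ?n ?E
            (\<lambda>u v. estimate (arrs sA ''num'' (u * ?n + v)) (arrs sA ''den'' (u * ?n + v)))"
      using c[of ?n ?E "subdivided_list n k es"] by blast
    have "?n + card ?E + 2 \<le> (2 * k + 2) * (n + m + 2)" unfolding cE by (simp add: algebra_simps)
    then have WW: "word_bound c (?n + card ?E) \<le> ?W" unfolding m_def by (rule word_bound_sub(1))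
    have W: "roomy k n m ?W" using roomy_word_bound[of k n m c 0] by (simp add: m_def)
    from runs_static_prog[OF S m W vA ex WW] obtain t' s where
      ex': "exec ?W (static_prog A) (graph_input n es) t' s"
      and t': "t' \<le> t + 15 + m * (length expand_body + 2) + n * n * 18"
      and inv: "out_inv n ?n (arrs sA ''num'') (arrs sA ''den'') (n * n) s"
      unfolding runs_def by blast
    \<comment> \<open>The lower bound is applied to the subdivided graph. It therefore dominates not
      only \<open>n * n\<close> but also \<open>m\<close>, as
      \<open>m \<le> k * m \<le> n + k * m\<close>.\<close>
    have "?n * ?n \<le> t" by (rule static_time_lower_bound[OF ex est])
    moreover have "n * n \<le> ?n * ?n" by (rule mult_le_mono) auto
    ultimately have nt: "n * n \<le> t" by linarith
    have "1 * m \<le> k * m" using k by (rule mult_le_mono1)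
    then have "m \<le> ?n" unfolding mult_1 by linarith
    also have "?n \<le> ?n * ?n" by (rule le_square)
    also have "\<dots> \<le> t" by fact
    finally have "m * (length expand_body + 2) \<le> t * (length expand_body + 2)" by (rule mult_le_mono1)
    moreover have "1 \<le> t" using exec_pos[OF ex] by simp
    moreover have "t * (length expand_body + 2) = t * length expand_body + 2 * t"
      "C * t = 36 * t + t * length expand_body"
      by (simp_all add: C_def algebra_simps)
    ultimately have "t' \<le> C * t" using t' nt by linarith
    also have "\<dots> \<le> C * \<tau> ?n (card ?E)" using t by (rule mult_le_mono2)
    finally have time: "t' \<le> C * \<tau> (n + k * card E) ((k + 1) * card E)" unfolding cE m_def by simp
    have out: "arrs s ''num'' (u * n + v) = fst (rnd k (arrs sA ''num'' (u * ?n + v)) (arrs sA ''den'' (u * ?n + v)))"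
      "arrs s ''den'' (u * n + v) = snd (rnd k (arrs sA ''num'' (u * ?n + v)) (arrs sA ''den'' (u * ?n + v)))"
      if "u < n" "v < n" for u v
      using inv key_less[OF that] that unfolding out_inv_def by simp_all
    have "is_estimate (arrs s ''num'' (u * n + v)) (arrs s ''den'' (u * n + v))" if "u < n" "v < n" for u v
      unfolding out[OF that] using that by (intro is_estimate_rnd est) auto
    moreover have "good_estimate (real a + (real k + 2) * \<epsilon>) 0 E u v
        (estimate (arrs s ''num'' (u * n + v)) (arrs s ''den'' (u * n + v)))" if "u < n" "v < n" for u v
      unfolding out[OF that] E[symmetric]
      using app that \<open>1 \<le> a\<close> \<open>0 \<le> \<epsilon>\<close> by (intro good_estimate_rnd[OF S k]) (auto simp: apsp_approx_def)
    ultimately show "\<exists>t s. exec ?W (static_prog A) (graph_input n es) t s \<and>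
          t \<le> C * \<tau> (n + k * card E) ((k + 1) * card E) \<and>
          (\<forall>u<n. \<forall>v<n. is_estimate (arrs s ''num'' (u * n + v)) (arrs s ''den'' (u * n + v))) \<and>
          apsp_approx (real a + (real k + 2) * \<epsilon>) 0 n E
            (\<lambda>u v. estimate (arrs s ''num'' (u * n + v)) (arrs s ''den'' (u * n + v)))"
      using ex' time unfolding apsp_approx_def by blast
  qed
qed

end

section \<open>Dynamic algorithms\<close>

context subdivider
begin

definition sim :: "string set \<Rightarrow> state \<Rightarrow> state \<Rightarrow> bool" where
  "sim R s0 s \<longleftrightarrow> (\<forall>x. x \<notin> range z \<longrightarrow> x \<notin> R \<longrightarrow> regs s0 x = regs s x) \<and>
     (\<forall>x. x \<notin> range z \<longrightarrow> arrs s0 x = arrs s x)"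

lemma sim_changes_only:
  assumes "sim R s0 s" "changes_only R' A s s'" "A \<subseteq> range z" "R' \<subseteq> range z \<union> R"
  shows "sim R s0 s'"
  using assms unfolding sim_def changes_only_def by (metis UnE subsetD)

text \<open>
  Between two operations the registers \<open>num\<close> and \<open>den\<close> hold the answer to the last query, their values in
  the simulated run are kept in \<open>zNum\<close> and \<open>zDen\<close>; \<open>u\<close> and \<open>v\<close> are overwritten by the next operation.
\<close>

definition parked :: "state \<Rightarrow> state \<Rightarrow> bool" where
  "parked s0 s \<longleftrightarrow> sim {''num'', ''den'', ''u'', ''v''} s0 s \<and>
     regs s zNum = regs s0 ''num'' \<and> regs s zDen = regs s0 ''den''"

definition free_stack :: "nat \<Rightarrow> nat set \<Rightarrow> state \<Rightarrow> bool" where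
  "free_stack m B s \<longleftrightarrow> regs s zTop = m - card B \<and>
     bij_betw (arrs s aStack) {..<m - card B} ({..<m} - B)"

definition memory :: "nat \<Rightarrow> nat \<Rightarrow> (nat \<Rightarrow> nat \<times> nat) \<Rightarrow> nat set \<Rightarrow> state \<Rightarrow> bool" where
  "memory n m f B s \<longleftrightarrow> regs s zN = n \<and> stored n f B s \<and> free_stack m B s"

lemma memory_cong:
  assumes "regs s' zN = regs s zN" "regs s' zTop = regs s zTop"
    "arrs s' aX = arrs s aX" "arrs s' aY = arrs s aY" "arrs s' aSlot = arrs s aSlot" "arrs s' aStack = arrs s aStack"
  shows "memory n m f B s' = memory n m f B s"
  using assms by (simp add: memory_def stored_def free_stack_def)

section \<open>Programs of the dynamic reduction\<close>

definition restore :: "com list" where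
  "restore = [Move ''num'' (Reg zNum), Move ''den'' (Reg zDen)]"

definition save :: com where
  "save = block [Move zNum (Reg ''num''), Move zDen (Reg ''den'')]"

definition restored :: "state \<Rightarrow> state" where
  "restored s = set_reg ''den'' (regs s zDen) (set_reg ''num'' (regs s zNum) s)"

lemma wp_restore: "bounded W s \<Longrightarrow> wp W (restore @ cs) R s = wp W cs R (restored s)"
  by (simp add: restore_def restored_def bounded_def)

lemma sim_restored: "parked s0 s \<Longrightarrow> sim {''u'', ''v''} s0 (restored s)"
  by (simp add: parked_def sim_def restored_def)

lemma runs_save:
  assumes "sim {''u'', ''v''} s0 s" "regs s ''num'' < W" "regs s ''den'' < W"
  shows "runs W save s 3 (\<lambda>s'. changes_only {zNum, zDen} {} s s' \<and> parked s0 s')"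
proof -
  let ?s = "set_reg zDen (regs s ''den'') (set_reg zNum (regs s ''num'') s)"
  have nz: "''num'' \<notin> range z" "''den'' \<notin> range z" by auto
  then have nd: "regs s ''num'' = regs s0 ''num''" "regs s ''den'' = regs s0 ''den''"
    using assms(1) by (auto simp: sim_def)
  have "changes_only {zNum, zDen} {} s ?s" by (simp add: changes_only_def)
  moreover have "sim {''num'', ''den'', ''u'', ''v''} s0 s" using assms(1) by (auto simp: sim_def)
  then have "sim {''num'', ''den'', ''u'', ''v''} s0 ?s"
    using \<open>changes_only {zNum, zDen} {} s ?s\<close> by (rule sim_changes_only) auto
  then have "parked s0 ?s" using nd by (simp add: parked_def)
  ultimately have "wp W [Move zNum (Reg ''num''), Move zDen (Reg ''den'')]
    (\<lambda>s'. changes_only {zNum, zDen} {} s s' \<and> parked s0 s') s"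
    using assms(2,3) by simp
  then show ?thesis unfolding save_def by (rule runs_block) simp
qed

text \<open>The arguments are loaded anew before each copy of the update program, since a copy may
  overwrite \<open>u\<close> and \<open>v\<close>.\<close>

primrec run_segs :: "com \<Rightarrow> nat \<Rightarrow> com" where
  "run_segs X 0 = block []"
| "run_segs X (Suc j) = Seq (run_segs X j) (Seq (block [load_node ''u'' j, load_node ''v'' (Suc j)]) X)"

definition insert_pre :: "com list" where
  "insert_pre = [Arith zTop Sub (Reg zTop) (Const 1), Load zB aStack (Reg zTop),
     Move zX (Reg ''u''), Move zY (Reg ''v'')] @ record_edge @ base"

text \<open>The stored orientation is reloaded, because the numbering along the path depends on it
  while the update may name the edge the other way round.\<close>

definition delete_pre :: "com list" where
  "delete_pre = [Arith zT Mul (Reg ''u'') (Reg zN), Arith zT Add (Reg zT) (Reg ''v''),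
     Load zB aSlot (Reg zT), Store aStack (Reg zTop) (Reg zB), Arith zTop Add (Reg zTop) (Const 1),
     Load zX aX (Reg zB), Load zY aY (Reg zB)] @ base"

definition update_pre :: "kind \<Rightarrow> com list" where
  "update_pre \<kappa> = (case \<kappa> of Insert \<Rightarrow> insert_pre | Delete \<Rightarrow> delete_pre)"

definition update_prog :: "kind \<Rightarrow> com \<Rightarrow> com" where
  "update_prog \<kappa> X = Seq (block (restore @ update_pre \<kappa>)) (Seq (run_segs X (Suc k)) save)"

definition query_prog :: "com \<Rightarrow> com" where
  "query_prog X = Seq (block restore) (Seq X (Seq save (round_code ''num'' ''den'')))"

definition stack_body :: "com list" where
  "stack_body = [Store aStack (Reg zTop) (Reg zB), Arith zTop Add (Reg zTop) (Const 1),
     Arith zB Add (Reg zB) (Const 1)]"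

definition preprocess_prog :: "com \<Rightarrow> com" where
  "preprocess_prog X = Seq (block [Move zN (Reg ''n''), Move zM (Reg ''m''), Move zB (Reg ''m'')])
     (Seq (While (Less (Reg zB) (Reg ''cap'')) (block stack_body))
       (Seq expand
         (Seq (block [Arith zT Mul (Reg ''cap'') (Const k), Arith ''n'' Add (Reg zN) (Reg zT),
              Arith ''m'' Mul (Reg zM) (Const (Suc k)), Arith ''cap'' Mul (Reg ''cap'') (Const (Suc k))])
           (Seq X save))))"

definition dyn_prog :: "dyn_alg \<Rightarrow> dyn_alg" where
  "dyn_prog A = \<lparr>prep_prog = preprocess_prog (prep_prog A),
     upd_prog = (\<lambda>\<kappa>. update_prog \<kappa> (upd_prog A \<kappa>)), qry_prog = query_prog (qry_prog A)\<rparr>"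

text \<open>The slot is the top of the stack and hence known only at run time;
  \<open>card B < m\<close> makes the stack nonempty. Changing \<open>f\<close> at a slot outside
  \<open>B\<close> leaves all present edges alone.\<close>

lemma wp_insert_pre:
  assumes mem: "memory n m f B s" and S: "slots n m f B" and W: "roomy k n m W"
    and uv: "regs s ''u'' = u" "regs s ''v'' = v" "u < n" "v < n" "u \<noteq> v" "{u, v} \<notin> ends f ` B" "card B < m"
  shows "\<exists>b. b < m \<and> b \<notin> B \<and> slots n m (f(b := (u, v))) (insert b B) \<and>
    wp W insert_pre (\<lambda>s'. changes_only {zTop, zB, zX, zY, zT, zBase} {aX, aY, aSlot} s s' \<and>
      memory n m (f(b := (u, v))) (insert b B) s' \<and> at_slot n (f(b := (u, v))) b s') s"
proof -
  note mem = mem[unfolded memory_def free_stack_def]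
  define t where "t = m - card B - 1"
  define b where "b = arrs s aStack t"
  let ?f = "f(b := (u, v))"
  have top: "m - card B = Suc t" using \<open>card B < m\<close> by (simp add: t_def)
  have bij: "bij_betw (arrs s aStack) {..<Suc t} ({..<m} - B)" using mem top by simp
  then have bm: "b \<in> {..<m} - B" unfolding b_def by (rule bij_betwE[THEN bspec]) simp
  then have b: "b < m" "b \<notin> B" by auto
  have ends: "ends ?f c = ends f c" if "c \<in> B" for c using that b by (auto simp: ends_def)
  have S': "slots n m ?f (insert b B)"
    unfolding slots_def
  proof (intro conjI ballI)
    have "inj_on (ends ?f) B" using S ends by (simp add: slots_def inj_on_def)
    moreover have "ends ?f b \<notin> ends ?f ` B" using uv(6) ends by (auto simp: ends_def)
    ultimately show "inj_on (ends ?f) (insert b B)" using b by (simp add: inj_on_insert)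
  qed (use S b uv in \<open>auto simp: slots_def\<close>)
  have lt: "u < W" "v < W" "b < W" "t < W" using uv b roomyD(2)[OF W] by (auto simp: t_def)
  define s1 where "s1 = set_reg zY v (set_reg zX u (set_reg zB b (set_reg zTop t s)))"
  have u1: "changes_only {zTop, zB, zX, zY} {} s s1" by (simp add: changes_only_def s1_def)
  have st1: "stored n ?f B s1" using mem b by (auto simp: stored_def s1_def)
  have z1: "regs s1 zB = b" "regs s1 zX = fst (?f b)" "regs s1 zY = snd (?f b)" "regs s1 zN = n"
    using mem by (simp_all add: s1_def)
  have free: "bij_betw (arrs s aStack) {..<t} ({..<m} - insert b B)"
  proof -
    have "bij_betw (arrs s aStack) ({..<Suc t} - {t}) (({..<m} - B) - {b})"
      using bij_betw_DiffI[OF bij, of "{t}" "{b}"] bm by (simp add: b_def)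
    moreover have "{..<Suc t} - {t} = {..<t}" "({..<m} - B) - {b} = {..<m} - insert b B" by auto
    ultimately show ?thesis by simp
  qed
  have card: "m - card (insert b B) = t" using b slots_finite[OF S] by (simp add: t_def)
  have "wp W (record_edge @ base) (\<lambda>s'. changes_only {zTop, zB, zX, zY, zT, zBase} {aX, aY, aSlot} s s' \<and>
      memory n m ?f (insert b B) s' \<and> at_slot n ?f b s') s1"
    unfolding wp_append
  proof (rule wp_mono[OF wp_record_edge[OF z1 S' b(2) st1 W]])
    fix s2 assume 2: "changes_only {zT} {aX, aY, aSlot} s1 s2 \<and> stored n ?f (insert b B) s2"
    have z2: "regs s2 zB = b" "regs s2 zN = n" using 2 z1 by (auto simp: changes_only_def)
    show "wp W base (\<lambda>s'. changes_only {zTop, zB, zX, zY, zT, zBase} {aX, aY, aSlot} s s' \<and>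
      memory n m ?f (insert b B) s' \<and> at_slot n ?f b s') s2"
    proof (rule wp_mono[OF wp_base[OF z2 b(1) W]])
      fix s3 assume 3: "changes_only {zBase} {} s2 s3 \<and> regs s3 zBase = n + b * k"
      have "changes_only {zTop, zB, zX, zY, zT, zBase} {aX, aY, aSlot} s s3"
        using u1 2 3 by (simp add: changes_only_def)
      moreover have "stored n ?f (insert b B) s3" using 2 3 stored_changes_only[of _ _ s2 s3] by auto
      moreover have "regs s3 zN = n" "regs s3 zTop = t" "arrs s3 aStack = arrs s aStack"
        using u1 2 3 z2 by (auto simp: changes_only_def s1_def)
      then have "free_stack m (insert b B) s3" using free by (simp add: free_stack_def card)
      moreover have "regs s3 zX = fst (?f b)" "regs s3 zY = snd (?f b)"
        using z1(2,3) 2 3 by (simp_all add: changes_only_def)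
      then have "at_slot n ?f b s3" using 3 by (simp add: at_slot_def)
      ultimately show "changes_only {zTop, zB, zX, zY, zT, zBase} {aX, aY, aSlot} s s3 \<and>
        memory n m ?f (insert b B) s3 \<and> at_slot n ?f b s3"
        using \<open>regs s3 zN = n\<close> by (simp add: memory_def)
    qed
  qed
  then have "wp W insert_pre (\<lambda>s'. changes_only {zTop, zB, zX, zY, zT, zBase} {aX, aY, aSlot} s s' \<and>
      memory n m ?f (insert b B) s' \<and> at_slot n ?f b s') s"
    using lt mem top uv b_def by (simp add: insert_pre_def s1_def)
  then show ?thesis using b S' by blast
qed

lemma wp_delete_pre:
  assumes mem: "memory n m f B s" and S: "slots n m f B" and W: "roomy k n m W"
    and uv: "regs s ''u'' = u" "regs s ''v'' = v" "{u, v} \<in> ends f ` B"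
  shows "\<exists>b\<in>B. {u, v} = ends f b \<and>
    wp W delete_pre (\<lambda>s'. changes_only {zTop, zB, zX, zY, zT, zBase} {aStack} s s' \<and>
      memory n m f (B - {b}) s' \<and> at_slot n f b s') s"
proof -
  note mem = mem[unfolded memory_def free_stack_def]
  obtain b where b: "b \<in> B" "{u, v} = ends f b" using uv by auto
  then have bm: "b < m" and f: "fst (f b) < n" "snd (f b) < n" using S by (auto simp: slots_def)
  have or: "u = fst (f b) \<and> v = snd (f b) \<or> u = snd (f b) \<and> v = fst (f b)"
    using b(2) by (auto simp: ends_def doubleton_eq_iff)
  have slot: "arrs s aSlot (u * n + v) = b" using mem b(1) or by (auto simp: stored_def)
  have uvn: "u < n" "v < n" using or f by auto
  define t where "t = m - card B"
  have cB: "0 < card B" using b slots_finite[OF S] by (auto simp: card_gt_0_iff)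
  have "card B \<le> m" using S card_mono[of "{..<m}" B] by (auto simp: slots_def)
  then have card: "m - card (B - {b}) = Suc t" using b cB slots_finite[OF S] by (simp add: t_def)
  define s1 where "s1 = set_reg zY (snd (f b)) (set_reg zX (fst (f b)) (set_reg zTop (Suc t)
    (set_cell aStack t b (set_reg zB b (set_reg zT (u * n + v) (set_reg zT (u * n) s))))))"
  have lt: "u * n + v < W" "u * n < W" "b < W" "Suc t < W" "fst (f b) < W" "snd (f b) < W"
    using key_less[OF uvn] roomyD(1,2)[OF W] bm f by (auto simp: t_def)
  have z1: "regs s1 zB = b" "regs s1 zN = n" "regs s1 zTop = Suc t" "regs s1 zX = fst (f b)" "regs s1 zY = snd (f b)"
    using mem by (simp_all add: s1_def)
  have bij: "bij_betw (arrs s aStack) {..<t} ({..<m} - B)" using mem by (simp add: t_def)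
  have "bij_betw ((arrs s aStack)(t := b)) {..<Suc t} ({..<m} - (B - {b}))"
  proof -
    have "bij_betw ((arrs s aStack)(t := b)) {..<t} ({..<m} - B)"
      using bij by (rule bij_betw_cong[THEN iffD1, rotated]) simp
    moreover have "bij_betw ((arrs s aStack)(t := b)) {t} {b}" by (simp add: bij_betw_def)
    ultimately have "bij_betw ((arrs s aStack)(t := b)) ({..<t} \<union> {t}) (({..<m} - B) \<union> {b})"
      by (rule bij_betw_combine) (use b in auto)
    moreover have "{..<t} \<union> {t} = {..<Suc t}" "({..<m} - B) \<union> {b} = {..<m} - (B - {b})"
      using b bm by auto
    ultimately show ?thesis by simp
  qed
  then have fs: "free_stack m (B - {b}) s1"
    unfolding free_stack_def card using z1 by (simp add: s1_def)
  have st1: "stored n f (B - {b}) s1" using mem by (simp add: stored_def s1_def)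
  have u1: "changes_only {zTop, zB, zX, zY, zT} {aStack} s s1" by (simp add: changes_only_def s1_def)
  have "wp W base (\<lambda>s'. changes_only {zTop, zB, zX, zY, zT, zBase} {aStack} s s' \<and>
      memory n m f (B - {b}) s' \<and> at_slot n f b s') s1"
  proof (rule wp_mono[OF wp_base[OF z1(1,2) bm W]])
    fix s2 assume 2: "changes_only {zBase} {} s1 s2 \<and> regs s2 zBase = n + b * k"
    have "changes_only {zTop, zB, zX, zY, zT, zBase} {aStack} s s2"
      using u1 2 by (simp add: changes_only_def)
    moreover have "memory n m f (B - {b}) s2"
      using 2 fs st1 z1(2) by (simp add: changes_only_def memory_def stored_def free_stack_def)
    moreover have "at_slot n f b s2" using 2 z1 by (simp add: changes_only_def at_slot_def)
    ultimately show "changes_only {zTop, zB, zX, zY, zT, zBase} {aStack} s s2 \<and>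
      memory n m f (B - {b}) s2 \<and> at_slot n f b s2" by blast
  qed
  then have "wp W delete_pre (\<lambda>s'. changes_only {zTop, zB, zX, zY, zT, zBase} {aStack} s s' \<and>
      memory n m f (B - {b}) s' \<and> at_slot n f b s') s"
    using lt mem uv slot b(1) by (simp add: delete_pre_def s1_def t_def stored_def)
  then show ?thesis using b by blast
qed

end

text \<open>While the path grows, the edge set is a proper subset of the completed graph, which has
  at most \<open>Suc k * m\<close> edges. The capacity of the simulated run therefore suffices for
  every single piece.\<close>

lemma insert_seg_path:
  assumes S: "slots n m f (insert b B)" and "b \<notin> B" and k: "1 \<le> k" and "j \<le> k"
  defines "Es \<equiv> \<lambda>j. seg n k f ` (B \<times> {..k} \<union> {b} \<times> {..<j})"
  shows "valid_update Insert (n + k * m) (Suc k * m) (Es j) (node n k f b j) (node n k f b (Suc j))"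
    and "Es (Suc j) = apply_update Insert (Es j) (node n k f b j) (node n k f b (Suc j))"
proof -
  let ?all = "seg n k f ` (insert b B \<times> {..k})"
  have e: "{node n k f b j, node n k f b (Suc j)} = seg n k f (b, j)" by (simp add: seg_def)
  have new: "seg n k f (b, j) \<notin> Es j"
    unfolding Es_def
    by (subst inj_on_image_mem_iff[OF inj_on_seg[OF S k]]) (use \<open>b \<notin> B\<close> \<open>j \<le> k\<close> in auto)
  have "Es j \<subset> ?all"
  proof
    show "Es j \<subseteq> ?all" unfolding Es_def using \<open>j \<le> k\<close> by (intro image_mono) auto
    show "Es j \<noteq> ?all" using new \<open>j \<le> k\<close> by blast
  qed
  moreover have "finite ?all" using slots_finite[OF S] by simp
  ultimately have "card (Es j) < card ?all" by (rule psubset_card_mono[rotated])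
  also have "\<dots> = Suc k * card (insert b B)" by (rule card_seg[OF S k])
  also have "\<dots> \<le> Suc k * m"
    using S card_mono[of "{..<m}" "insert b B"] unfolding slots_def by (intro mult_le_mono2) auto
  finally have "card (Es j) < Suc k * m" .
  then show "valid_update Insert (n + k * m) (Suc k * m) (Es j) (node n k f b j) (node n k f b (Suc j))"
    using node_less[OF S, of b j k] node_less[OF S, of b "Suc j" k] node_neq_Suc[OF S _ k \<open>j \<le> k\<close>, of b]
      new e \<open>j \<le> k\<close> by simp
  have "B \<times> {..k} \<union> {b} \<times> {..<Suc j} = insert (b, j) (B \<times> {..k} \<union> {b} \<times> {..<j})" by auto
  then show "Es (Suc j) = apply_update Insert (Es j) (node n k f b j) (node n k f b (Suc j))"
    unfolding Es_def apply_update.simps e by simp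
qed

text \<open>Injectivity of \<open>seg\<close> is the point: removing an edge from the image removes
  exactly one pair \<open>(b, j)\<close>, so no other piece vanishes with it.\<close>

lemma delete_seg_path:
  assumes S: "slots n m f B" and "b \<in> B" and k: "1 \<le> k" and "j \<le> k"
  defines "Es \<equiv> \<lambda>j. seg n k f ` (B \<times> {..k} - {b} \<times> {..<j})"
  shows "valid_update Delete n' m' (Es j) (node n k f b j) (node n k f b (Suc j))"
    and "Es (Suc j) = apply_update Delete (Es j) (node n k f b j) (node n k f b (Suc j))"
proof -
  have e: "{node n k f b j, node n k f b (Suc j)} = seg n k f (b, j)" by (simp add: seg_def)
  show "valid_update Delete n' m' (Es j) (node n k f b j) (node n k f b (Suc j))"
    unfolding valid_update.simps e Es_def using \<open>b \<in> B\<close> \<open>j \<le> k\<close> by (intro imageI) auto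
  have "B \<times> {..k} - {b} \<times> {..<Suc j} = (B \<times> {..k} - {b} \<times> {..<j}) - {(b, j)}" by auto
  moreover have "seg n k f ` ((B \<times> {..k} - {b} \<times> {..<j}) - {(b, j)}) =
    seg n k f ` (B \<times> {..k} - {b} \<times> {..<j}) - seg n k f ` {(b, j)}"
    by (rule inj_on_image_set_diff[OF inj_on_seg[OF S k]]) (use \<open>b \<in> B\<close> \<open>j \<le> k\<close> in auto)
  ultimately show "Es (Suc j) = apply_update Delete (Es j) (node n k f b j) (node n k f b (Suc j))"
    unfolding Es_def apply_update.simps e by simp
qed

text \<open>Fixing the word exponent \<open>c\<close> once lets all operations of a simulated run
  refer to the same notion of reachability.\<close>

locale dyn_subdivider = subdivider +
  fixes c :: nat and K :: "kind set" and A :: dyn_alg and g :: guarantee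
    and P U Q :: "nat \<Rightarrow> nat \<Rightarrow> nat" and a :: nat and \<epsilon> :: real
  assumes a: "1 \<le> a" and eps: "0 \<le> \<epsilon>"
    and vars_prep: "vars (prep_prog A) \<subseteq> - range z"
    and vars_upd: "vars (upd_prog A \<kappa>) \<subseteq> - range z"
    and vars_qry: "vars (qry_prog A) \<subseteq> - range z"
    and A_prep: "\<lbrakk>ugraph n E; lists_edges es E; card E \<le> m\<rbrakk> \<Longrightarrow>
      \<exists>t s. exec (word_bound c (n + m)) (prep_prog A) (dyn_input n m es) t s \<and> t \<le> P n m"
    and A_amortized: "\<lbrakk>dyn_reach c K A n m E s i j T; g = Amortized\<rbrakk> \<Longrightarrow> T \<le> P n m + j * U n m"
    and A_upd: "\<lbrakk>dyn_reach c K A n m E s i j T; \<kappa> \<in> K; valid_update \<kappa> n m E u v\<rbrakk> \<Longrightarrow>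
      \<exists>t s'. exec (word_bound c (n + m + i)) (upd_prog A \<kappa>) (set_args u v s) t s' \<and>
        (g = Worst_Case \<longrightarrow> t \<le> U n m)"
    and A_qry: "\<lbrakk>dyn_reach c K A n m E s i j T; u < n; v < n\<rbrakk> \<Longrightarrow>
      \<exists>t s'. exec (word_bound c (n + m + i)) (qry_prog A) (set_args u v s) t s' \<and> t \<le> Q n m \<and>
        is_estimate (regs s' ''num'') (regs s' ''den'') \<and>
        good_estimate (real a + \<epsilon>) (real k) E u v (estimate (regs s' ''num'') (regs s' ''den''))"
begin

abbreviation "c' \<equiv> (2 * k + 3) * (c + 2)"

text \<open>Each piece extends a genuine run of \<open>A\<close>, so the assumption on updates
  applies again in the state just reached. \<open>TA\<close> is the time spent by \<open>A\<close>,
  kept apart from the overhead because an amortized guarantee bounds only the total of such times.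
  The overhead is three steps per piece: two arguments and the closing \<open>Skip\<close>.\<close>

lemma runs_run_segs:
  assumes r: "dyn_reach c K A n' m' (Es 0) sA i j T" and "\<kappa> \<in> K"
    and valid: "\<And>q. q \<le> k \<Longrightarrow> valid_update \<kappa> n' m' (Es q) (node n k f b q) (node n k f b (Suc q))"
    and Es: "\<And>q. q \<le> k \<Longrightarrow> Es (Suc q) = apply_update \<kappa> (Es q) (node n k f b q) (node n k f b (Suc q))"
    and sim: "sim {''u'', ''v''} sA s" and at: "at_slot n f b s"
    and nodeW: "\<And>q. q \<le> Suc k \<Longrightarrow> node n k f b q < W"
    and W: "\<And>q. q \<le> k \<Longrightarrow> word_bound c (n' + m' + i + q) \<le> W"
    and "q \<le> Suc k"
  shows "\<exists>TA sA'. dyn_reach c K A n' m' (Es q) sA' (i + q) (j + q) (T + TA) \<and>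
    (g = Worst_Case \<longrightarrow> TA \<le> q * U n' m') \<and>
    runs W (run_segs (upd_prog A \<kappa>) q) s (TA + 3 * q + 1)
      (\<lambda>s'. sim {''u'', ''v''} sA' s' \<and> agree (range z) s s')"
  using \<open>q \<le> Suc k\<close>
proof (induction q)
  case 0
  have "runs W (block []) s 1 (\<lambda>s'. sim {''u'', ''v''} sA s' \<and> agree (range z) s s')"
    by (rule runs_block) (simp_all add: sim agree_refl)
  then show ?case using r by (intro exI[of _ 0] exI[of _ sA]) simp
next
  case (Suc q)
  let ?x = "node n k f b q" and ?y = "node n k f b (Suc q)" and ?X = "upd_prog A \<kappa>"
  from Suc obtain TA sA' where
    r': "dyn_reach c K A n' m' (Es q) sA' (i + q) (j + q) (T + TA)"
    and TA: "g = Worst_Case \<longrightarrow> TA \<le> q * U n' m'"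
    and run: "runs W (run_segs ?X q) s (TA + 3 * q + 1) (\<lambda>s'. sim {''u'', ''v''} sA' s' \<and> agree (range z) s s')"
    by auto
  have q: "q \<le> k" using Suc.prems by simp
  from A_upd[OF r' \<open>\<kappa> \<in> K\<close> valid[OF q]] obtain t sA'' where
    ex: "exec (word_bound c (n' + m' + (i + q))) ?X (set_args ?x ?y sA') t sA''"
    and t: "g = Worst_Case \<longrightarrow> t \<le> U n' m'" by blast
  have WW: "word_bound c (n' + m' + (i + q)) \<le> W" using W[OF q] by (simp add: add.assoc)
  have "runs W (Seq (block [load_node ''u'' q, load_node ''v'' (Suc q)]) ?X) s1 (3 + t)
      (\<lambda>s'. sim {''u'', ''v''} sA'' s' \<and> agree (range z) s s')"
    if s1: "sim {''u'', ''v''} sA' s1 \<and> agree (range z) s s1" for s1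
  proof -
    let ?s2 = "set_reg ''v'' ?y (set_reg ''u'' ?x s1)"
    have at1: "at_slot n f b s1" using at s1 by (simp add: at_slot_def agree_def)
    then have at1': "at_slot n f b (set_reg ''u'' ?x s1)" by (simp add: at_slot_def)
    have "wp W [load_node ''u'' q, load_node ''v'' (Suc q)] (\<lambda>s. s = ?s2) s1"
      using nodeW[of q] nodeW[of "Suc q"] q by (simp add: wp_load_node[OF at1] wp_load_node[OF at1'])
    then have 1: "runs W (block [load_node ''u'' q, load_node ''v'' (Suc q)]) s1 3 (\<lambda>s. s = ?s2)"
      by (rule runs_block) simp
    have "agree (- range z) (set_args ?x ?y sA') ?s2"
      using s1 by (auto simp: sim_def agree_def)
    from runs_frame[OF ex WW vars_upd this]
    have "runs W ?X ?s2 t (\<lambda>s'. sim {''u'', ''v''} sA'' s' \<and> agree (range z) s s')"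
    proof (rule runs_weaken)
      fix s3 assume 3: "agree (- range z) sA'' s3 \<and> agree (- (- range z)) ?s2 s3"
      have "agree (range z) s ?s2" using s1 by (auto simp: agree_def)
      then have "agree (range z) s s3" using 3 agree_trans by auto
      moreover have "sim {''u'', ''v''} sA'' s3" using 3 by (auto simp: sim_def agree_def)
      ultimately show "sim {''u'', ''v''} sA'' s3 \<and> agree (range z) s s3" by blast
    qed simp
    then show ?thesis by (intro runs_Seq[OF runs_weaken[OF 1 le_refl]]) auto
  qed
  then have "runs W (run_segs ?X (Suc q)) s ((TA + t) + 3 * Suc q + 1)
      (\<lambda>s'. sim {''u'', ''v''} sA'' s' \<and> agree (range z) s s')"
    unfolding run_segs.simps by (intro runs_Seq[OF runs_weaken[OF run le_refl]]) auto
  moreover have "dyn_reach c K A n' m' (Es (Suc q)) sA'' (i + Suc q) (j + Suc q) (T + (TA + t))"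
    using dyn_reach.update[OF r' \<open>\<kappa> \<in> K\<close> valid[OF q] ex] Es[OF q] by (simp add: add.assoc)
  moreover have "g = Worst_Case \<longrightarrow> TA + t \<le> Suc q * U n' m'" using TA t by auto
  ultimately show ?case by blast
qed

text \<open>\<open>sA\<close> is the memory of a run of \<open>A\<close> on the subdivided graph that serves the run of \<open>dyn_prog A\<close>.\<close>

definition simulates ::
    "nat \<Rightarrow> nat \<Rightarrow> nat set set \<Rightarrow> state \<Rightarrow> nat \<Rightarrow> nat \<Rightarrow>
     (nat \<Rightarrow> nat \<times> nat) \<Rightarrow> nat set \<Rightarrow> state \<Rightarrow> nat \<Rightarrow> nat \<Rightarrow> bool" where
  "simulates n m E s i j f B sA iA T \<longleftrightarrow> slots n m f B \<and> E = ends f ` B \<and>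
     dyn_reach c K A (n + k * m) (Suc k * m) (seg n k f ` (B \<times> {..k})) sA iA (Suc k * j) T \<and>
     iA \<le> Suc k * i \<and> parked sA s \<and> memory n m f B s"

text \<open>The factor \<open>2 * k + 2\<close> originates here: \<open>n + k * m\<close> nodes,
  capacity \<open>Suc k * m\<close>, at most \<open>Suc k * i\<close> past operations and up to
  \<open>k\<close> pieces of the current one.\<close>

lemma word_bound_sim:
  assumes "iA \<le> Suc k * i" "q \<le> k"
  shows "word_bound c (n + k * m + Suc k * m + iA + q) \<le> word_bound c' (n + m + i)"
proof (rule word_bound_sub(1))
  show "n + k * m + Suc k * m + iA + q + 2 \<le> (2 * k + 2) * (n + m + i + 2)"
    using assms by (simp add: algebra_simps)
qed

lemma runs_update_prog:
  assumes sim: "simulates n m E s i j f B sA iA T" and "\<kappa> \<in> K" and valid: "valid_update \<kappa> n m E u v"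
    and bd: "bounded (word_bound c' (n + m + i)) (set_args u v s)"
  shows "\<exists>f' B' sA' TA. (g = Worst_Case \<longrightarrow> TA \<le> Suc k * U (n + k * m) (Suc k * m)) \<and>
    runs (word_bound c' (n + m + i)) (update_prog \<kappa> (upd_prog A \<kappa>)) (set_args u v s) (TA + 3 * k + 30)
      (\<lambda>s'. simulates n m (apply_update \<kappa> E u v) s' (Suc i) (Suc j) f' B' sA' (iA + Suc k) (T + TA))"
proof -
  let ?W = "word_bound c' (n + m + i)" and ?s = "set_args u v s" and ?X = "upd_prog A \<kappa>"
  let ?R = "{zTop, zB, zX, zY, zT, zBase}"
  note sim = sim[unfolded simulates_def]
  have S: "slots n m f B" and E: "E = ends f ` B"
    and r: "dyn_reach c K A (n + k * m) (Suc k * m) (seg n k f ` (B \<times> {..k})) sA iA (Suc k * j) T"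
    and iA: "iA \<le> Suc k * i" using sim by auto
  have W: "roomy k n m ?W" by (rule roomy_word_bound)
  have parked: "parked sA ?s" using sim by (simp add: parked_def sim_def)
  have mem: "memory n m f B ?s" using sim by (simp add: memory_cong[of ?s s])
  define s1 where "s1 = restored ?s"
  have sim1: "sim {''u'', ''v''} sA s1" unfolding s1_def by (rule sim_restored[OF parked])
  have "memory n m f B s1 = memory n m f B ?s"
    by (rule memory_cong) (simp_all add: s1_def restored_def)
  then have mem1: "memory n m f B s1" using mem by simp
  have uv1: "regs s1 ''u'' = u" "regs s1 ''v'' = v" by (simp_all add: s1_def restored_def)
  let ?Pre = "\<lambda>b f' B'. wp ?W (update_pre \<kappa>) (\<lambda>s2. changes_only ?R {aX, aY, aSlot, aStack} s1 s2 \<and>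
        memory n m f' B' s2 \<and> at_slot n f' b s2) s1"
  \<comment> \<open>Insertion and deletion are brought to a common form: the sets
    \<open>Es 0\<close> to \<open>Es (Suc k)\<close> lead from the old subdivided graph to the new
    one, one piece at a time.\<close>
  have "\<exists>b f' B' Es. slots n m f' B' \<and> apply_update \<kappa> E u v = ends f' ` B' \<and>
    Es 0 = seg n k f ` (B \<times> {..k}) \<and> Es (Suc k) = seg n k f' ` (B' \<times> {..k}) \<and>
    (\<forall>q\<le>k. valid_update \<kappa> (n + k * m) (Suc k * m) (Es q) (node n k f' b q) (node n k f' b (Suc q)) \<and>
       Es (Suc q) = apply_update \<kappa> (Es q) (node n k f' b q) (node n k f' b (Suc q))) \<and>
    (\<forall>q\<le>Suc k. node n k f' b q < n + k * m) \<and> ?Pre b f' B'"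
  proof (cases \<kappa>)
    case Insert
    then have uv: "u < n" "v < n" "u \<noteq> v" "{u, v} \<notin> ends f ` B" "card B < m"
      using valid E card_ends[OF S] by auto
    obtain b where b: "b < m" "b \<notin> B" "slots n m (f(b := (u, v))) (insert b B)"
      and pre: "wp ?W insert_pre (\<lambda>s'. changes_only ?R {aX, aY, aSlot} s1 s' \<and>
        memory n m (f(b := (u, v))) (insert b B) s' \<and> at_slot n (f(b := (u, v))) b s') s1"
      using wp_insert_pre[OF mem1 S W uv1 uv] by blast
    let ?f = "f(b := (u, v))"
    let ?Es = "\<lambda>j. seg n k ?f ` (B \<times> {..k} \<union> {b} \<times> {..<j})"
    have val: "\<forall>q\<le>k. valid_update \<kappa> (n + k * m) (Suc k * m) (?Es q) (node n k ?f b q) (node n k ?f b (Suc q)) \<and>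
       ?Es (Suc q) = apply_update \<kappa> (?Es q) (node n k ?f b q) (node n k ?f b (Suc q))"
      unfolding Insert using insert_seg_path[OF b(3,2) k] by blast
    have "ends ?f ` B = ends f ` B" using b(2) by (intro image_cong) (auto simp: ends_def)
    then have "apply_update \<kappa> E u v = ends ?f ` insert b B"
      using Insert E by (simp add: ends_def[of _ b])
    moreover have "?Es 0 = seg n k f ` (B \<times> {..k})"
      using b(2) by (intro image_cong) (auto simp: seg_def node_def)
    moreover have "B \<times> {..k} \<union> {b} \<times> {..<Suc k} = insert b B \<times> {..k}" by auto
    then have "?Es (Suc k) = seg n k ?f ` (insert b B \<times> {..k})" by simp
    moreover have "\<forall>q\<le>Suc k. node n k ?f b q < n + k * m"
      using node_less[OF b(3), of b] by blast
    moreover have "?Pre b ?f (insert b B)"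
      unfolding update_pre_def Insert kind.case
      by (rule wp_mono[OF pre]) (auto simp: changes_only_def)
    ultimately show ?thesis
      using b(3) val
      by - (rule exI[of _ b], rule exI[of _ ?f], rule exI[of _ "insert b B"], rule exI[of _ ?Es],
        intro conjI; assumption)
  next
    case Delete
    then have uv: "{u, v} \<in> ends f ` B" using valid E by auto
    obtain b where b: "b \<in> B" "{u, v} = ends f b"
      and pre: "wp ?W delete_pre (\<lambda>s'. changes_only ?R {aStack} s1 s' \<and>
        memory n m f (B - {b}) s' \<and> at_slot n f b s') s1"
      using wp_delete_pre[OF mem1 S W uv1 uv] by blast
    let ?Es = "\<lambda>j. seg n k f ` (B \<times> {..k} - {b} \<times> {..<j})"
    have val: "\<forall>q\<le>k. valid_update \<kappa> (n + k * m) (Suc k * m) (?Es q) (node n k f b q) (node n k f b (Suc q)) \<and>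
       ?Es (Suc q) = apply_update \<kappa> (?Es q) (node n k f b q) (node n k f b (Suc q))"
      unfolding Delete using delete_seg_path[OF S b(1) k] by blast
    have "slots n m f (B - {b})" by (rule slots_mono[OF S]) auto
    moreover have "apply_update \<kappa> E u v = ends f ` (B - {b})"
      using Delete E b S inj_on_image_set_diff[of "ends f" B B "{b}"] by (simp add: slots_def)
    moreover have "?Es 0 = seg n k f ` (B \<times> {..k})" by simp
    moreover have "B \<times> {..k} - {b} \<times> {..<Suc k} = (B - {b}) \<times> {..k}" by auto
    then have "?Es (Suc k) = seg n k f ` ((B - {b}) \<times> {..k})" by simp
    moreover have "\<forall>q\<le>Suc k. node n k f b q < n + k * m"
      using node_less[OF S b(1)] by blast
    moreover have "?Pre b f (B - {b})"
      unfolding update_pre_def Delete kind.case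
      by (rule wp_mono[OF pre]) (auto simp: changes_only_def)
    ultimately show ?thesis
      using val
      by - (rule exI[of _ b], rule exI[of _ f], rule exI[of _ "B - {b}"], rule exI[of _ ?Es],
        intro conjI; assumption)
  qed
  then obtain b f' B' Es where S': "slots n m f' B'" and E': "apply_update \<kappa> E u v = ends f' ` B'"
    and Es0: "Es 0 = seg n k f ` (B \<times> {..k})" and Esk: "Es (Suc k) = seg n k f' ` (B' \<times> {..k})"
    and val: "\<forall>q\<le>k. valid_update \<kappa> (n + k * m) (Suc k * m) (Es q) (node n k f' b q) (node n k f' b (Suc q)) \<and>
       Es (Suc q) = apply_update \<kappa> (Es q) (node n k f' b q) (node n k f' b (Suc q))"
    and nd: "\<forall>q\<le>Suc k. node n k f' b q < n + k * m"
    and pre: "?Pre b f' B'" by (elim exE conjE)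
  have ndW: "node n k f' b q < ?W" if "q \<le> Suc k" for q
    using nd[rule_format, OF that] roomyD(2)[OF W] by simp
  have wW: "word_bound c (n + k * m + Suc k * m + iA + q) \<le> ?W" if "q \<le> k" for q
    by (rule word_bound_sim[OF iA that])
  have "wp ?W (restore @ update_pre \<kappa>) (\<lambda>s2. changes_only ?R {aX, aY, aSlot, aStack} s1 s2 \<and>
        memory n m f' B' s2 \<and> at_slot n f' b s2) ?s"
    unfolding wp_restore[OF bd] using pre by (simp only: s1_def)
  moreover have "length (restore @ update_pre \<kappa>) < 17"
    by (cases \<kappa>) (simp_all add: restore_def update_pre_def insert_pre_def delete_pre_def record_edge_def base_def)
  ultimately have "runs ?W (block (restore @ update_pre \<kappa>)) ?s 17 (\<lambda>s2.
      changes_only ?R {aX, aY, aSlot, aStack} s1 s2 \<and> memory n m f' B' s2 \<and> at_slot n f' b s2)"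
    by (rule runs_block)
  then obtain t2 s2 where ex2: "exec ?W (block (restore @ update_pre \<kappa>)) ?s t2 s2" "t2 \<le> 17"
    and ch2: "changes_only ?R {aX, aY, aSlot, aStack} s1 s2"
    and mem2: "memory n m f' B' s2" and at2: "at_slot n f' b s2"
    unfolding runs_def by blast
  have bd2: "bounded ?W s2" by (rule exec_bounded[OF ex2(1) bd])
  have sim2: "sim {''u'', ''v''} sA s2" by (rule sim_changes_only[OF sim1 ch2]) auto
  from runs_run_segs[OF r[folded Es0] \<open>\<kappa> \<in> K\<close> val[rule_format, THEN conjunct1]
      val[rule_format, THEN conjunct2] sim2 at2 ndW wW le_refl] obtain TA sA' where
    r': "dyn_reach c K A (n + k * m) (Suc k * m) (Es (Suc k)) sA' (iA + Suc k) (Suc k * j + Suc k) (T + TA)"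
    and TA: "g = Worst_Case \<longrightarrow> TA \<le> Suc k * U (n + k * m) (Suc k * m)"
    and run: "runs ?W (run_segs ?X (Suc k)) s2 (TA + 3 * Suc k + 1)
      (\<lambda>s'. sim {''u'', ''v''} sA' s' \<and> agree (range z) s2 s')" by blast
  from run obtain t3 s3 where ex3: "exec ?W (run_segs ?X (Suc k)) s2 t3 s3" "t3 \<le> TA + 3 * Suc k + 1"
    and sim3: "sim {''u'', ''v''} sA' s3" and ag3: "agree (range z) s2 s3"
    unfolding runs_def by blast
  have "bounded ?W s3" by (rule exec_bounded[OF ex3(1) bd2])
  then have "runs ?W save s3 3 (\<lambda>s'. changes_only {zNum, zDen} {} s3 s' \<and> parked sA' s')"
    using sim3 by (intro runs_save) (auto simp: bounded_def)
  then obtain t4 s4 where ex4: "exec ?W save s3 t4 s4" "t4 \<le> 3"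
    and ch4: "changes_only {zNum, zDen} {} s3 s4" and parked4: "parked sA' s4"
    unfolding runs_def by blast
  have "memory n m f' B' s4 = memory n m f' B' s2"
    using ag3 ch4 by (intro memory_cong) (auto simp: agree_def changes_only_def)
  then have "simulates n m (apply_update \<kappa> E u v) s4 (Suc i) (Suc j) f' B' sA' (iA + Suc k) (T + TA)"
    using S' E' r' Esk iA parked4 mem2 by (simp add: simulates_def add.commute)
  moreover have "exec ?W (update_prog \<kappa> ?X) ?s (t2 + (t3 + t4)) s4"
    unfolding update_prog_def by (rule exec.Seq[OF ex2(1) exec.Seq[OF ex3(1) ex4(1)]])
  moreover have "t2 + (t3 + t4) \<le> TA + 3 * k + 30" using ex2(2) ex3(2) ex4(2) by simp
  ultimately show ?thesis using TA unfolding runs_def by blast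
qed

text \<open>Rounding comes after \<open>save\<close>, so it changes only registers in which
  \<open>parked\<close> tolerates a deviation from the simulated run.\<close>

lemma runs_query_prog:
  assumes sim: "simulates n m E s i j f B sA iA T" and uv: "u < n" "v < n"
    and bd: "bounded (word_bound c' (n + m + i)) (set_args u v s)"
  shows "\<exists>sA'. runs (word_bound c' (n + m + i)) (query_prog (qry_prog A)) (set_args u v s)
      (12 * Q (n + k * m) (Suc k * m))
      (\<lambda>s'. simulates n m E s' (Suc i) j f B sA' (iA + 1) T \<and>
        is_estimate (regs s' ''num'') (regs s' ''den'') \<and>
        good_estimate (real a + (real k + 2) * \<epsilon>) 0 E u v (estimate (regs s' ''num'') (regs s' ''den'')))"
proof -
  let ?W = "word_bound c' (n + m + i)" and ?s = "set_args u v s" and ?X = "qry_prog A"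
  note sim = sim[unfolded simulates_def]
  have S: "slots n m f B" and E: "E = ends f ` B"
    and r: "dyn_reach c K A (n + k * m) (Suc k * m) (seg n k f ` (B \<times> {..k})) sA iA (Suc k * j) T"
    and iA: "iA \<le> Suc k * i" using sim by auto
  have W: "roomy k n m ?W" by (rule roomy_word_bound)
  have uv': "u < n + k * m" "v < n + k * m" using uv by simp_all
  have parked: "parked sA ?s" using sim by (simp add: parked_def sim_def)
  define s1 where "s1 = restored ?s"
  have "sim {''u'', ''v''} sA s1" unfolding s1_def by (rule sim_restored[OF parked])
  then have ag1: "agree (- range z) (set_args u v sA) s1"
    by (auto simp: sim_def agree_def s1_def restored_def)
  have "wp ?W (restore @ []) (\<lambda>s'. s' = s1) ?s" unfolding wp_restore[OF bd] by (simp add: s1_def)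
  then have "runs ?W (block restore) ?s 3 (\<lambda>s'. s' = s1)"
    unfolding append_Nil2 by (rule runs_block) (simp add: restore_def)
  then obtain t1 where ex1: "exec ?W (block restore) ?s t1 s1" "t1 \<le> 3" unfolding runs_def by blast
  from A_qry[OF r uv'] obtain t sA' where
    exA: "exec (word_bound c (n + k * m + Suc k * m + iA)) ?X (set_args u v sA) t sA'"
    and t: "t \<le> Q (n + k * m) (Suc k * m)"
    and est: "is_estimate (regs sA' ''num'') (regs sA' ''den'')"
    and good: "good_estimate (real a + \<epsilon>) (real k) (seg n k f ` (B \<times> {..k})) u v
      (estimate (regs sA' ''num'') (regs sA' ''den''))" by blast
  have "word_bound c (n + k * m + Suc k * m + iA) \<le> ?W" using word_bound_sim[OF iA, of 0 n m] by simp
  from runs_frame[OF exA this vars_qry ag1] obtain t2 s2 where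
    ex2: "exec ?W ?X s1 t2 s2" "t2 \<le> t"
    and ag2: "agree (- range z) sA' s2" "agree (range z) s1 s2" unfolding runs_def by auto
  have bd2: "bounded ?W s2" using exec_bounded[OF ex2(1)] exec_bounded[OF ex1(1) bd] by blast
  have "sim {''u'', ''v''} sA' s2" using ag2 by (auto simp: sim_def agree_def)
  then have "runs ?W save s2 3 (\<lambda>s'. changes_only {zNum, zDen} {} s2 s' \<and> parked sA' s')"
    using bd2 by (intro runs_save) (auto simp: bounded_def)
  then obtain t3 s3 where ex3: "exec ?W save s2 t3 s3" "t3 \<le> 3"
    and ch3: "changes_only {zNum, zDen} {} s2 s3" and parked3: "parked sA' s3"
    unfolding runs_def by blast
  have nd: "''num'' \<in> - range z" "''den'' \<in> - range z" by auto
  have nd3: "regs s3 ''num'' = regs sA' ''num''" "regs s3 ''den'' = regs sA' ''den''"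
    using ch3 ag2(1) nd unfolding changes_only_def agree_def by auto
  have "bounded ?W s3" by (rule exec_bounded[OF ex3(1) bd2])
  moreover have "1 < ?W" using roomyD(2)[OF W] by simp
  ultimately have "runs ?W (round_code ''num'' ''den'') s3 5 (\<lambda>s'. changes_only {''num'', ''den''} {} s3 s' \<and>
    regs s' ''num'' = fst (rnd k (regs s3 ''num'') (regs s3 ''den'')) \<and>
    regs s' ''den'' = snd (rnd k (regs s3 ''num'') (regs s3 ''den'')))"
    by (intro runs_round_code) (auto simp: bounded_def)
  then obtain t4 s4 where ex4: "exec ?W (round_code ''num'' ''den'') s3 t4 s4" "t4 \<le> 5"
    and ch4: "changes_only {''num'', ''den''} {} s3 s4"
    and out: "regs s4 ''num'' = fst (rnd k (regs sA' ''num'') (regs sA' ''den''))"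
      "regs s4 ''den'' = snd (rnd k (regs sA' ''num'') (regs sA' ''den''))"
    unfolding runs_def nd3 by blast
  have "sim {''num'', ''den'', ''u'', ''v''} sA' s3" using parked3 by (simp add: parked_def)
  then have "sim {''num'', ''den'', ''u'', ''v''} sA' s4"
    by (rule sim_changes_only[OF _ ch4]) simp_all
  then have "parked sA' s4" using parked3 ch4 by (simp add: parked_def changes_only_def)
  moreover have "memory n m f B s4 = memory n m f B s"
    using ag2(2) ch3 ch4 by (intro memory_cong) (auto simp: agree_def changes_only_def s1_def restored_def)
  moreover have "dyn_reach c K A (n + k * m) (Suc k * m) (seg n k f ` (B \<times> {..k})) sA' (iA + 1) (Suc k * j) T"
    using dyn_reach.query[OF r uv' exA] by simp
  ultimately have "simulates n m E s4 (Suc i) j f B sA' (iA + 1) T"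
    using sim by (simp add: simulates_def)
  moreover have "is_estimate (regs s4 ''num'') (regs s4 ''den'')" unfolding out by (rule is_estimate_rnd[OF est])
  moreover have "good_estimate (real a + (real k + 2) * \<epsilon>) 0 E u v (estimate (regs s4 ''num'') (regs s4 ''den''))"
    unfolding out E by (rule good_estimate_rnd[OF S k uv a eps good])
  moreover have "exec ?W (query_prog ?X) ?s (t1 + (t2 + (t3 + t4))) s4"
    unfolding query_prog_def by (rule exec.Seq[OF ex1(1) exec.Seq[OF ex2(1) exec.Seq[OF ex3(1) ex4(1)]]])
  \<comment> \<open>The fixed cost is \<open>3 + 3 + 5\<close>. Since the query of \<open>A\<close>
    takes at least one step, this is absorbed into the factor 12 and leaves no additive
    constant.\<close>
  moreover have "t1 + (t2 + (t3 + t4)) \<le> 12 * Q (n + k * m) (Suc k * m)"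
    using ex1(2) ex2(2) ex3(2) ex4(2) t exec_pos[OF exA] by simp
  ultimately show ?thesis unfolding runs_def by blast
qed

end

context subdivider
begin

text \<open>The initial edges occupy the slots below \<open>m0\<close>, so the slots from
  \<open>m0\<close> on are pushed as free.\<close>

definition stack_inv :: "state \<Rightarrow> nat \<Rightarrow> nat \<Rightarrow> state \<Rightarrow> bool" where
  "stack_inv s0 m0 i s \<longleftrightarrow> changes_only {zB, zTop} {aStack} s0 s \<and>
     regs s zTop = i \<and> regs s zB = m0 + i \<and> (\<forall>p<i. arrs s aStack p = m0 + p)"

lemma runs_stack:
  assumes "regs s zB = m0" "regs s zTop = 0" "regs s ''cap'' = m" "m0 \<le> m" "m < W"
  shows "runs W (While (Less (Reg zB) (Reg ''cap'')) (block stack_body)) s (Suc ((m - m0) * 5))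
    (stack_inv s m0 (m - m0))"
proof -
  have "runs W (While (Less (Reg zB) (Reg ''cap'')) (block stack_body)) s (Suc ((m - m0) * Suc 4))
    (stack_inv s m0 (m - m0))"
  proof (rule runs_While_count)
    fix i t assume i: "i < m - m0" and inv: "stack_inv s m0 i t"
    have cap: "regs t ''cap'' = m" using inv assms(3) by (simp add: stack_inv_def changes_only_def)
    have "wp W stack_body (stack_inv s m0 (Suc i)) t"
      using inv i \<open>m < W\<close> by (auto simp: stack_body_def stack_inv_def changes_only_def less_Suc_eq)
    then have "runs W (block stack_body) t 4 (stack_inv s m0 (Suc i))"
      by (rule runs_block) (simp add: stack_body_def)
    then show "holds (Less (Reg zB) (Reg ''cap'')) t \<and> runs W (block stack_body) t 4 (stack_inv s m0 (Suc i))"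
      using cap i inv by (simp add: stack_inv_def)
  next
    fix t assume inv: "stack_inv s m0 (m - m0) t"
    have cap: "regs t ''cap'' = m" using inv assms(3) by (simp add: stack_inv_def changes_only_def)
    then show "\<not> holds (Less (Reg zB) (Reg ''cap'')) t" using inv \<open>m0 \<le> m\<close> by (simp add: stack_inv_def)
  next
    show "stack_inv s m0 0 s" using assms by (simp add: stack_inv_def changes_only_def)
  qed
  then show ?thesis by simp
qed

end

context dyn_subdivider
begin

text \<open>The simulated graph receives nodes and capacity for all \<open>m\<close> slots although
  only the initial edges are subdivided; the spare nodes are isolated. The overhead depends on
  \<open>m\<close> and not just on the initial edges because the free stack is filled for the full
  capacity.\<close>

lemma runs_prep_prog:
  assumes G: "ugraph n E" "lists_edges es E" "card E \<le> m"
  shows "\<exists>f B sA T. T \<le> P (n + k * m) (Suc k * m) \<and>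
    runs (word_bound c' (n + m)) (preprocess_prog (prep_prog A)) (dyn_input n m es)
      (T + (length expand_body + 23) * (n + m + 1))
      (\<lambda>s'. simulates n m E s' 0 0 f B sA 0 T)"
proof -
  let ?W = "word_bound c' (n + m)" and ?s0 = "dyn_input n m es" and ?X = "prep_prog A"
  let ?f = "(!) es" and ?B = "{..<length es}" and ?n = "n + k * m" and ?m = "Suc k * m"
  let ?es = "subdivided_list n k es" and ?L = "length expand_body"
  let ?E = "seg n k ?f ` (?B \<times> {..k})"
  define m0 where "m0 = length es"
  have m0: "length es = m0" "m0 \<le> m" using lists_edges_length[OF G(2)] G(3) by (auto simp: m0_def)
  have S: "slots n m ?f ?B" and E: "ends ?f ` ?B = E"
    using lists_edges_slots[OF G(1,2), of m] m0 by auto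
  have W: "roomy k n m ?W" using roomy_word_bound[of k n m c 0] by simp
  have lt: "m < ?W" "n < ?W" "k * m < ?W" "n + k * m < ?W" "m + k * m < ?W" using roomyD(2)[OF W] by simp_all
  have lt0: "m0 < ?W" "m0 + k * m0 < ?W"
    using lt m0(2) mult_le_mono2[OF m0(2), of k] by linarith+
  have cE: "card ?E \<le> ?m" using card_seg[OF S k] m0 by (simp del: mult_Suc)
  from A_prep[OF seg_ugraph[OF S k] lists_edges_subdivided[OF S k] cE] obtain T sA where
    exA: "exec (word_bound c (?n + ?m)) ?X (dyn_input ?n ?m ?es) T sA" and T: "T \<le> P ?n ?m" by blast
  have reach: "dyn_reach c K A ?n ?m ?E sA 0 0 T"
    by (rule dyn_reach.start[OF seg_ugraph[OF S k] lists_edges_subdivided[OF S k] cE exA])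
  have WW: "word_bound c (?n + ?m) \<le> ?W" using word_bound_sim[of 0 0 0 n m] by simp
  have bd0: "bounded ?W ?s0"
    using graph_input_bounded[OF S lt(2)] lt0(1) m0(1) lt(1) by (simp add: dyn_input_def bounded_def)

  let ?s1 = "set_reg zB m0 (set_reg zM m0 (set_reg zN n ?s0))"
  let ?cs1 = "[Move zN (Reg ''n''), Move zM (Reg ''m''), Move zB (Reg ''m'')]"
  have "wp ?W ?cs1 (\<lambda>s. s = ?s1) ?s0"
    using lt(2) lt0(1) by (simp only: wp.simps) (simp add: dyn_input_def graph_input_def m0(1))
  then have "runs ?W (block ?cs1) ?s0 4 (\<lambda>s. s = ?s1)" by (rule runs_block) simp
  then obtain t1 where ex1: "exec ?W (block ?cs1) ?s0 t1 ?s1" "t1 \<le> 4" unfolding runs_def by blast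

  let ?cw = "While (Less (Reg zB) (Reg ''cap'')) (block stack_body)"
  \<comment> \<open>The stack height starts at \<open>0\<close> because untouched registers are
    zero.\<close>
  have "runs ?W ?cw ?s1 (Suc ((m - m0) * 5)) (stack_inv ?s1 m0 (m - m0))"
    by (rule runs_stack) (use m0(2) lt(1) in \<open>simp_all add: dyn_input_def graph_input_def\<close>)
  then obtain t2 s2 where ex2: "exec ?W ?cw ?s1 t2 s2" "t2 \<le> Suc ((m - m0) * 5)"
    and s2: "stack_inv ?s1 m0 (m - m0) s2" unfolding runs_def by blast
  note s2 = s2[unfolded stack_inv_def]
  have ch2: "changes_only {zB, zTop} {aStack} ?s1 s2" using s2 by blast

  let ?R = "{zB, zX, zY, zBase, zT, zPos}" and ?A = "{aX, aY, aSlot, ''src'', ''dst''}"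
  have "runs ?W expand s2 (3 + length es * (?L + 2))
    (\<lambda>s. changes_only ?R ?A s2 s \<and> stored n ?f ?B s \<and>
       arrs s ''src'' = arrs (graph_input ?n ?es) ''src'' \<and> arrs s ''dst'' = arrs (graph_input ?n ?es) ''dst'')"
  proof (rule runs_expand[OF S _ W])
    show "length es \<le> m" using m0 by simp
    show "regs s2 zN = n" "regs s2 zM = length es" using ch2 m0(1) by (simp_all add: changes_only_def)
    show "arrs s2 ''src'' = arrs (graph_input n es) ''src''" "arrs s2 ''dst'' = arrs (graph_input n es) ''dst''"
      using ch2 by (simp_all add: changes_only_def dyn_input_def)
  qed
  then obtain t3 s3 where ex3: "exec ?W expand s2 t3 s3" "t3 \<le> 3 + m0 * (?L + 2)"
    and ch3: "changes_only ?R ?A s2 s3" and st3: "stored n ?f ?B s3"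
    and src3: "arrs s3 ''src'' = arrs (graph_input ?n ?es) ''src''" "arrs s3 ''dst'' = arrs (graph_input ?n ?es) ''dst''"
    unfolding runs_def m0(1) by blast
  have z3: "regs s3 zN = n" "regs s3 zM = m0" "regs s3 ''cap'' = m"
    using ch2 ch3 by (simp_all add: changes_only_def dyn_input_def)

  let ?cs4 = "[Arith zT Mul (Reg ''cap'') (Const k), Arith ''n'' Add (Reg zN) (Reg zT),
      Arith ''m'' Mul (Reg zM) (Const (Suc k)), Arith ''cap'' Mul (Reg ''cap'') (Const (Suc k))]"
  define s4 where "s4 = set_reg ''cap'' (m * Suc k) (set_reg ''m'' (m0 * Suc k) (set_reg ''n'' (n + m * k) (set_reg zT (m * k) s3)))"
  have "wp ?W ?cs4 (\<lambda>s. s = s4) s3"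
    using lt lt0 z3 by (simp only: wp.simps) (simp add: s4_def mult.commute)
  then have "runs ?W (block ?cs4) s3 5 (\<lambda>s. s = s4)" by (rule runs_block) simp
  then obtain t4 where ex4: "exec ?W (block ?cs4) s3 t4 s4" "t4 \<le> 5" unfolding runs_def by blast
  have bd4: "bounded ?W s4"
    by (rule exec_bounded[OF ex4(1) exec_bounded[OF ex3(1) exec_bounded[OF ex2(1) exec_bounded[OF ex1(1) bd0]]]])
  have len: "length ?es = Suc k * m0" by (simp add: subdivided_list_def m0(1))
  have ag4: "agree (- range z) (dyn_input ?n ?m ?es) s4"
    unfolding agree_def
  proof (intro ballI conjI)
    fix x assume "x \<in> - range z"
    then have nz: "x \<noteq> z i" for i by auto
    have "regs s3 x = regs ?s0 x" using ch2 ch3 nz by (simp add: changes_only_def)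
    then show "regs (dyn_input ?n ?m ?es) x = regs s4 x"
      using nz by (simp add: s4_def dyn_input_def graph_input_def len mult.commute)
    show "arrs (dyn_input ?n ?m ?es) x = arrs s4 x"
    proof (cases "x = ''src'' \<or> x = ''dst''")
      case True
      then show ?thesis using src3 by (auto simp: s4_def dyn_input_def)
    next
      case False
      then have "arrs s3 x = arrs ?s0 x" using ch2 ch3 nz by (simp add: changes_only_def)
      then show ?thesis using False by (simp add: s4_def dyn_input_def graph_input_def)
    qed
  qed
  from runs_frame[OF exA WW vars_prep ag4] obtain t5 s5 where
    ex5: "exec ?W ?X s4 t5 s5" "t5 \<le> T"
    and ag5: "agree (- range z) sA s5" "agree (range z) s4 s5" unfolding runs_def by auto
  have bd5: "bounded ?W s5" by (rule exec_bounded[OF ex5(1) bd4])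
  have "sim {''u'', ''v''} sA s5" using ag5 by (auto simp: sim_def agree_def)
  then have "runs ?W save s5 3 (\<lambda>s'. changes_only {zNum, zDen} {} s5 s' \<and> parked sA s')"
    using bd5 by (intro runs_save) (auto simp: bounded_def)
  then obtain t6 s6 where ex6: "exec ?W save s5 t6 s6" "t6 \<le> 3"
    and ch6: "changes_only {zNum, zDen} {} s5 s6" and parked6: "parked sA s6"
    unfolding runs_def by blast
  have "memory n m ?f ?B s6 = memory n m ?f ?B s4"
    using ag5(2) ch6 by (intro memory_cong) (auto simp: agree_def changes_only_def)
  also have "\<dots> = memory n m ?f ?B s3" by (rule memory_cong) (simp_all add: s4_def)
  finally have "memory n m ?f ?B s6 = memory n m ?f ?B s3" .
  moreover have "memory n m ?f ?B s3"
  proof -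
    have stk: "regs s3 zTop = m - m0" "\<forall>p<m - m0. arrs s3 aStack p = m0 + p"
      using s2 ch3 by (simp_all add: changes_only_def)
    have "bij_betw (\<lambda>p. m0 + p) {..<m - m0} ({..<m} - {..<m0})"
      by (rule bij_betw_byWitness[where f' = "\<lambda>p. p - m0"]) auto
    then have "bij_betw (arrs s3 aStack) {..<m - m0} ({..<m} - {..<m0})"
      using stk(2) by (subst bij_betw_cong[where g = "\<lambda>p. m0 + p"]) auto
    then show ?thesis using st3 z3(1) stk(1) by (simp add: memory_def free_stack_def m0(1))
  qed
  ultimately have "simulates n m E s6 0 0 ?f ?B sA 0 T"
    using S E reach parked6 by (simp add: simulates_def)
  moreover have "exec ?W (preprocess_prog ?X) ?s0 (t1 + (t2 + (t3 + (t4 + (t5 + t6))))) s6"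
    unfolding preprocess_prog_def
    by (rule exec.Seq[OF ex1(1) exec.Seq[OF ex2(1) exec.Seq[OF ex3(1) exec.Seq[OF ex4(1) exec.Seq[OF ex5(1) ex6(1)]]]]])
  moreover have "t1 + (t2 + (t3 + (t4 + (t5 + t6)))) \<le> T + (?L + 23) * (n + m + 1)"
  proof -
    have "m0 * (?L + 2) \<le> m * (?L + 2)" using m0(2) by (rule mult_le_mono1)
    moreover have "(?L + 23) * (n + m + 1) = m * (?L + 2) + 21 * m + (?L + 23) * n + ?L + 23"
      by (simp add: algebra_simps)
    ultimately show ?thesis using ex1(2) ex2(2) ex3(2) ex4(2) ex5(2) ex6(2) by linarith
  qed
  ultimately show ?thesis using T unfolding runs_def by blast
qed

text \<open>One constant that dominates \<open>length expand_body + 23\<close> for preprocessing,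
  \<open>3 * k + 30\<close> for an update and the factor 12 of a query.\<close>

abbreviation "overhead \<equiv> length expand_body + 3 * k + 30"

lemma c'_pos: "1 \<le> c'"
  by simp

text \<open>By determinism every operation of an arbitrary run coincides with the constructed one,
  so a simulated run exists alongside it. Total times are compared, as an amortized guarantee does
  not limit a single update.\<close>

lemma dyn_reach_simulates:
  assumes "dyn_reach c' K (dyn_prog A) n m E s i j T"
  shows "\<exists>f B sA iA TA. simulates n m E s i j f B sA iA TA \<and> T \<le> TA + overhead * (n + m + 1) + j * overhead"
  using assms
proof (induction rule: dyn_reach.induct)
  case (start E es t s)
  obtain f B sA TA where
    run: "runs (word_bound c' (n + m)) (preprocess_prog (prep_prog A)) (dyn_input n m es)
      (TA + (length expand_body + 23) * (n + m + 1)) (\<lambda>s'. simulates n m E s' 0 0 f B sA 0 TA)"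
    using runs_prep_prog[OF start(1-3)] by blast
  have "exec (word_bound c' (n + m)) (preprocess_prog (prep_prog A)) (dyn_input n m es) t s"
    using start(4) by (simp add: dyn_prog_def)
  note res = runs_exec[OF run this]
  have "(length expand_body + 23) * (n + m + 1) \<le> overhead * (n + m + 1)" by (rule mult_le_mono1) simp
  then have "t \<le> TA + overhead * (n + m + 1) + 0 * overhead" using res(1) by linarith
  then show ?case using res(2) by blast
next
  case (update E s i j T \<kappa> u v t s')
  then obtain f B sA iA TA where sim: "simulates n m E s i j f B sA iA TA"
    and T: "T \<le> TA + overhead * (n + m + 1) + j * overhead" by blast
  have bd: "bounded (word_bound c' (n + m + i)) (set_args u v s)"
    by (rule dyn_reach_bounded_args[OF update(1) c'_pos])
      (use valid_update_less[OF dyn_reach_ugraph[OF update(1)] update(3)] in auto)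
  obtain f' B' sA' TA' where
    run: "runs (word_bound c' (n + m + i)) (update_prog \<kappa> (upd_prog A \<kappa>)) (set_args u v s) (TA' + 3 * k + 30)
      (\<lambda>s'. simulates n m (apply_update \<kappa> E u v) s' (Suc i) (Suc j) f' B' sA' (iA + Suc k) (TA + TA'))"
    using runs_update_prog[OF sim update(2,3) bd] by blast
  have "exec (word_bound c' (n + m + i)) (update_prog \<kappa> (upd_prog A \<kappa>)) (set_args u v s) t s'"
    using update(4) by (simp add: dyn_prog_def)
  note res = runs_exec[OF run this]
  have "T + t \<le> (TA + TA') + overhead * (n + m + 1) + Suc j * overhead" using T res(1) by simp
  then show ?case using res(2) by blast
next
  case (query E s i j T u v t s')
  then obtain f B sA iA TA where sim: "simulates n m E s i j f B sA iA TA"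
    and T: "T \<le> TA + overhead * (n + m + 1) + j * overhead" by blast
  have bd: "bounded (word_bound c' (n + m + i)) (set_args u v s)"
    by (rule dyn_reach_bounded_args[OF query(1) c'_pos query(2,3)])
  have "exec (word_bound c' (n + m + i)) (query_prog (qry_prog A)) (set_args u v s) t s'"
    using query(4) by (simp add: dyn_prog_def)
  then show ?case using runs_query_prog[OF sim query(2,3) bd] runs_exec(2) T by blast
qed

lemma dynamic_reduction:
  "dynamic_apsp g K (real a + (real k + 2) * \<epsilon>) 0 (dyn_prog A)
     (\<lambda>n m. P (n + k * m) ((k + 1) * m) + overhead * (n + m + 1))
     (\<lambda>n m. (k + 1) * U (n + k * m) ((k + 1) * m) + overhead)
     (\<lambda>n m. overhead * Q (n + k * m) ((k + 1) * m))"
  unfolding dynamic_apsp_def Suc_eq_plus1[symmetric]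
proof (rule exI[of _ c'], intro allI conjI impI ballI)
  fix n m E es assume G: "ugraph n E \<and> lists_edges es E \<and> card E \<le> m"
  obtain T where T: "T \<le> P (n + k * m) (Suc k * m)"
    and "\<exists>R. runs (word_bound c' (n + m)) (preprocess_prog (prep_prog A)) (dyn_input n m es)
      (T + (length expand_body + 23) * (n + m + 1)) R"
    using runs_prep_prog[of n E es m] G by blast
  then obtain t s where "exec (word_bound c' (n + m)) (preprocess_prog (prep_prog A)) (dyn_input n m es) t s"
    "t \<le> T + (length expand_body + 23) * (n + m + 1)" unfolding runs_def by blast
  moreover have "(length expand_body + 23) * (n + m + 1) \<le> overhead * (n + m + 1)" by (rule mult_le_mono1) simp
  ultimately show "\<exists>t s. exec (word_bound c' (n + m)) (prep_prog (dyn_prog A)) (dyn_input n m es) t s \<and>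
    t \<le> P (n + k * m) (Suc k * m) + overhead * Suc (n + m)"
    using T by (intro exI[of _ t] exI[of _ s]) (simp add: dyn_prog_def)
next
  fix n m E s i j T
  assume r: "dyn_reach c' K (dyn_prog A) n m E s i j T" and "g = Amortized"
  obtain f B sA iA TA where sim: "simulates n m E s i j f B sA iA TA"
    and T: "T \<le> TA + overhead * (n + m + 1) + j * overhead" using dyn_reach_simulates[OF r] by blast
  \<comment> \<open>The simulated run has processed \<open>Suc k * j\<close> updates, which yields
    the factor \<open>k + 1\<close>; queries do not enter this count.\<close>
  have "TA \<le> P (n + k * m) (Suc k * m) + Suc k * j * U (n + k * m) (Suc k * m)"
    by (rule A_amortized[OF _ \<open>g = Amortized\<close>])
      (rule sim[unfolded simulates_def, THEN conjunct2, THEN conjunct2, THEN conjunct1])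
  then show "T \<le> P (n + k * m) (Suc k * m) + overhead * Suc (n + m) + j * (Suc k * U (n + k * m) (Suc k * m) + overhead)"
    using T by (simp add: algebra_simps)
next
  fix n m E s i j T \<kappa> u v
  assume r: "dyn_reach c' K (dyn_prog A) n m E s i j T" and \<kappa>: "\<kappa> \<in> K" and v: "valid_update \<kappa> n m E u v"
  obtain f B sA iA TA where sim: "simulates n m E s i j f B sA iA TA" using dyn_reach_simulates[OF r] by blast
  have bd: "bounded (word_bound c' (n + m + i)) (set_args u v s)"
    by (rule dyn_reach_bounded_args[OF r c'_pos])
      (use valid_update_less[OF dyn_reach_ugraph[OF r] v] in auto)
  from runs_update_prog[OF sim \<kappa> v bd] obtain TA' t s' where
    TA': "g = Worst_Case \<longrightarrow> TA' \<le> Suc k * U (n + k * m) (Suc k * m)"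
    and "exec (word_bound c' (n + m + i)) (update_prog \<kappa> (upd_prog A \<kappa>)) (set_args u v s) t s'"
      "t \<le> TA' + 3 * k + 30" unfolding runs_def by blast
  then show "\<exists>t s'. exec (word_bound c' (n + m + i)) (upd_prog (dyn_prog A) \<kappa>) (set_args u v s) t s' \<and>
     (g = Worst_Case \<longrightarrow> t \<le> Suc k * U (n + k * m) (Suc k * m) + overhead)"
    by (intro exI[of _ t] exI[of _ s']) (auto simp: dyn_prog_def)
next
  fix n m E s i j T u v
  assume r: "dyn_reach c' K (dyn_prog A) n m E s i j T" and uv: "u < n" "v < n"
  obtain f B sA iA TA where sim: "simulates n m E s i j f B sA iA TA" using dyn_reach_simulates[OF r] by blast
  have bd: "bounded (word_bound c' (n + m + i)) (set_args u v s)"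
    by (rule dyn_reach_bounded_args[OF r c'_pos uv])
  from runs_query_prog[OF sim uv bd] obtain t s' where
    ex: "exec (word_bound c' (n + m + i)) (query_prog (qry_prog A)) (set_args u v s) t s'"
    and t: "t \<le> 12 * Q (n + k * m) (Suc k * m)"
    and res: "is_estimate (regs s' ''num'') (regs s' ''den'')"
      "good_estimate (real a + (real k + 2) * \<epsilon>) 0 E u v (estimate (regs s' ''num'') (regs s' ''den''))"
    unfolding runs_def by blast
  have "12 * Q (n + k * m) (Suc k * m) \<le> overhead * Q (n + k * m) (Suc k * m)" by (rule mult_le_mono1) simp
  then have "t \<le> overhead * Q (n + k * m) (Suc k * m)" using t by linarith
  then show "\<exists>t s'. exec (word_bound c' (n + m + i)) (qry_prog (dyn_prog A)) (set_args u v s) t s' \<and>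
      t \<le> overhead * Q (n + k * m) (Suc k * m) \<and> is_estimate (regs s' ''num'') (regs s' ''den'') \<and>
      good_estimate (real a + (real k + 2) * \<epsilon>) 0 E u v (estimate (regs s' ''num'') (regs s' ''den''))"
    using ex res unfolding dyn_prog_def by auto
qed

end

section \<open>Fresh names and the transfer of guarantees\<close>

lemma fresh_names:
  assumes "finite (F :: string set)"
  obtains z :: "nat \<Rightarrow> string" where "inj z" "range z \<inter> F = {}"
proof -
  have "infinite (UNIV - F)" using assms infinite_UNIV_listI by (rule Diff_infinite_finite)
  then obtain z :: "nat \<Rightarrow> string" where "inj z" "range z \<subseteq> UNIV - F"
    using infinite_countable_subset by blast
  then show ?thesis using that by blast
qed

lemma subdivider_exists:
  assumes "1 \<le> k" "finite V"
  obtains z where "subdivider k z" "V \<subseteq> - range z"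
proof -
  let ?N = "{''n'', ''m'', ''cap'', ''u'', ''v'', ''num'', ''den'', ''src'', ''dst''} :: string set"
  have fin: "finite (?N \<union> V)" using assms(2) by (simp only: finite_Un finite_insert finite.emptyI)
  obtain z :: "nat \<Rightarrow> string" where z: "inj z" "range z \<inter> (?N \<union> V) = {}" using fresh_names[OF fin] .
  have "z i \<notin> ?N" for i using z(2) rangeI[of z i] unfolding disjoint_iff Un_iff by metis
  then have "subdivider k z" by (intro subdivider.intro assms z(1))
  moreover have "V \<subseteq> - range z" using z(2) unfolding disjoint_iff Un_iff by (metis ComplI subsetI)
  ultimately show ?thesis by (rule that)
qed

theorem theorem2p1:
  fixes a k :: nat and \<epsilon> :: real
  assumes "1 \<le> a" and "1 \<le> k" and "0 \<le> \<epsilon>" and "\<epsilon> < 1"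
  shows
    "(\<forall>A \<tau>. static_apsp (real a + \<epsilon>) (real k) A \<tau> \<longrightarrow>
        (\<exists>B C. static_apsp (real a + (real k + 2) * \<epsilon>) 0 B
           (\<lambda>n m. C * \<tau> (n + k * m) ((k + 1) * m)))) \<and>
     (\<forall>g K A P U Q. dynamic_apsp g K (real a + \<epsilon>) (real k) A P U Q \<longrightarrow>
        (\<exists>B C. dynamic_apsp g K (real a + (real k + 2) * \<epsilon>) 0 B
           (\<lambda>n m. P (n + k * m) ((k + 1) * m) + C * (n + m + 1))
           (\<lambda>n m. (k + 1) * U (n + k * m) ((k + 1) * m) + C)
           (\<lambda>n m. C * Q (n + k * m) ((k + 1) * m))))"
proof (intro conjI allI impI)
  fix A \<tau> assume A: "static_apsp (real a + \<epsilon>) (real k) A \<tau>"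
  obtain z where "subdivider k z" "vars A \<subseteq> - range z"
    using subdivider_exists[OF assms(2) finite_vars] .
  from subdivider.static_reduction[OF this(1) A this(2) assms(1,3)]
  show "\<exists>B C. static_apsp (real a + (real k + 2) * \<epsilon>) 0 B (\<lambda>n m. C * \<tau> (n + k * m) ((k + 1) * m))"
    by blast
next
  fix g K A P U Q assume A: "dynamic_apsp g K (real a + \<epsilon>) (real k) A P U Q"
  \<comment> \<open>The update programs form a family indexed by \<open>kind\<close>; with just two
    kinds, finitely many names occur in it.\<close>
  let ?V = "vars (prep_prog A) \<union> (\<Union>\<kappa>\<in>{Insert, Delete}. vars (upd_prog A \<kappa>)) \<union> vars (qry_prog A)"
  have fin: "finite ?V" by (simp add: finite_vars)
  obtain z where z: "subdivider k z" "?V \<subseteq> - range z"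
    using subdivider_exists[OF assms(2) fin] .
  have kinds: "\<kappa> \<in> {Insert, Delete}" for \<kappa> by (cases \<kappa>) auto
  have v: "vars (upd_prog A \<kappa>) \<subseteq> - range z" for \<kappa> using z(2) kinds[of \<kappa>] by blast
  from A obtain c where c: "\<And>n m.
       (\<forall>E es. ugraph n E \<and> lists_edges es E \<and> card E \<le> m \<longrightarrow>
          (\<exists>t s. exec (word_bound c (n + m)) (prep_prog A) (dyn_input n m es) t s \<and> t \<le> P n m)) \<and>
       (\<forall>E s i j T. dyn_reach c K A n m E s i j T \<longrightarrow>
          (g = Amortized \<longrightarrow> T \<le> P n m + j * U n m) \<and>
          (\<forall>\<kappa>\<in>K. \<forall>u v. valid_update \<kappa> n m E u v \<longrightarrow>
             (\<exists>t s'. exec (word_bound c (n + m + i)) (upd_prog A \<kappa>) (set_args u v s) t s' \<and>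
                (g = Worst_Case \<longrightarrow> t \<le> U n m))) \<and>
          (\<forall>u<n. \<forall>v<n.
             \<exists>t s'. exec (word_bound c (n + m + i)) (qry_prog A) (set_args u v s) t s' \<and>
                t \<le> Q n m \<and>
                is_estimate (regs s' ''num'') (regs s' ''den'') \<and>
                good_estimate (real a + \<epsilon>) (real k) E u v (estimate (regs s' ''num'') (regs s' ''den''))))"
    unfolding dynamic_apsp_def by blast
  have "dyn_subdivider k z c K A g P U Q a \<epsilon>"
  proof (intro dyn_subdivider.intro dyn_subdivider_axioms.intro)
    show "subdivider k z" by (rule z(1))
    show "1 \<le> a" "0 \<le> \<epsilon>" by (fact assms)+
    show "vars (prep_prog A) \<subseteq> - range z" "vars (qry_prog A) \<subseteq> - range z" using z(2) by blast+
    show "\<And>\<kappa>. vars (upd_prog A \<kappa>) \<subseteq> - range z" by (rule v)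
  next
    fix n E es m assume "ugraph n E" "lists_edges es E" "card E \<le> m"
    then show "\<exists>t s. exec (word_bound c (n + m)) (prep_prog A) (dyn_input n m es) t s \<and> t \<le> P n m"
      using c[of n m] by blast
  next
    fix n m E s i j T assume "dyn_reach c K A n m E s i j T" "g = Amortized"
    then show "T \<le> P n m + j * U n m" using c[of n m] by blast
  next
    fix n m E s i j T \<kappa> u v assume "dyn_reach c K A n m E s i j T" "\<kappa> \<in> K" "valid_update \<kappa> n m E u v"
    then show "\<exists>t s'. exec (word_bound c (n + m + i)) (upd_prog A \<kappa>) (set_args u v s) t s' \<and>
                (g = Worst_Case \<longrightarrow> t \<le> U n m)" using c[of n m] by blast
  next
    fix n m E s i j T u v assume "dyn_reach c K A n m E s i j T" "u < n" "v < n"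
    then show "\<exists>t s'. exec (word_bound c (n + m + i)) (qry_prog A) (set_args u v s) t s' \<and> t \<le> Q n m \<and>
                is_estimate (regs s' ''num'') (regs s' ''den'') \<and>
                good_estimate (real a + \<epsilon>) (real k) E u v (estimate (regs s' ''num'') (regs s' ''den''))"
      using c[of n m] by blast
  qed
  from dyn_subdivider.dynamic_reduction[OF this]
  show "\<exists>B C. dynamic_apsp g K (real a + (real k + 2) * \<epsilon>) 0 B
           (\<lambda>n m. P (n + k * m) ((k + 1) * m) + C * (n + m + 1))
           (\<lambda>n m. (k + 1) * U (n + k * m) ((k + 1) * m) + C)
           (\<lambda>n m. C * Q (n + k * m) ((k + 1) * m))" by blast
qed

end
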